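(* Let $\mathfrak q$ be an indeterminate. (1) (Ariki--Koike algebras) Let $m\ge1$, let $\bm\lambda=(\lambda^{(1)},\dots,\lambda^{(m)})$ be an $m$-multipartition, and let $\mathscr G_{\bm\lambda}(Z;\mathfrak q,\bm u)=\sum_{\bm\alpha\in\mathscr A_m}(\mathfrak q-1)^{\ell(\bm\alpha)}\chi^{\bm\lambda}_{\bm\alpha}Z^{\bm\alpha}$. For $N\ge1$ let $\mathscr G^{[N]}_{\bm\lambda}$ be obtained from $\mathscr G_{\bm\lambda}$ by setting $z_{i,j}=0$ for all $j>N$. Then $$\mathscr G^{[N]}_{\bm\lambda}(Z;\mathfrak q,\bm u)=\sum_{\kappa}\left(\prod_{i=1}^m\prod_{j=1}^N b^{(i)}_{\kappa_{i,j}}\right)\prod_{r=1}^m s_{\lambda^{(r)}}\bigl[(\mathfrak q-1)Y_{r,N}(\kappa)\bigr],$$ where $\kappa=(\kappa_{i,j})$ runs over $\{0,1,\dots,m\}^{\{1,\dots,m\}\times\{1,\dots,N\}}$, $$Y_{r,N}(\kappa)=\sum_{\substack{1\le i\le m,\,1\le j\le N\\ \kappa_{i,j}\ge r}}z_{i,j},\qquad b^{(i)}_0=1-u_1^{i-1},\quad b^{(i)}_k=u_k^{i-1}-u_{k+1}^{i-1}\ (1\le k\le m-1),\quad b^{(i)}_m=u_m^{i-1}.$$ Consequently $\mathscr G_{\bm\lambda}$ is the coefficientwise stable limit of these finite formulas as $N\to\infty$. (2) (Hecke--Clifford algebras) For every strict partition $\nu$, $$\mathscr G^c_\nu(Z;\mathfrak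 q):=\sum_{\alpha\in\mathscr A_1}(\mathfrak q-1)^{\ell(\alpha)}\zeta^\nu_\alpha(\mathfrak q)Z^\alpha=2^{\frac{-\ell(\nu)+\delta(\nu)}2}\,Q_\nu\bigl[(\mathfrak q-1)Z\bigr].$$ (3) ($\mathfrak q$-rook monoid algebras) For every partition $\lambda$, $$\mathscr G^R_\lambda(Z;\mathfrak q):=\sum_{\alpha\in\mathscr A_1}(\mathfrak q-1)^{\ell(\alpha)}\Upsilon^\lambda_\alpha(\mathfrak q)Z^\alpha=\sigma_Z[\mathfrak q-1]\;s_\lambda\bigl[(\mathfrak q-1)Z\bigr],\qquad \sigma_Z[\mathfrak q-1]=\prod_{j\ge1}\frac{1-z_j}{1-\mathfrak qz_j}.$$
   Context: **Plethysm.** For a symmetric function $f$ and an expression $A$, $f[A]$ is the image of $f$ under the algebra map $p_r\mapsto p_r[A]$, where $p_r[A]$ replaces each variable of the alphabets and $\mathfrak q$ by its $r$th power; e.g. $p_r[(\mathfrak q-1)Z]=(\mathfrak q^r-1)p_r(Z)$. **Index sets.** $\mathscr A_m$ is the set of arrays $\bm\alpha=(\alpha_{i,j})_{1\le i\le m,\,j\ge1}$ of nonnegative integers with finite support; $Z^{\bm\alpha}=\prod_{i,j}z_{i,j}^{\alpha_{i,j}}$, $|\bm\alpha|=\sum\alpha_{i,j}$, $\ell(\bm\alpha)=\#\{(i,j):\alpha_{i,j}>0\}$. For $m=1$ write $Z=z_1+z_2+\cdots$ and $Z^\alpha=\prod_jz_j^{\alpha_j}$. **One-row Hall--Littlewood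 functions.** $\sum_{r\ge0}q_r(X;t)z^r=\prod_i\frac{1-tx_iz}{1-x_iz}$. **Ariki--Koike coefficients.** The base field is $\mathbb C(\mathfrak q,u_1,\dots,u_m)$. Take $m$ independent alphabets $X^{(1)},\dots,X^{(m)}$ and put $s_{\bm\lambda}(X)=\prod_{r}s_{\lambda^{(r)}}(X^{(r)})$. For $1\le i\le m$, $a\ge1$ let $$q^{(i)}_a(X;\mathfrak q,\bm u)=\frac{\mathfrak q^a}{\mathfrak q-1}\sum_{c}u_{\kappa(c)}^{\,i-1}\prod_{r=1}^mq_{c_r}(X^{(r)};\mathfrak q^{-1}),$$ the sum over $c\in\mathbb Z_{\ge0}^m$ with $\sum c_r=a$, where $\kappa(c)=\max\{r:c_r\ne0\}$. The coefficients $\chi^{\bm\lambda}_{\bm\alpha}$ are defined by $$\prod_{(i,j):\alpha_{i,j}>0}q^{(i)}_{\alpha_{i,j}}(X;\mathfrak q,\bm u)=\sum_{\bm\lambda}\chi^{\bm\lambda}_{\bm\alpha}\,s_{\bm\lambda}(X),$$ the sum over all $m$-multipartitions (so $\chi^{\bm\lambda}_{\bm\alpha}=0$ unless $|\bm\lambda|=|\bm\alpha|$). By Shoji's Frobenius formula, when $\bm\alpha$ is a multipartition of $n$ this is the value of the irreducible character of the Ariki--Koike algebra of type $G(m,1,n)$ labelled $\bm\lambda$ on Shoji's standard element labelled $\bm\alpha$. **Hecke--Clifford coefficients.** Let $\sum_{n\ge0}q_n(X)z^n=\prod_i\frac{1+x_iz}{1-x_iz}$, let $Q_\nu$ ($\nu$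 strict) be the Schur $Q$-functions, $\tilde q_n=\frac1{\mathfrak q-1}q_n$ for $n\ge1$, and $\delta(\nu)\in\{0,1\}$ with $\delta(\nu)\equiv\ell(\nu)\pmod2$. Then $\zeta^\nu_\alpha(\mathfrak q)$ is defined by $$\prod_{j:\alpha_j>0}\tilde q_{\alpha_j}[(\mathfrak q-1)X]=\sum_{\nu\text{ strict}}2^{-\frac{\ell(\nu)+\delta(\nu)}2}\zeta^\nu_\alpha(\mathfrak q)\,Q_\nu(X);$$ when $\alpha$ is a partition with all parts odd this is the irreducible character value of the Hecke--Clifford algebra. **$\mathfrak q$-rook coefficients.** $\Upsilon^\lambda_\alpha(\mathfrak q)$ is defined by $$\mathfrak q^{|\alpha|}\prod_{j\ge1}q_{\alpha_j}[1+X;\mathfrak q^{-1}]=\sum_\lambda(\mathfrak q-1)^{\ell(\alpha)}\Upsilon^\lambda_\alpha(\mathfrak q)\,s_\lambda(X),$$ where $\sum_aq_a[1+X;t]z^a=\frac{1-tz}{1-z}\prod_i\frac{1-tx_iz}{1-x_iz}$; when $\alpha$ is a partition of $n$ these are irreducible character values of the $\mathfrak q$-rook monoid algebra on standard elements. *)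

theory Defs
  imports
    "HOL-Library.Poly_Mapping"
    "HOL-Library.FuncSet"
    "HOL-Computational_Algebra.Fraction_Field"
    "HOL-Computational_Algebra.Formal_Power_Series"
    "HOL-Combinatorics.Permutations"
    "Jordan_Normal_Form.Determinant"
begin

section \<open>Formal power series in an arbitrary set of variables\<close>

text \<open>
  A series over variables of type \<open>'v\<close> assigns a coefficient to every monomial, i.e. to every
  finitely supported exponent vector.
\<close>

typedef ('v, 'a) mfps = "UNIV :: (('v \<Rightarrow>\<^sub>0 nat) \<Rightarrow> 'a) set"
  morphisms mcoeff Abs_mfps ..

lemma mcoeff_Abs [simp]: "mcoeff (Abs_mfps f) = f"
  by (simp add: Abs_mfps_inverse)

lemma mfps_eqI: "(\<And>\<mu>. mcoeff f \<mu> = mcoeff g \<mu>) \<Longrightarrow> f = g"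
  by (metis ext mcoeff_inject)

lemma finite_below_monomial: "finite {\<beta> :: 'v \<Rightarrow>\<^sub>0 nat. \<exists>\<gamma>. \<beta> + \<gamma> = \<mu>}"
proof -
  let ?F = "{f. \<forall>v. (v \<in> Poly_Mapping.keys \<mu> \<longrightarrow> f v \<in> {..(\<Sum>w\<in>Poly_Mapping.keys \<mu>. Poly_Mapping.lookup \<mu> w)}) \<and> (v \<notin> Poly_Mapping.keys \<mu> \<longrightarrow> f v = 0)}"
  have "finite ?F"
    by (rule finite_set_of_finite_funs) auto
  moreover have "Poly_Mapping.lookup ` {\<beta>. \<exists>\<gamma>. \<beta> + \<gamma> = \<mu>} \<subseteq> ?F"
  proof clarsimp
    fix \<beta> \<gamma> :: "'v \<Rightarrow>\<^sub>0 nat" and v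
    assume "\<mu> = \<beta> + \<gamma>"
    then have le: "Poly_Mapping.lookup \<beta> v \<le> Poly_Mapping.lookup (\<beta> + \<gamma>) v"
      by (simp add: lookup_add)
    show "(v \<in> Poly_Mapping.keys (\<beta> + \<gamma>) \<longrightarrow> Poly_Mapping.lookup \<beta> v \<le> (\<Sum>w\<in>Poly_Mapping.keys (\<beta> + \<gamma>). Poly_Mapping.lookup (\<beta> + \<gamma>) w)) \<and>
          (v \<notin> Poly_Mapping.keys (\<beta> + \<gamma>) \<longrightarrow> Poly_Mapping.lookup \<beta> v = 0)"
    proof (intro conjI impI)
      assume "v \<in> Poly_Mapping.keys (\<beta> + \<gamma>)"
      then have "Poly_Mapping.lookup (\<beta> + \<gamma>) v \<le> (\<Sum>w\<in>Poly_Mapping.keys (\<beta> + \<gamma>). Poly_Mapping.lookup (\<beta> + \<gamma>) w)"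
        by (intro member_le_sum) auto
      with le show "Poly_Mapping.lookup \<beta> v \<le> (\<Sum>w\<in>Poly_Mapping.keys (\<beta> + \<gamma>). Poly_Mapping.lookup (\<beta> + \<gamma>) w)" by linarith
    next
      assume "v \<notin> Poly_Mapping.keys (\<beta> + \<gamma>)"
      with le show "Poly_Mapping.lookup \<beta> v = 0" by (simp add: in_keys_iff)
    qed
  qed
  ultimately have "finite (Poly_Mapping.lookup ` {\<beta>. \<exists>\<gamma>. \<beta> + \<gamma> = \<mu>})"
    by (rule rev_finite_subset)
  then show ?thesis
    by (rule finite_imageD) (rule inj_onI, rule poly_mapping_eqI, simp)
qed

lemma finite_monomial_splits: "finite {(\<beta>, \<gamma>). \<beta> + \<gamma> = (\<mu> :: 'v \<Rightarrow>\<^sub>0 nat)}"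
proof (rule finite_subset)
  show "{(\<beta>, \<gamma>). \<beta> + \<gamma> = \<mu>} \<subseteq> {\<beta>. \<exists>\<gamma>. \<beta> + \<gamma> = \<mu>} \<times> {\<beta>. \<exists>\<gamma>. \<beta> + \<gamma> = \<mu>}"
    by (auto; metis add.commute)
  show "finite ({\<beta>. \<exists>\<gamma>. \<beta> + \<gamma> = \<mu>} \<times> {\<beta>. \<exists>\<gamma>. \<beta> + \<gamma> = \<mu>})"
    by (intro finite_cartesian_product finite_below_monomial)
qed

instantiation mfps :: (type, comm_ring_1) comm_ring_1
begin

definition "0 = Abs_mfps (\<lambda>_. 0)"
definition "1 = Abs_mfps (\<lambda>\<mu>. if \<mu> = 0 then 1 else 0)"
definition "f + g = Abs_mfps (\<lambda>\<mu>. mcoeff f \<mu> + mcoeff g \<mu>)"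
definition "f - g = Abs_mfps (\<lambda>\<mu>. mcoeff f \<mu> - mcoeff g \<mu>)"
definition "- f = Abs_mfps (\<lambda>\<mu>. - mcoeff f \<mu>)"
definition "f * g = Abs_mfps (\<lambda>\<mu>. \<Sum>(\<beta>, \<gamma>) | \<beta> + \<gamma> = \<mu>. mcoeff f \<beta> * mcoeff g \<gamma>)"

instance
proof
  fix f g h :: "('a, 'b) mfps"
  show "f * g * h = f * (g * h)"
  proof (rule mfps_eqI)
    fix \<mu> :: "'a \<Rightarrow>\<^sub>0 nat"
    define S where "S = (\<lambda>\<mu>. {(\<beta>, \<gamma>). \<beta> + \<gamma> = (\<mu> :: 'a \<Rightarrow>\<^sub>0 nat)})"
    have fin: "finite (S \<nu>)" for \<nu>
      unfolding S_def by (rule finite_monomial_splits)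
    have S: "(p \<in> S \<nu>) = (fst p + snd p = \<nu>)" for p \<nu>
      by (simp add: S_def case_prod_unfold)
    have times: "mcoeff (x * y) \<nu> = (\<Sum>p\<in>S \<nu>. mcoeff x (fst p) * mcoeff y (snd p))"
      for x y :: "('a, 'b) mfps" and \<nu>
      by (simp add: times_mfps_def S_def case_prod_unfold)
    have "mcoeff (f * g * h) \<mu> =
        (\<Sum>p\<in>S \<mu>. \<Sum>q\<in>S (fst p). mcoeff f (fst q) * mcoeff g (snd q) * mcoeff h (snd p))"
      unfolding times sum_distrib_right ..
    also have "\<dots> = (\<Sum>(p, q) \<in> (SIGMA p:S \<mu>. S (fst p)).
        mcoeff f (fst q) * mcoeff g (snd q) * mcoeff h (snd p))"
      by (rule sum.Sigma) (simp_all add: fin)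
    also have "\<dots> = (\<Sum>(p, q) \<in> (SIGMA p:S \<mu>. S (snd p)).
        mcoeff f (fst p) * (mcoeff g (fst q) * mcoeff h (snd q)))"
      by (rule sum.reindex_bij_witness[where
            i = "\<lambda>(p, q). ((fst p + fst q, snd q), (fst p, fst q))" and
            j = "\<lambda>(p, q). ((fst q, snd q + snd p), (snd q, snd p))"])
         (auto simp: S add.assoc mult.assoc)
    also have "\<dots> = (\<Sum>p\<in>S \<mu>. \<Sum>q\<in>S (snd p).
        mcoeff f (fst p) * (mcoeff g (fst q) * mcoeff h (snd q)))"
      by (rule sum.Sigma[symmetric]) (simp_all add: fin)
    also have "\<dots> = mcoeff (f * (g * h)) \<mu>"
      unfolding times sum_distrib_left ..
    finally show "mcoeff (f * g * h) \<mu> = mcoeff (f * (g * h)) \<mu>" .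
  qed
  show "f * g = g * f"
  proof (rule mfps_eqI)
    fix \<mu> :: "'a \<Rightarrow>\<^sub>0 nat"
    show "mcoeff (f * g) \<mu> = mcoeff (g * f) \<mu>"
      unfolding times_mfps_def mcoeff_Abs
      by (rule sum.reindex_bij_witness[where i = prod.swap and j = prod.swap])
         (auto simp: add_ac mult_ac)
  qed
  show "1 * f = f"
  proof (rule mfps_eqI)
    fix \<mu> :: "'a \<Rightarrow>\<^sub>0 nat"
    have "mcoeff (1 * f) \<mu> = (\<Sum>p | fst p + snd p = \<mu>. mcoeff 1 (fst p) * mcoeff f (snd p))"
      by (simp add: times_mfps_def case_prod_unfold)
    also have "\<dots> = (\<Sum>p \<in> {(0, \<mu>)}. mcoeff 1 (fst p) * mcoeff f (snd p))"
      using finite_monomial_splits[of \<mu>]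
      by (intro sum.mono_neutral_right) (auto simp: case_prod_unfold one_mfps_def)
    also have "\<dots> = mcoeff f \<mu>"
      by (simp add: one_mfps_def)
    finally show "mcoeff (1 * f) \<mu> = mcoeff f \<mu>" .
  qed
  show "(f + g) * h = f * h + g * h"
    by (rule mfps_eqI)
       (simp add: times_mfps_def plus_mfps_def distrib_right case_prod_unfold sum.distrib)
  show "(0 :: ('a, 'b) mfps) \<noteq> 1"
  proof
    assume "(0 :: ('a, 'b) mfps) = 1"
    then have "mcoeff (0 :: ('a, 'b) mfps) 0 = mcoeff 1 0" by (rule arg_cong)
    then show False by (simp add: zero_mfps_def one_mfps_def)
  qed
  show "f + g + h = f + (g + h)"
    by (simp add: plus_mfps_def add.assoc)
  show "f + g = g + f"
    by (simp add: plus_mfps_def add.commute)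
  show "0 + f = f"
    by (rule mfps_eqI) (simp add: plus_mfps_def zero_mfps_def)
  show "- f + f = 0"
    by (simp add: plus_mfps_def uminus_mfps_def zero_mfps_def)
  show "f - g = f + - g"
    by (simp add: plus_mfps_def uminus_mfps_def minus_mfps_def)
qed

end

definition mconst :: "'a \<Rightarrow> ('v, 'a::comm_ring_1) mfps" where
  "mconst c = Abs_mfps (\<lambda>\<mu>. if \<mu> = 0 then c else 0)"

definition mvar :: "'v \<Rightarrow> ('v, 'a::comm_ring_1) mfps" where
  "mvar v = Abs_mfps (\<lambda>\<mu>. if \<mu> = Poly_Mapping.single v 1 then 1 else 0)"

text \<open>The sum of all variables in \<open>V\<close>, for a possibly infinite set \<open>V\<close>.\<close>

definition alphabet :: "'v set \<Rightarrow> ('v, 'a::comm_ring_1) mfps" where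
  "alphabet V = Abs_mfps (\<lambda>\<mu>. if \<exists>v\<in>V. \<mu> = Poly_Mapping.single v 1 then 1 else 0)"

definition restrict_vars :: "'v set \<Rightarrow> ('v, 'a::comm_ring_1) mfps \<Rightarrow> ('v, 'a) mfps" where
  \<comment> \<open>sets every variable outside \<open>V\<close> to zero\<close>
  "restrict_vars V f = Abs_mfps (\<lambda>\<mu>. if Poly_Mapping.keys \<mu> \<subseteq> V then mcoeff f \<mu> else 0)"

definition stable_limit :: "(nat \<Rightarrow> ('v, 'a) mfps) \<Rightarrow> ('v, 'a) mfps \<Rightarrow> bool" where
  "stable_limit F f \<longleftrightarrow> (\<forall>\<mu>. \<forall>\<^sub>F n in sequentially. mcoeff (F n) \<mu> = mcoeff f \<mu>)"

definition mlim :: "(nat \<Rightarrow> ('v, 'a) mfps) \<Rightarrow> ('v, 'a) mfps" where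
  "mlim F = (THE f. stable_limit F f)"

definition recip :: "'a::comm_ring_1 \<Rightarrow> 'a" where
  "recip x = (THE y. x * y = 1)"


section \<open>The base field\<close>

text \<open>
  The field of rational functions over the complex numbers in the indeterminates
  \<open>qq\<close>, \<open>uu 1\<close>, \<open>uu 2\<close>, \dots. It contains \<open>\<complex>(qq, uu 1, \<dots>, uu m)\<close> for all \<open>m\<close> at once,
  so \<open>m\<close> can be quantified inside a formula.
\<close>

type_synonym K = "((nat \<Rightarrow>\<^sub>0 nat) \<Rightarrow>\<^sub>0 complex) fract"

definition K_const :: "complex \<Rightarrow> K" where
  "K_const c = Fract (Poly_Mapping.single 0 c) 1"

definition K_var :: "nat \<Rightarrow> K" where
  "K_var k = Fract (Poly_Mapping.single (Poly_Mapping.single k 1) 1) 1"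

definition qq :: K where "qq = K_var 0"

definition uu :: "nat \<Rightarrow> K" where
  \<comment> \<open>only used for \<open>k \<ge> 1\<close>\<close>
  "uu k = K_var k"


section \<open>Plethysm\<close>

text \<open>
  A plethystic expression is a series in its alphabets with coefficients in \<open>\<complex>[qq]\<close>; the
  variable of \<^typ>\<open>complex poly\<close> stands for \<open>qq\<close>.
\<close>

type_synonym 'v expression = "('v, complex poly) mfps"

definition q_minus_1 :: "'v expression" where
  "q_minus_1 = mconst [:-1, 1:]"

text \<open>
  \<open>power_sum r A\<close> is \<open>p\<^sub>r[A]\<close>: every alphabet variable and \<open>qq\<close> are replaced by their
  \<open>r\<close>-th powers. For \<open>r \<ge> 1\<close> the inner sum has at most one term.
\<close>

definition power_sum :: "nat \<Rightarrow> 'v expression \<Rightarrow> ('v, K) mfps" where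
  "power_sum r A = Abs_mfps (\<lambda>\<nu>. \<Sum>\<mu> | Poly_Mapping.map ((*) r) \<mu> = \<nu>.
     poly (map_poly K_const (mcoeff A \<mu>)) (qq ^ r))"

text \<open>
  Polynomials in the power sums: variable \<open>r\<close> of the polynomial stands for \<open>p\<^bsub>r+1\<^esub>\<close>.
\<close>

definition eval_power_sums :: "((nat \<Rightarrow>\<^sub>0 nat) \<Rightarrow>\<^sub>0 K) \<Rightarrow> 'v expression \<Rightarrow> ('v, K) mfps" where
  "eval_power_sums P A = (\<Sum>\<mu>\<in>Poly_Mapping.keys P. mconst (Poly_Mapping.lookup P \<mu>) *
     (\<Prod>r\<in>Poly_Mapping.keys \<mu>. power_sum (Suc r) A ^ Poly_Mapping.lookup \<mu> r))"

text \<open>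
  Symmetric functions are elements of the subring of \<^typ>\<open>(nat, K) mfps\<close> generated over
  \<^typ>\<open>K\<close> by the power sums of the alphabet of all variables. As these are algebraically
  independent, the polynomial below is unique.
\<close>

definition plethysm :: "(nat, K) mfps \<Rightarrow> 'v expression \<Rightarrow> ('v, K) mfps" where
  "plethysm f A = eval_power_sums (THE P. eval_power_sums P (alphabet UNIV) = f) A"


section \<open>Symmetric functions\<close>

text \<open>
  \<open>hall_littlewood_q t r\<close> is the coefficient of \<open>z\<^sup>r\<close> in the product of all
  \<open>(1 - t x\<^sub>i z) / (1 - x\<^sub>i z)\<close>.
\<close>

definition hall_littlewood_q :: "K \<Rightarrow> nat \<Rightarrow> (nat, K) mfps" where
  "hall_littlewood_q t r = mlim (\<lambda>n. fps_nth
     (\<Prod>i<n. (1 - fps_const (mconst t * mvar i) * fps_X) *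
             recip (1 - fps_const (mvar i) * fps_X)) r)"

definition complete_h :: "int \<Rightarrow> (nat, K) mfps" where
  "complete_h k = (if k < 0 then 0 else hall_littlewood_q 0 (nat k))"

abbreviation schur_q :: "nat \<Rightarrow> (nat, K) mfps" where
  "schur_q \<equiv> hall_littlewood_q (-1)"

definition partitions :: "nat list set" where
  "partitions = {\<pi>. sorted_wrt (\<ge>) \<pi> \<and> 0 \<notin> set \<pi>}"

definition strict_partitions :: "nat list set" where
  "strict_partitions = {\<nu>. sorted_wrt (>) \<nu> \<and> 0 \<notin> set \<nu>}"

definition schur :: "nat list \<Rightarrow> (nat, K) mfps" where
  \<comment> \<open>Jacobi--Trudi determinant\<close>
  "schur \<pi> = det (mat (length \<pi>) (length \<pi>)
     (\<lambda>(i, j). complete_h (int (\<pi> ! i) - int i + int j)))"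

text \<open>
  The Pfaffian of the skew-symmetric matrix of size \<open>2n\<close> with entries \<open>M i j\<close> above the
  diagonal; the permutations below are in bijection with the perfect matchings of
  \<open>{..<2n}\<close>.
\<close>

definition pfaffian :: "nat \<Rightarrow> (nat \<Rightarrow> nat \<Rightarrow> 'a::comm_ring_1) \<Rightarrow> 'a" where
  "pfaffian n M = (\<Sum>\<sigma> | \<sigma> permutes {..<2 * n} \<and> (\<forall>i<n. \<sigma> (2 * i) < \<sigma> (2 * i + 1)) \<and>
        (\<forall>j<n. \<forall>i<j. \<sigma> (2 * i) < \<sigma> (2 * j)).
     of_int (sign \<sigma>) * (\<Prod>i<n. M (\<sigma> (2 * i)) (\<sigma> (2 * i + 1))))"

definition schur_Q2 :: "nat \<Rightarrow> nat \<Rightarrow> (nat, K) mfps" where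
  "schur_Q2 r s = schur_q r * schur_q s +
     2 * (\<Sum>k = 1..s. (-1) ^ k * schur_q (r + k) * schur_q (s - k))"

text \<open>
  Schur's definition of the \<open>Q\<close>-functions: the Pfaffian of the two-row functions, where
  \<open>\<nu>\<close> is padded by one zero part if its length is odd.
\<close>

definition schur_Q :: "nat list \<Rightarrow> (nat, K) mfps" where
  "schur_Q \<nu> = (let part = (\<lambda>i. if i < length \<nu> then \<nu> ! i else 0)
     in pfaffian ((length \<nu> + 1) div 2) (\<lambda>i j. schur_Q2 (part i) (part j)))"

text \<open>The coefficients of \<open>f\<close> with respect to a linearly independent family \<open>b\<close> indexed by \<open>I\<close>.\<close>

definition expansion_coeff ::
  "'i set \<Rightarrow> ('i \<Rightarrow> ('v, K) mfps) \<Rightarrow> ('v, K) mfps \<Rightarrow> 'i \<Rightarrow> K" where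
  "expansion_coeff I b f = (THE c. {i. c i \<noteq> 0} \<subseteq> I \<and> finite {i. c i \<noteq> 0} \<and>
     f = (\<Sum>i | c i \<noteq> 0. mconst (c i) * b i))"


section \<open>Ariki--Koike coefficients\<close>

text \<open>
  The variable \<open>(r, i)\<close> is the \<open>i\<close>-th variable of the \<open>r\<close>-th alphabet. Superscripts
  \<open>r\<close> range over \<open>{1..m}\<close>; the variables within an alphabet are numbered from \<open>0\<close>.
\<close>

definition multipartitions :: "nat \<Rightarrow> (nat \<Rightarrow> nat list) set" where
  "multipartitions m = {\<Lambda>. (\<forall>r\<in>{1..m}. \<Lambda> r \<in> partitions) \<and> (\<forall>r. r \<notin> {1..m} \<longrightarrow> \<Lambda> r = [])}"

definition multi_schur :: "nat \<Rightarrow> (nat \<Rightarrow> nat list) \<Rightarrow> (nat \<times> nat, K) mfps" where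
  "multi_schur m \<Lambda> = (\<Prod>r = 1..m. plethysm (schur (\<Lambda> r)) (alphabet ({r} \<times> UNIV)))"

definition arrays :: "nat \<Rightarrow> (nat \<times> nat \<Rightarrow>\<^sub>0 nat) set" where
  "arrays m = {\<alpha>. Poly_Mapping.keys \<alpha> \<subseteq> {1..m} \<times> UNIV}"

definition AK_q :: "nat \<Rightarrow> nat \<Rightarrow> nat \<Rightarrow> (nat \<times> nat, K) mfps" where
  "AK_q m i a = mconst (qq ^ a / (qq - 1)) *
     (\<Sum>c | (\<forall>r. r \<notin> {1..m} \<longrightarrow> c r = 0) \<and> (\<Sum>r = 1..m. c r) = a.
        mconst (uu (Max {r. c r \<noteq> 0}) ^ (i - 1)) *
        (\<Prod>r = 1..m. plethysm (hall_littlewood_q (1 / qq) (c r)) (alphabet ({r} \<times> UNIV))))"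

definition AK_chi :: "nat \<Rightarrow> (nat \<times> nat \<Rightarrow>\<^sub>0 nat) \<Rightarrow> (nat \<Rightarrow> nat list) \<Rightarrow> K" where
  "AK_chi m \<alpha> = expansion_coeff (multipartitions m) (multi_schur m)
     (\<Prod>(i, j)\<in>Poly_Mapping.keys \<alpha>. AK_q m i (Poly_Mapping.lookup \<alpha> (i, j)))"

definition AK_G :: "nat \<Rightarrow> (nat \<Rightarrow> nat list) \<Rightarrow> (nat \<times> nat, K) mfps" where
  "AK_G m \<Lambda> = Abs_mfps (\<lambda>\<alpha>. if \<alpha> \<in> arrays m
     then (qq - 1) ^ card (Poly_Mapping.keys \<alpha>) * AK_chi m \<alpha> \<Lambda> else 0)"

definition AK_b :: "nat \<Rightarrow> nat \<Rightarrow> nat \<Rightarrow> K" where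
  "AK_b m i k = (if k = 0 then 1 - uu 1 ^ (i - 1)
     else if k < m then uu k ^ (i - 1) - uu (k + 1) ^ (i - 1)
     else uu m ^ (i - 1))"

definition AK_Y :: "nat \<Rightarrow> nat \<Rightarrow> nat \<Rightarrow> (nat \<times> nat \<Rightarrow> nat) \<Rightarrow> (nat \<times> nat) expression" where
  "AK_Y m r N \<kappa> = (\<Sum>(i, j) | (i, j) \<in> {1..m} \<times> {..<N} \<and> \<kappa> (i, j) \<ge> r. mvar (i, j))"

definition AK_formula :: "nat \<Rightarrow> nat \<Rightarrow> (nat \<Rightarrow> nat list) \<Rightarrow> (nat \<times> nat, K) mfps" where
  "AK_formula m N \<Lambda> = (\<Sum>\<kappa> \<in> ({1..m} \<times> {..<N}) \<rightarrow>\<^sub>E {0..m}.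
     mconst (\<Prod>i = 1..m. \<Prod>j<N. AK_b m i (\<kappa> (i, j))) *
     (\<Prod>r = 1..m. plethysm (schur (\<Lambda> r)) (q_minus_1 * AK_Y m r N \<kappa>)))"


section \<open>Hecke--Clifford coefficients\<close>

definition delta :: "nat list \<Rightarrow> nat" where
  "delta \<nu> = length \<nu> mod 2"

definition schur_q_tilde :: "nat \<Rightarrow> (nat, K) mfps" where
  "schur_q_tilde n = mconst (1 / (qq - 1)) * schur_q n"

definition HC_zeta :: "(nat \<Rightarrow>\<^sub>0 nat) \<Rightarrow> nat list \<Rightarrow> K" where
  "HC_zeta \<alpha> = expansion_coeff strict_partitions
     (\<lambda>\<nu>. mconst (2 powi (- (int (length \<nu> + delta \<nu>) div 2))) * schur_Q \<nu>)
     (\<Prod>j\<in>Poly_Mapping.keys \<alpha>. plethysm (schur_q_tilde (Poly_Mapping.lookup \<alpha> j)) (q_minus_1 * alphabet UNIV))"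

definition HC_G :: "nat list \<Rightarrow> (nat, K) mfps" where
  "HC_G \<nu> = Abs_mfps (\<lambda>\<alpha>. (qq - 1) ^ card (Poly_Mapping.keys \<alpha>) * HC_zeta \<alpha> \<nu>)"


section \<open>Rook monoid coefficients\<close>

text \<open>As \<open>q\<^sub>0 = 1\<close>, the product over all \<open>j\<close> reduces to the support of \<open>\<alpha>\<close>.\<close>

definition rook_Upsilon :: "(nat \<Rightarrow>\<^sub>0 nat) \<Rightarrow> nat list \<Rightarrow> K" where
  "rook_Upsilon \<alpha> = expansion_coeff partitions
     (\<lambda>\<pi>. mconst ((qq - 1) ^ card (Poly_Mapping.keys \<alpha>)) * schur \<pi>)
     (mconst (qq ^ (\<Sum>j\<in>Poly_Mapping.keys \<alpha>. Poly_Mapping.lookup \<alpha> j)) *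
      (\<Prod>j\<in>Poly_Mapping.keys \<alpha>. plethysm (hall_littlewood_q (1 / qq) (Poly_Mapping.lookup \<alpha> j)) (1 + alphabet UNIV)))"

definition rook_G :: "nat list \<Rightarrow> (nat, K) mfps" where
  "rook_G \<pi> = Abs_mfps (\<lambda>\<alpha>. (qq - 1) ^ card (Poly_Mapping.keys \<alpha>) * rook_Upsilon \<alpha> \<pi>)"

definition sigma_Z :: "(nat, K) mfps" where
  "sigma_Z = mlim (\<lambda>n. \<Prod>j<n. (1 - mvar j) * recip (1 - mconst qq * mvar j))"

end

theory Submission
  imports Defs
begin

text \<open>
  On polynomials in the power sums, the Hall form has the exponential series \<open>exp (\<Sum> b\<^sub>i p\<^sub>i z\<^sup>i / g\<^sub>i)\<close> as
  reproducing kernels: the coefficient of \<open>Z\<^sup>\<alpha>\<close> in the evaluation \<open>p\<^sub>i \<mapsto> \<Sum>\<^sub>v b\<^sub>v\<^sub>,\<^sub>i z\<^sub>v\<^sup>i\<close> of \<open>F\<close> is the pairing of \<open>F\<close>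
  with a product of coefficients of such series. For \<open>b\<^sub>i = q\<^sup>i - 1\<close> these coefficients are the one-row functions
  defining the characters, and the evaluation is the plethysm \<open>F[(q - 1) Z]\<close>. As Schur functions are orthonormal for
  the Hall form and Schur Q-functions are orthogonal for its analogue on odd power sums, the pairings are, up to norms,
  the expansion coefficients of the products of one-row functions.

  Orthogonality and spanning come from vertex operators: both families are obtained by applying creation operators to
  \<open>1\<close>, and the commutation relations (Bernstein, Clifford) give orthogonality and a straightening rule. The
  Jacobi--Trudi and Pfaffian formulas are recovered by showing that both sides behave in the same way under
  translation of the alphabet.
\<close>

text \<open>Two definite descriptions stand between the definitions and any computation: the
  polynomial behind \<open>plethysm\<close> and the coefficients behind
  \<open>expansion_coeff\<close>. Both are resolved by the Hall form. Its nondegeneracy gives the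
  algebraic independence of the power sums; orthogonality and spanning give uniqueness and existence
  of the expansions. Hence the work takes place in abstract polynomial rings, and series in X are
  reached through injective evaluations. Determinants and Pfaffians show neither orthogonality nor
  spanning, which is why vertex operators are brought in.

  Origin of the constants: a Q-function has square norm 2^l, and dividing by it and by the
  normalisation 2^(-(l+delta)/2) leaves 2^((-l+delta)/2). In the rook case the alphabet 1 + X gives
  every one-row function a constant term, and the products of these are the coefficients of
  \<open>sigma_Z\<close>. In the Ariki-Koike case each variable z_(i,j) chooses a colour \<kappa>
  with weight b_\<kappa>; colour 0 completes the sum of the weights to 1, so that variables with
  exponent 0 contribute a factor 1.\<close>

unbundle fps_syntax
no_notation vec_index (infixl "$" 100)

section \<open>Polynomials as finitely supported functions\<close>

type_synonym ('i, 'k) pl = "('i \<Rightarrow>\<^sub>0 nat) \<Rightarrow>\<^sub>0 'k"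

definition pconst :: "'k \<Rightarrow> ('i, 'k::comm_ring_1) pl" where
  "pconst c = Poly_Mapping.single 0 c"

definition pvar :: "'i \<Rightarrow> ('i, 'k::comm_ring_1) pl" where
  "pvar i = Poly_Mapping.single (Poly_Mapping.single i 1) 1"

lemma comm_ring_hom_pconst: "comm_ring_hom (pconst :: 'k::comm_ring_1 \<Rightarrow> ('i, 'k) pl)"
  by unfold_locales (simp_all add: pconst_def single_add mult_single)

interpretation pconst: comm_ring_hom "pconst :: 'k::comm_ring_1 \<Rightarrow> ('i, 'k) pl"
  by (rule comm_ring_hom_pconst)

text \<open>Turns the step of \<open>update_induct\<close> into the addition of one term, the form
  in which additive maps can use it.\<close>

lemma keys_add_single:
  "i \<notin> Poly_Mapping.keys \<mu> \<Longrightarrow> Poly_Mapping.update i n \<mu> = Poly_Mapping.single i n + (\<mu> :: 'i \<Rightarrow>\<^sub>0 'b::comm_monoid_add)"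
  by (rule poly_mapping_eqI) (auto simp: lookup_update lookup_add lookup_single when_def in_keys_iff)

lemma pvar_power: "pvar i ^ n = Poly_Mapping.single (Poly_Mapping.single i n) (1::'k::comm_ring_1)"
proof (induction n)
  case (Suc n)
  then show ?case
    by (simp add: pvar_def mult_single flip: single_add)
qed simp

text \<open>The inductive step multiplies by a single variable, because multiplication by one
  variable has a simple adjoint for the form and a simple image under every evaluation.\<close>

lemma pl_induct [case_names const add var]:
  fixes F :: "('i, 'k::comm_ring_1) pl"
  assumes const: "\<And>c. P (pconst c)"
    and add: "\<And>F G. P F \<Longrightarrow> P G \<Longrightarrow> P (F + G)"
    and var: "\<And>i F. P F \<Longrightarrow> P (pvar i * F)"
  shows "P F"
proof (induction F rule: update_induct)
  case const
  then show ?case using assms(1)[of 0] by simp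
next
  case (update F \<mu> c)
  have "P (pvar i ^ n * G)" if "P G" for i n G
    using that by (induction n) (simp_all add: var mult.assoc)
  then have "P (Poly_Mapping.single \<mu> c)"
  proof (induction \<mu> rule: update_induct)
    case const
    then show ?case using assms(1)[of c] by (simp add: pconst_def)
  next
    case (update \<mu> i n)
    then have "P (pvar i ^ n * Poly_Mapping.single \<mu> c)" by blast
    then show ?case using update by (simp add: pvar_power mult_single keys_add_single)
  qed
  then show ?case using update add by (simp add: keys_add_single)
qed

section \<open>Evaluation homomorphisms\<close>

definition poly_eval :: "('k::comm_ring_1 \<Rightarrow> 'r::comm_ring_1) \<Rightarrow> ('i \<Rightarrow> 'r) \<Rightarrow> ('i, 'k) pl \<Rightarrow> 'r" where
  "poly_eval \<kappa> \<theta> F = (\<Sum>\<mu>\<in>Poly_Mapping.keys F. \<kappa> (Poly_Mapping.lookup F \<mu>) *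
     (\<Prod>i\<in>Poly_Mapping.keys \<mu>. \<theta> i ^ Poly_Mapping.lookup \<mu> i))"

context
  fixes \<kappa> :: "'k::comm_ring_1 \<Rightarrow> 'r::comm_ring_1" and \<theta> :: "'i \<Rightarrow> 'r"
  assumes \<kappa>: "comm_ring_hom \<kappa>"
begin

interpretation \<kappa>: comm_ring_hom \<kappa> by (rule \<kappa>)

lemma poly_eval_add: "poly_eval \<kappa> \<theta> (F + G) = poly_eval \<kappa> \<theta> F + poly_eval \<kappa> \<theta> G"
  unfolding poly_eval_def
  by (rule setsum_keys_plus_distrib) (simp_all add: \<kappa>.hom_add distrib_right)

lemma poly_eval_pconst [simp]: "poly_eval \<kappa> \<theta> (pconst c) = \<kappa> c"
  by (simp add: poly_eval_def pconst_def)

lemma poly_eval_single: "poly_eval \<kappa> \<theta> (Poly_Mapping.single \<mu> c) =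
    \<kappa> c * (\<Prod>i\<in>Poly_Mapping.keys \<mu>. \<theta> i ^ Poly_Mapping.lookup \<mu> i)"
  by (simp add: poly_eval_def)

lemma poly_eval_pvar [simp]: "poly_eval \<kappa> \<theta> (pvar i) = \<theta> i"
  by (simp add: poly_eval_single pvar_def)

lemma monomial_prod_add:
  "(\<Prod>i\<in>Poly_Mapping.keys (\<mu> + \<nu>). \<theta> i ^ Poly_Mapping.lookup (\<mu> + \<nu>) i) =
   (\<Prod>i\<in>Poly_Mapping.keys \<mu>. \<theta> i ^ Poly_Mapping.lookup \<mu> i) *
   (\<Prod>i\<in>Poly_Mapping.keys \<nu>. \<theta> i ^ Poly_Mapping.lookup \<nu> i)"
proof -
  let ?S = "Poly_Mapping.keys \<mu> \<union> Poly_Mapping.keys \<nu>"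
  have *: "(\<Prod>i\<in>Poly_Mapping.keys \<rho>. \<theta> i ^ Poly_Mapping.lookup \<rho> i) = (\<Prod>i\<in>?S. \<theta> i ^ Poly_Mapping.lookup \<rho> i)"
    if "Poly_Mapping.keys \<rho> \<subseteq> ?S" for \<rho>
    using that by (intro prod.mono_neutral_left) (auto simp: in_keys_iff)
  show ?thesis
    unfolding *[OF keys_add] *[OF Un_upper1] *[OF Un_upper2]
    by (simp add: lookup_add power_add prod.distrib)
qed

lemma poly_eval_single_mult:
  "poly_eval \<kappa> \<theta> (Poly_Mapping.single \<mu> c * F) =
   poly_eval \<kappa> \<theta> (Poly_Mapping.single \<mu> c) * poly_eval \<kappa> \<theta> F"
proof (induction F rule: update_induct)
  case const
  then show ?case by (simp add: poly_eval_def)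
next
  case (update F \<nu> d)
  then show ?case
    by (simp add: keys_add_single distrib_left mult_single poly_eval_add poly_eval_single
        monomial_prod_add \<kappa>.hom_mult mult_ac)
qed

lemma poly_eval_mult: "poly_eval \<kappa> \<theta> (F * G) = poly_eval \<kappa> \<theta> F * poly_eval \<kappa> \<theta> G"
proof (induction F rule: update_induct)
  case const
  then show ?case by (simp add: poly_eval_def)
next
  case (update F \<nu> d)
  then show ?case
    by (simp add: keys_add_single distrib_right poly_eval_add poly_eval_single_mult)
qed

lemma comm_ring_hom_poly_eval: "comm_ring_hom (poly_eval \<kappa> \<theta>)"
proof
  show "poly_eval \<kappa> \<theta> 1 = 1"
    using poly_eval_pconst[of 1] by simp
  show "poly_eval \<kappa> \<theta> 0 = 0"
    by (simp add: poly_eval_def)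
qed (simp_all add: poly_eval_add poly_eval_mult)

end

lemma pl_hom_eqI:
  assumes "comm_ring_hom \<phi>" "comm_ring_hom \<psi>"
    and "\<And>c. \<phi> (pconst c) = \<psi> (pconst c)" "\<And>i. \<phi> (pvar i) = \<psi> (pvar i)"
  shows "\<phi> F = \<psi> F"
proof -
  interpret \<phi>: comm_ring_hom \<phi> by fact
  interpret \<psi>: comm_ring_hom \<psi> by fact
  show ?thesis
    by (induction F rule: pl_induct)
       (simp_all add: assms \<phi>.hom_add \<psi>.hom_add \<phi>.hom_mult \<psi>.hom_mult)
qed

lemma comm_ring_hom_comp:
  assumes "comm_ring_hom f" "comm_ring_hom g"
  shows "comm_ring_hom (f \<circ> g)"
proof -
  interpret f: comm_ring_hom f by fact
  interpret g: comm_ring_hom g by fact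
  show ?thesis
    by unfold_locales (simp_all add: f.hom_add g.hom_add f.hom_mult g.hom_mult)
qed

lemma comm_ring_hom_id: "comm_ring_hom (\<lambda>x::'a::comm_ring_1. x)"
  by unfold_locales auto

lemma comm_ring_hom_fps_const: "comm_ring_hom (fps_const :: 'a::comm_ring_1 \<Rightarrow> 'a fps)"
  by unfold_locales auto

interpretation fps_const: comm_ring_hom "fps_const :: 'a::comm_ring_1 \<Rightarrow> 'a fps"
  by (rule comm_ring_hom_fps_const)

lemma poly_eval_comp:
  assumes "comm_ring_hom \<phi>" "comm_ring_hom \<kappa>"
  shows "\<phi> (poly_eval \<kappa> \<theta> F) = poly_eval (\<phi> \<circ> \<kappa>) (\<phi> \<circ> \<theta>) F"
proof -
  have "(\<phi> \<circ> poly_eval \<kappa> \<theta>) F = poly_eval (\<phi> \<circ> \<kappa>) (\<phi> \<circ> \<theta>) F"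
    by (rule pl_hom_eqI) (simp_all add: comm_ring_hom_comp comm_ring_hom_poly_eval assms del: o_apply, simp_all add: assms comm_ring_hom_comp)
  then show ?thesis by simp
qed

lemma lookup_pconst_mult [simp]: "Poly_Mapping.lookup (pconst c * F) \<mu> = c * Poly_Mapping.lookup F \<mu>"
  unfolding pconst_def mult_map_scale_conv_mult[symmetric] by (simp add: Poly_Mapping.map.rep_eq when_def)

lemma lookup_pvar_mult:
  "Poly_Mapping.lookup (pvar i * F) \<mu> =
    (if Poly_Mapping.lookup \<mu> i = 0 then 0 else Poly_Mapping.lookup F (\<mu> - Poly_Mapping.single i 1))"
proof (induction F rule: update_induct)
  case const
  then show ?case by simp
next
  case (update F \<nu> d)
  have "Poly_Mapping.single i 1 + \<nu> = \<mu> \<longleftrightarrow> Poly_Mapping.lookup \<mu> i \<noteq> 0 \<and> \<nu> = \<mu> - Poly_Mapping.single i 1"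
  proof
    assume "Poly_Mapping.single i 1 + \<nu> = \<mu>"
    then show "Poly_Mapping.lookup \<mu> i \<noteq> 0 \<and> \<nu> = \<mu> - Poly_Mapping.single i 1"
      by (auto simp: lookup_add)
  next
    assume "Poly_Mapping.lookup \<mu> i \<noteq> 0 \<and> \<nu> = \<mu> - Poly_Mapping.single i 1"
    then show "Poly_Mapping.single i 1 + \<nu> = \<mu>"
      by (intro poly_mapping_eqI) (auto simp: lookup_add lookup_minus lookup_single when_def)
  qed
  then show ?case
    using update by (auto simp: keys_add_single distrib_left lookup_add pvar_def mult_single lookup_single when_def)
qed

lemma lookup_pconst: "Poly_Mapping.lookup (pconst c) \<mu> = (if \<mu> = 0 then c else 0)"
  by (simp add: pconst_def lookup_single when_def)


section \<open>The exponential differential equation for power series\<close>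

text \<open>The map provides division by positive integers in a ring without division, as formal
  exponentials require.\<close>

locale rat_algebra =
  fixes \<kappa> :: "'k::field_char_0 \<Rightarrow> 'r::comm_ring_1"
  assumes hom: "comm_ring_hom \<kappa>"
begin

interpretation \<kappa>: comm_ring_hom \<kappa> by (rule hom)

lemma of_nat_cancel:
  assumes "of_nat (Suc n) * x = (0::'r)"
  shows "x = 0"
proof -
  have "x = \<kappa> (inverse (of_nat (Suc n)) * of_nat (Suc n)) * x"
    by (simp del: of_nat_Suc)
  also have "\<dots> = \<kappa> (inverse (of_nat (Suc n))) * (of_nat (Suc n) * x)"
    unfolding \<kappa>.hom_mult \<kappa>.hom_of_nat mult.assoc ..
  finally show ?thesis using assms by simp
qed

text \<open>The equation expresses \<open>m + 1\<close> times the coefficient at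
  \<open>m + 1\<close> through earlier coefficients, and the factor can be cancelled.\<close>

lemma linear_ode_unique:
  fixes F :: "'r fps"
  assumes "fps_deriv F = A * F" "F $ 0 = 0"
  shows "F = 0"
proof -
  have "F $ n = 0" for n
  proof (induction n rule: less_induct)
    case (less n)
    show ?case
    proof (cases n)
      case (Suc m)
      have "of_nat (Suc m) * F $ Suc m = (\<Sum>i=0..m. A $ i * F $ (m - i))"
        using arg_cong[OF assms(1), of "\<lambda>G. G $ m"] by (simp add: fps_mult_nth)
      also have "\<dots> = 0"
        using less Suc by simp
      finally show ?thesis using of_nat_cancel Suc by blast
    qed (use assms in simp)
  qed
  then show ?thesis by (simp add: fps_eq_iff)
qed

lemma ode_unique:
  fixes F G :: "'r fps"
  assumes "fps_deriv F = A * F" "fps_deriv G = A * G" "F $ 0 = G $ 0"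
  shows "F = G"
  using linear_ode_unique[of "F - G" A] assms by (simp add: right_diff_distrib)

text \<open>The recursion is the coefficientwise form of F' = A F. Prescribing the logarithmic
  derivative avoids composing power series.\<close>

fun fexp_coeff :: "'r fps \<Rightarrow> nat \<Rightarrow> 'r" where
  "fexp_coeff A 0 = 1"
| "fexp_coeff A (Suc n) = \<kappa> (inverse (of_nat (Suc n))) * (\<Sum>i\<le>n. A $ i * fexp_coeff A (n - i))"

text \<open>\<open>fexp A\<close> is the exponential of the formal integral of \<open>A\<close>.\<close>

definition fexp :: "'r fps \<Rightarrow> 'r fps" where
  "fexp A = Abs_fps (fexp_coeff A)"

lemma fexp_0 [simp]: "fexp A $ 0 = 1"
  by (simp add: fexp_def)

lemma fps_deriv_fexp: "fps_deriv (fexp A) = A * fexp A"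
proof (rule fps_ext)
  fix n
  have "of_nat (Suc n) * \<kappa> (inverse (of_nat (Suc n))) = \<kappa> (of_nat (Suc n) * inverse (of_nat (Suc n)))"
    unfolding \<kappa>.hom_mult \<kappa>.hom_of_nat ..
  also have "\<dots> = 1"
    by (simp del: of_nat_Suc)
  finally have "of_nat (Suc n) * \<kappa> (inverse (of_nat (Suc n))) = 1" .
  then show "fps_deriv (fexp A) $ n = (A * fexp A) $ n"
    unfolding fexp_def
    by (simp add: fps_mult_nth atMost_atLeast0 flip: mult.assoc del: of_nat_Suc)
qed

lemma fexp_Suc: "of_nat (Suc n) * fexp A $ Suc n = (\<Sum>i\<le>n. A $ i * fexp A $ (n - i))"
  using arg_cong[OF fps_deriv_fexp, of "\<lambda>G. G $ n" A] by (simp add: fps_mult_nth atMost_atLeast0)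

lemma fexp_unique: "fps_deriv F = A * F \<Longrightarrow> F $ 0 = 1 \<Longrightarrow> F = fexp A"
  by (rule ode_unique) (simp_all add: fps_deriv_fexp)

lemma fexp_add: "fexp (A + B) = fexp A * fexp B"
  by (rule sym, rule fexp_unique) (simp_all add: fps_deriv_fexp algebra_simps)

lemma fexp_zero [simp]: "fexp 0 = 1"
  by (rule sym, rule fexp_unique) simp_all

lemma fexp_sum: "fexp (\<Sum>i\<in>I. A i) = (\<Prod>i\<in>I. fexp (A i))"
  by (induction I rule: infinite_finite_induct) (simp_all add: fexp_add)

lemma fexp_uminus: "fexp (- A) * fexp A = 1"
  using fexp_add[of "- A" A] by simp

text \<open>The substitution of c z for z: it turns a logarithmic derivative A(z) into c A(c z). It
  later absorbs powers of \<open>qq\<close> and the sign in Q(-z).\<close>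

lemma fexp_scale: "fexp (Abs_fps (\<lambda>i. c ^ Suc i * A $ i)) $ n = c ^ n * fexp A $ n"
proof -
  have "Abs_fps (\<lambda>n. c ^ n * fexp A $ n) = fexp (Abs_fps (\<lambda>i. c ^ Suc i * A $ i))"
  proof (rule fexp_unique)
    show "fps_deriv (Abs_fps (\<lambda>n. c ^ n * fexp A $ n)) =
        Abs_fps (\<lambda>i. c ^ Suc i * A $ i) * Abs_fps (\<lambda>n. c ^ n * fexp A $ n)"
    proof (rule fps_ext)
      fix n
      have "c ^ Suc n = c ^ Suc i * c ^ (n - i)" if "i \<le> n" for i
        using that by (simp flip: power_add power_Suc)
      then have "c ^ Suc n * (A * fexp A) $ n = (\<Sum>i=0..n. c ^ Suc i * A $ i * (c ^ (n - i) * fexp A $ (n - i)))"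
        unfolding fps_mult_nth sum_distrib_left by (intro sum.cong) (auto simp: mult_ac)
      moreover have "of_nat (Suc n) * fexp A $ Suc n = (A * fexp A) $ n"
        using fexp_Suc[of n A] by (simp add: fps_mult_nth atMost_atLeast0)
      ultimately show "fps_deriv (Abs_fps (\<lambda>n. c ^ n * fexp A $ n)) $ n =
        (Abs_fps (\<lambda>i. c ^ Suc i * A $ i) * Abs_fps (\<lambda>n. c ^ n * fexp A $ n)) $ n"
        by (simp add: fps_mult_nth mult_ac mult.left_commute[of "of_nat (Suc n)" "c ^ Suc n"]
            del: of_nat_Suc power_Suc)
    qed
  qed simp
  then show ?thesis by (simp add: fps_eq_iff)
qed

end

text \<open>Each coefficient of an exponential is a polynomial with rational coefficients in earlier
  coefficients of \<open>A\<close>, so an algebra map may be applied inside.\<close>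

lemma fexp_hom:
  assumes "rat_algebra \<kappa>" "rat_algebra \<kappa>'" "comm_ring_hom \<phi>" "\<And>c. \<phi> (\<kappa> c) = \<kappa>' c"
    and "\<And>i. i < n \<Longrightarrow> \<phi> (A $ i) = A' $ i"
  shows "\<phi> (rat_algebra.fexp \<kappa> A $ n) = rat_algebra.fexp \<kappa>' A' $ n"
proof -
  interpret R: rat_algebra \<kappa> by fact
  interpret R': rat_algebra \<kappa>' by fact
  interpret \<phi>: comm_ring_hom \<phi> by fact
  have "m \<le> n \<Longrightarrow> \<phi> (R.fexp A $ m) = R'.fexp A' $ m" for m
  proof (induction m rule: less_induct)
    case (less m)
    show ?case
    proof (cases m)
      case (Suc l)
      show ?thesis
        unfolding R.fexp_def R'.fexp_def Suc
        using less Suc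
        by (auto simp: \<phi>.hom_mult \<phi>.hom_sum assms(4,5) R.fexp_def R'.fexp_def
            intro!: arg_cong2[of _ _ _ _ "(*)"] sum.cong)
    qed (simp add: R.fexp_def R'.fexp_def)
  qed
  then show ?thesis by simp
qed

lemma rat_algebra_pconst: "rat_algebra (pconst :: 'k::field_char_0 \<Rightarrow> ('i, 'k) pl)"
  by (simp add: rat_algebra_def comm_ring_hom_pconst)

lemma rat_algebra_id: "rat_algebra (\<lambda>x::'a::field_char_0. x)"
  by (simp add: rat_algebra_def comm_ring_hom_id)

lemma rat_algebra_comp: "rat_algebra \<kappa> \<Longrightarrow> comm_ring_hom \<phi> \<Longrightarrow> rat_algebra (\<phi> \<circ> \<kappa>)"
  by (simp add: rat_algebra_def comm_ring_hom_comp)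


section \<open>The Hall form\<close>

text \<open>The substitution of \<open>pvar i + fps_X\<close> for \<open>pvar i\<close>. Its linear
  coefficient is the partial derivative, and the Leibniz rule becomes the product rule for linear
  coefficients of series.\<close>

definition dual_hom :: "'i \<Rightarrow> ('i, 'k::comm_ring_1) pl \<Rightarrow> ('i, 'k) pl fps" where
  "dual_hom i = poly_eval (fps_const \<circ> pconst) (\<lambda>j. fps_const (pvar j) + (if j = i then fps_X else 0))"

definition pdiff :: "'i \<Rightarrow> ('i, 'k::comm_ring_1) pl \<Rightarrow> ('i, 'k) pl" where
  "pdiff i F = dual_hom i F $ 1"

lemma comm_ring_hom_fps_pconst: "comm_ring_hom (fps_const \<circ> (pconst :: 'k::comm_ring_1 \<Rightarrow> ('i, 'k) pl))"
  by (rule comm_ring_hom_comp[OF comm_ring_hom_fps_const comm_ring_hom_pconst])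

interpretation dual_hom: comm_ring_hom "dual_hom i :: ('i, 'k::comm_ring_1) pl \<Rightarrow> _"
  unfolding dual_hom_def by (rule comm_ring_hom_poly_eval[OF comm_ring_hom_fps_pconst])

lemma dual_hom_pconst [simp]: "dual_hom i (pconst c) = fps_const (pconst c)"
  by (simp add: dual_hom_def poly_eval_pconst[OF comm_ring_hom_fps_pconst])

lemma dual_hom_pvar [simp]: "dual_hom i (pvar j) = fps_const (pvar j) + (if j = i then fps_X else 0)"
  by (simp add: dual_hom_def poly_eval_pvar[OF comm_ring_hom_fps_pconst])

lemma dual_hom_0 [simp]: "dual_hom i F $ 0 = F"
  by (induction F rule: pl_induct) (simp_all add: dual_hom.hom_add dual_hom.hom_mult)

lemma pdiff_add [simp]: "pdiff i (F + G) = pdiff i F + pdiff i G"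
  by (simp add: pdiff_def dual_hom.hom_add)

lemma pdiff_mult: "pdiff i (F * G) = pdiff i F * G + F * pdiff i G"
  by (simp add: pdiff_def dual_hom.hom_mult fps_mult_nth)

lemma pdiff_pconst [simp]: "pdiff i (pconst c) = 0"
  by (simp add: pdiff_def)

lemma pdiff_pvar [simp]: "pdiff i (pvar j) = (if j = i then 1 else 0)"
  by (simp add: pdiff_def)

lemma pdiff_0 [simp]: "pdiff i 0 = 0"
  by (simp add: pdiff_def)

lemma pdiff_1 [simp]: "pdiff i 1 = 0"
  by (simp add: pdiff_def)

lemma pdiff_of_nat [simp]: "pdiff i (of_nat n) = 0"
  by (induction n) auto

lemma pdiff_sum: "pdiff i (\<Sum>x\<in>S. f x) = (\<Sum>x\<in>S. pdiff i (f x))"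
  by (induction S rule: infinite_finite_induct) auto

lemma pdiff_pconst_mult [simp]: "pdiff i (pconst c * F) = pconst c * pdiff i F"
  by (simp add: pdiff_mult)

lemma pdiff_prod:
  "finite S \<Longrightarrow> pdiff i (\<Prod>x\<in>S. f x) = (\<Sum>x\<in>S. pdiff i (f x) * (\<Prod>y\<in>S - {x}. f y))"
proof (induction S rule: finite_induct)
  case (insert x S)
  have "(\<Prod>y\<in>insert x S - {z}. f y) = f x * (\<Prod>y\<in>S - {z}. f y)" if "z \<in> S" for z
  proof -
    have "insert x S - {z} = insert x (S - {z})"
      using that insert by auto
    then show ?thesis using insert by simp
  qed
  then show ?case
    using insert by (simp add: pdiff_mult sum_distrib_left mult_ac cong: sum.cong)
qed simp

lemma lookup_pdiff: "Poly_Mapping.lookup (pdiff i F) \<mu> =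
    of_nat (Suc (Poly_Mapping.lookup \<mu> i)) * Poly_Mapping.lookup F (\<mu> + Poly_Mapping.single i 1)"
proof (induction F arbitrary: \<mu> rule: pl_induct)
  case (const c)
  have "\<mu> + Poly_Mapping.single i 1 \<noteq> 0"
  proof
    assume "\<mu> + Poly_Mapping.single i 1 = 0"
    then have "Poly_Mapping.lookup (\<mu> + Poly_Mapping.single i 1) i = 0" by simp
    then show False by (simp add: lookup_add)
  qed
  then show ?case by (simp add: lookup_pconst)
next
  case (add F G)
  then show ?case by (simp add: lookup_add distrib_left)
next
  case (var j F)
  show ?case
  proof (cases "j = i")
    case True
    have "Poly_Mapping.lookup \<mu> i \<noteq> 0 \<Longrightarrow> \<mu> - Poly_Mapping.single i 1 + Poly_Mapping.single i 1 = \<mu>"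
      by (intro poly_mapping_eqI) (auto simp: lookup_add lookup_minus lookup_single when_def)
    then show ?thesis
      using True var by (auto simp: pdiff_mult lookup_add lookup_pvar_mult lookup_minus distrib_right add.commute)
        (simp add: algebra_simps)
  next
    case False
    have "Poly_Mapping.lookup \<mu> j \<noteq> 0 \<Longrightarrow>
        \<mu> + Poly_Mapping.single i 1 - Poly_Mapping.single j 1 = \<mu> - Poly_Mapping.single j 1 + Poly_Mapping.single i 1"
      using False by (intro poly_mapping_eqI) (auto simp: lookup_add lookup_minus lookup_single when_def)
    then show ?thesis
      using False var
      by (auto simp: pdiff_mult lookup_add lookup_pvar_mult lookup_minus lookup_single_not_eq)
  qed
qed

text \<open>For \<open>g i = i + 1\<close> this is the usual z_\<mu>, the square norm of a product
  of power sums in the Hall form.\<close>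

definition mono_norm :: "('i \<Rightarrow> 'k::field_char_0) \<Rightarrow> ('i \<Rightarrow>\<^sub>0 nat) \<Rightarrow> 'k" where
  "mono_norm g \<mu> = (\<Prod>i\<in>Poly_Mapping.keys \<mu>. fact (Poly_Mapping.lookup \<mu> i) * g i ^ Poly_Mapping.lookup \<mu> i)"

definition form :: "('i \<Rightarrow> 'k::field_char_0) \<Rightarrow> ('i, 'k) pl \<Rightarrow> ('i, 'k) pl \<Rightarrow> 'k" where
  "form g F G = (\<Sum>\<mu>\<in>Poly_Mapping.keys F. mono_norm g \<mu> * (Poly_Mapping.lookup F \<mu> * Poly_Mapping.lookup G \<mu>))"

lemma form_superset:
  assumes "finite S" "Poly_Mapping.keys F \<subseteq> S"
  shows "form g F G = (\<Sum>\<mu>\<in>S. mono_norm g \<mu> * (Poly_Mapping.lookup F \<mu> * Poly_Mapping.lookup G \<mu>))"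
  unfolding form_def using assms
  by (intro sum.mono_neutral_left) (auto simp: in_keys_iff)

lemma form_commute: "form g F G = form g G F"
proof -
  let ?S = "Poly_Mapping.keys F \<union> Poly_Mapping.keys G"
  show ?thesis
    using form_superset[of ?S F g G] form_superset[of ?S G g F] by (simp add: mult_ac)
qed

lemma form_add_right: "form g F (G + H) = form g F G + form g F H"
  by (simp add: form_def lookup_add algebra_simps sum.distrib)

lemma form_pconst_mult_right: "form g F (pconst c * G) = c * form g F G"
  unfolding form_def lookup_pconst_mult sum_distrib_left by (simp add: mult_ac)

lemma form_add_left: "form g (F + G) H = form g F H + form g G H"
  by (simp add: form_commute[of g _ H] form_add_right)

lemma form_pconst_mult_left: "form g (pconst c * F) G = c * form g F G"
  by (simp add: form_commute[of g _ G] form_pconst_mult_right)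

lemma form_0_left [simp]: "form g 0 G = 0"
  by (simp add: form_def)

lemma form_0_right [simp]: "form g G 0 = 0"
  by (simp add: form_def)

lemma form_sum_right: "form g F (\<Sum>x\<in>S. f x) = (\<Sum>x\<in>S. form g F (f x))"
  by (induction S rule: infinite_finite_induct) (simp_all add: form_add_right)

lemma form_sum_left: "form g (\<Sum>x\<in>S. f x) F = (\<Sum>x\<in>S. form g (f x) F)"
  by (induction S rule: infinite_finite_induct) (simp_all add: form_add_left)

lemma form_pconst_right [simp]: "form g F (pconst c) = Poly_Mapping.lookup F 0 * c"
proof -
  have "form g F (pconst c) = (\<Sum>\<mu>\<in>insert 0 (Poly_Mapping.keys F).
      mono_norm g \<mu> * (Poly_Mapping.lookup F \<mu> * Poly_Mapping.lookup (pconst c) \<mu>))"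
    by (rule form_superset) auto
  also have "\<dots> = (\<Sum>\<mu>\<in>{0}. mono_norm g \<mu> * (Poly_Mapping.lookup F \<mu> * Poly_Mapping.lookup (pconst c) \<mu>))"
    by (rule sum.mono_neutral_right) (auto simp: lookup_pconst)
  finally show ?thesis by (simp add: lookup_pconst mono_norm_def)
qed

lemma form_one_right [simp]: "form g F 1 = Poly_Mapping.lookup F 0"
  using form_pconst_right[of g F 1] by simp

lemma form_one_left [simp]: "form g 1 F = Poly_Mapping.lookup F 0"
  using form_one_right[of g F] by (simp add: form_commute)

lemma mono_norm_superset:
  assumes "finite S" "Poly_Mapping.keys \<mu> \<subseteq> S"
  shows "mono_norm g \<mu> = (\<Prod>i\<in>S. fact (Poly_Mapping.lookup \<mu> i) * g i ^ Poly_Mapping.lookup \<mu> i)"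
  unfolding mono_norm_def using assms
  by (intro prod.mono_neutral_left) (auto simp: in_keys_iff)

lemma mono_norm_add_single:
  "mono_norm g (\<mu> + Poly_Mapping.single i 1) = mono_norm g \<mu> * (g i * of_nat (Suc (Poly_Mapping.lookup \<mu> i)))"
proof -
  let ?S = "insert i (Poly_Mapping.keys \<mu>)"
  have "mono_norm g (\<mu> + Poly_Mapping.single i 1) = (\<Prod>j\<in>?S. fact (Poly_Mapping.lookup (\<mu> + Poly_Mapping.single i 1) j) *
      g j ^ Poly_Mapping.lookup (\<mu> + Poly_Mapping.single i 1) j)"
    using keys_add[of \<mu> "Poly_Mapping.single i (1::nat)"] by (intro mono_norm_superset) auto
  also have "\<dots> = (\<Prod>j\<in>?S. fact (Poly_Mapping.lookup \<mu> j) * g j ^ Poly_Mapping.lookup \<mu> j *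
      (if j = i then g i * of_nat (Suc (Poly_Mapping.lookup \<mu> i)) else 1))"
    by (intro prod.cong) (auto simp: lookup_add lookup_single when_def mult_ac)
  also have "\<dots> = mono_norm g \<mu> * (g i * of_nat (Suc (Poly_Mapping.lookup \<mu> i)))"
  proof -
    have "mono_norm g \<mu> = (\<Prod>j\<in>?S. fact (Poly_Mapping.lookup \<mu> j) * g j ^ Poly_Mapping.lookup \<mu> j)"
      by (rule mono_norm_superset) auto
    moreover have "(\<Prod>j\<in>?S. if j = i then g i * of_nat (Suc (Poly_Mapping.lookup \<mu> i)) else 1) =
        g i * of_nat (Suc (Poly_Mapping.lookup \<mu> i))"
      by (subst prod.delta) auto
    ultimately show ?thesis by (subst prod.distrib) simp
  qed
  finally show ?thesis .
qed

text \<open>Raising one exponent multiplies the norm by \<open>g i\<close> and by the new exponent;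
  the second factor is the one that differentiation produces.\<close>

lemma form_pvar_mult_left: "form g (pvar i * F) G = g i * form g F (pdiff i G)"
proof -
  let ?e = "Poly_Mapping.single i (1::nat)"
  have "Poly_Mapping.keys (pvar i * F) \<subseteq> (\<lambda>\<mu>. \<mu> + ?e) ` Poly_Mapping.keys F"
    using keys_mult[of "pvar i" F] by (auto simp: pvar_def add.commute)
  then have "form g (pvar i * F) G = (\<Sum>\<mu>\<in>(\<lambda>\<mu>. \<mu> + ?e) ` Poly_Mapping.keys F.
      mono_norm g \<mu> * (Poly_Mapping.lookup (pvar i * F) \<mu> * Poly_Mapping.lookup G \<mu>))"
    by (intro form_superset) auto
  also have "\<dots> = (\<Sum>\<mu>\<in>Poly_Mapping.keys F. mono_norm g (\<mu> + ?e) *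
      (Poly_Mapping.lookup (pvar i * F) (\<mu> + ?e) * Poly_Mapping.lookup G (\<mu> + ?e)))"
    by (subst sum.reindex) (auto intro!: inj_onI)
  also have "\<dots> = g i * form g F (pdiff i G)"
  proof -
    have "Poly_Mapping.lookup (pvar i * F) (\<mu> + ?e) = Poly_Mapping.lookup F \<mu>" for \<mu>
      by (simp add: lookup_pvar_mult lookup_add)
    then show ?thesis
      unfolding form_def sum_distrib_left
      by (intro sum.cong) (simp_all only: mono_norm_add_single lookup_pdiff mult_ac)
  qed
  finally show ?thesis .
qed

lemma form_pvar_mult_right: "form g F (pvar i * G) = g i * form g (pdiff i F) G"
  by (simp add: form_commute[of g _ G] form_commute[of g F] form_pvar_mult_left)

lemma lookup_mult_0:
  "Poly_Mapping.lookup (F * G) 0 = Poly_Mapping.lookup F 0 * Poly_Mapping.lookup (G :: ('i, 'k::comm_ring_1) pl) 0"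
proof (induction F rule: pl_induct)
  case (var i F)
  then show ?case by (simp add: mult.assoc lookup_pvar_mult)
qed (simp_all add: distrib_right lookup_add lookup_pconst)

lemma lookup_prod_0:
  "Poly_Mapping.lookup (\<Prod>x\<in>S. f x :: ('i, 'k::comm_ring_1) pl) 0 = (\<Prod>x\<in>S. Poly_Mapping.lookup (f x) 0)"
  by (induction S rule: infinite_finite_induct) (simp_all add: lookup_mult_0)

lemma lookup_pvar_0: "Poly_Mapping.lookup (pvar i :: ('i, 'k::comm_ring_1) pl) 0 = 0"
  using lookup_pvar_mult[of i 1 0] by simp

lemma comm_ring_hom_lookup_0:
  "comm_ring_hom (\<lambda>F :: ('i, 'k::comm_ring_1) pl. Poly_Mapping.lookup F 0)"
  by unfold_locales (simp_all add: lookup_add lookup_mult_0)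


section \<open>Exponential series and translations of the alphabet\<close>

interpretation pexp: rat_algebra "pconst :: 'k::field_char_0 \<Rightarrow> ('i, 'k) pl"
  by (rule rat_algebra_pconst)

interpretation kexp: rat_algebra "\<lambda>x :: 'k::field_char_0. x"
  by (rule rat_algebra_id)

text \<open>Variable \<open>i\<close> stands for a power sum of degree \<open>w i\<close> and norm \<open>g i\<close>.\<close>

locale weights =
  fixes w :: "'i \<Rightarrow> nat" and g :: "'i \<Rightarrow> 'k::field_char_0"
  assumes w_pos: "w i > 0" and g_nonzero: "g i \<noteq> 0"
begin

abbreviation B :: "('i, 'k) pl \<Rightarrow> ('i, 'k) pl \<Rightarrow> 'k" where
  "B \<equiv> form g"

lemma mono_norm_nonzero: "mono_norm g \<mu> \<noteq> 0"
  by (simp add: mono_norm_def g_nonzero)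

text \<open>Pairing with a monomial reads off one coefficient, up to its nonzero norm.\<close>

lemma form_eqI:
  assumes "\<And>F. B F G = B F H"
  shows "G = H"
proof (rule poly_mapping_eqI)
  fix \<mu>
  have "B (Poly_Mapping.single \<mu> 1) G = B (Poly_Mapping.single \<mu> 1) H"
    by (rule assms)
  then show "Poly_Mapping.lookup G \<mu> = Poly_Mapping.lookup H \<mu>"
    by (simp add: form_def mono_norm_nonzero)
qed

text \<open>Differentiating the equation of the exponential by variable \<open>i\<close> yields an
  inhomogeneous linear equation, solved by (b / g_i) z^(w i) times the exponential. Only the
  derivatives of \<open>A\<close> are prescribed, so \<open>A\<close> may have constant parts, as
  happens for the alphabet 1 + X.\<close>

lemma pdiff_fexp:
  assumes A: "\<And>k. pdiff i (A $ k) = (if Suc k = w i then pconst (of_nat (w i) * b / g i) else 0)"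
  shows "pconst (g i) * pdiff i (pexp.fexp A $ k) = (if w i \<le> k then pconst b * pexp.fexp A $ (k - w i) else 0)"
proof -
  let ?E = "pexp.fexp A"
  define dE where "dE = Abs_fps (\<lambda>k. pdiff i (?E $ k))"
  define c where "c = fps_const (pconst (b / g i) :: ('i, 'k) pl)"
  obtain v where v: "w i = Suc v"
    using w_pos[of i] gr0_conv_Suc by blast
  have "Abs_fps (\<lambda>k. pdiff i (A $ k)) = of_nat (w i) * c * fps_X ^ v"
  proof -
    have "of_nat (w i) * c = fps_const (pconst (of_nat (w i) * b / g i))"
      unfolding c_def fps_of_nat[symmetric] pconst.hom_of_nat[symmetric] fps_const_mult
        pconst.hom_mult[symmetric] by simp
    then show ?thesis
      unfolding \<open>of_nat (w i) * c = _\<close> using v by (auto simp: fps_eq_iff A simp del: of_nat_Suc)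
  qed
  moreover have "fps_deriv dE = Abs_fps (\<lambda>k. pdiff i (A $ k)) * ?E + A * dE"
  proof (rule fps_ext)
    fix n
    have "fps_deriv dE $ n = pdiff i (fps_deriv ?E $ n)"
      by (simp add: dE_def pdiff_mult del: of_nat_Suc)
    also have "\<dots> = (Abs_fps (\<lambda>k. pdiff i (A $ k)) * ?E + A * dE) $ n"
      by (simp add: pexp.fps_deriv_fexp fps_mult_nth pdiff_sum pdiff_mult dE_def sum.distrib)
    finally show "fps_deriv dE $ n = (Abs_fps (\<lambda>k. pdiff i (A $ k)) * ?E + A * dE) $ n" .
  qed
  ultimately have ode: "fps_deriv dE = of_nat (w i) * c * fps_X ^ v * ?E + A * dE"
    by simp
  have "fps_deriv (fps_X ^ w i :: ('i, 'k) pl fps) = of_nat (w i) * fps_X ^ v"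
    unfolding fps_deriv_power v fps_of_nat fps_deriv_fps_X by (simp only: diff_Suc_1 mult_1_right)
  \<comment> \<open>The difference from the expected solution satisfies the homogeneous equation
    with initial value 0.\<close>
  then have "fps_deriv (dE - c * fps_X ^ w i * ?E) = A * (dE - c * fps_X ^ w i * ?E)"
    by (simp add: ode pexp.fps_deriv_fexp c_def algebra_simps)
  moreover have "(dE - c * fps_X ^ w i * ?E) $ 0 = 0"
    using v by (simp add: dE_def fps_mult_nth)
  ultimately have "dE - c * fps_X ^ w i * ?E = 0"
    by (rule pexp.linear_ode_unique)
  then have "dE = fps_const (pconst (b / g i)) * (fps_X ^ w i * ?E)"
    by (simp add: c_def mult.assoc)
  then have "dE $ k = pconst (b / g i) * (if k < w i then 0 else ?E $ (k - w i))"
    by (simp add: fps_X_power_mult_nth)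
  then have "pdiff i (?E $ k) = pconst (b / g i) * (if k < w i then 0 else ?E $ (k - w i))"
    by (simp add: dE_def)
  moreover have "pconst (g i) * (pconst (b / g i) :: ('i, 'k) pl) = pconst b"
    using g_nonzero[of i] by (simp flip: pconst.hom_mult)
  ultimately show ?thesis
    by (simp flip: mult.assoc)
qed

text \<open>Ensures that each degree contributes a finite sum to \<open>logder b\<close>; over an
  infinite set that sum would silently be 0. It restricts \<open>b\<close> only where infinitely
  many variables share a degree.\<close>

definition admissible :: "('i \<Rightarrow> 'k) \<Rightarrow> bool" where
  "admissible b \<longleftrightarrow> (\<forall>k. finite {n. w n = k \<and> b n \<noteq> 0})"

text \<open>\<open>Mser b\<close> is the series \<open>\<Prod>\<^sub>i exp (b\<^sub>i p\<^sub>i z\<^bsup>w i\<^esup> / g\<^sub>i)\<close>, given by its logarithmic derivative. Multiplication by its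
  coefficients is adjoint to the translation \<open>p\<^sub>i \<mapsto> p\<^sub>i + b\<^sub>i z\<^bsup>w i\<^esup>\<close>, whose coefficients are the operators \<open>D b k\<close>.\<close>

definition logder :: "('i \<Rightarrow> 'k) \<Rightarrow> ('i, 'k) pl fps" where
  "logder b = Abs_fps (\<lambda>k. \<Sum>n | w n = Suc k \<and> b n \<noteq> 0. pconst (of_nat (w n) * b n / g n) * pvar n)"

definition Mser :: "('i \<Rightarrow> 'k) \<Rightarrow> ('i, 'k) pl fps" where
  "Mser b = pexp.fexp (logder b)"

lemma Mser_0 [simp]: "Mser b $ 0 = 1"
  by (simp add: Mser_def)

lemma pdiff_logder:
  assumes "admissible b"
  shows "pdiff i (logder b $ k) = (if Suc k = w i then pconst (of_nat (w i) * b i / g i) else 0)"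
proof -
  have fin: "finite {n. w n = Suc k \<and> b n \<noteq> 0}"
    using assms by (simp add: admissible_def)
  have "pdiff i (logder b $ k) =
      (\<Sum>n | w n = Suc k \<and> b n \<noteq> 0. if n = i then pconst (of_nat (w i) * b i / g i) else 0)"
    unfolding logder_def by (auto simp: pdiff_sum intro!: sum.cong)
  also have "\<dots> = (if Suc k = w i then pconst (of_nat (w i) * b i / g i) else 0)"
    using fin by (auto simp: sum.delta)
  finally show ?thesis .
qed

lemma pdiff_Mser:
  assumes "admissible b"
  shows "pconst (g i) * pdiff i (Mser b $ k) = (if w i \<le> k then pconst (b i) * Mser b $ (k - w i) else 0)"
  unfolding Mser_def by (rule pdiff_fexp) (rule pdiff_logder[OF assms])

lemma logder_add:
  assumes "admissible b" "admissible c"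
  shows "logder (\<lambda>n. b n + c n) = logder b + logder c"
proof (rule fps_ext)
  fix k
  let ?S = "{n. w n = Suc k \<and> b n \<noteq> 0} \<union> {n. w n = Suc k \<and> c n \<noteq> 0}"
  have fin: "finite ?S"
    using assms by (simp add: admissible_def)
  have *: "logder a $ k = (\<Sum>n\<in>?S. pconst (of_nat (w n) * a n / g n) * pvar n)"
    if "{n. w n = Suc k \<and> a n \<noteq> 0} \<subseteq> ?S" for a
    unfolding logder_def fps_nth_Abs_fps
    by (rule sum.mono_neutral_left) (use fin that in auto)
  show "logder (\<lambda>n. b n + c n) $ k = (logder b + logder c) $ k"
    unfolding fps_add_nth
    by (subst (1 2 3) *)
       (auto simp: sum.distrib[symmetric] pconst.hom_add[symmetric] distrib_left add_divide_distrib
         distrib_right[symmetric] intro!: sum.cong)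
qed

lemma Mser_add:
  assumes "admissible b" "admissible c"
  shows "Mser (\<lambda>n. b n + c n) = Mser b * Mser c"
  by (simp add: Mser_def logder_add assms pexp.fexp_add)

lemma Mser_zero [simp]: "Mser (\<lambda>_. 0) = 1"
proof -
  have "logder (\<lambda>_. 0) = 0"
    by (simp add: logder_def fps_eq_iff)
  then show ?thesis by (simp add: Mser_def)
qed

text \<open>Setting all variables to 0 kills the logarithmic derivative, which leaves the
  exponential of 0.\<close>

lemma lookup_Mser_0: "Poly_Mapping.lookup (Mser b $ k) 0 = (if k = 0 then 1 else 0)"
proof -
  interpret L: comm_ring_hom "\<lambda>F :: ('i, 'k) pl. Poly_Mapping.lookup F 0"
    by (rule comm_ring_hom_lookup_0)
  have "Poly_Mapping.lookup (Mser b $ k) 0 = kexp.fexp 0 $ k"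
    unfolding Mser_def
    by (rule fexp_hom[OF rat_algebra_pconst rat_algebra_id comm_ring_hom_lookup_0])
       (simp_all add: lookup_pconst logder_def L.hom_sum lookup_pvar_0)
  then show ?thesis by simp
qed

section \<open>Translations of the alphabet\<close>

definition Dhom :: "('i \<Rightarrow> 'k) \<Rightarrow> ('i, 'k) pl \<Rightarrow> ('i, 'k) pl fps" where
  "Dhom b = poly_eval (fps_const \<circ> pconst) (\<lambda>n. fps_const (pvar n) + fps_const (pconst (b n)) * fps_X ^ w n)"

definition D :: "('i \<Rightarrow> 'k) \<Rightarrow> nat \<Rightarrow> ('i, 'k) pl \<Rightarrow> ('i, 'k) pl" where
  "D b k F = Dhom b F $ k"

lemma comm_ring_hom_Dhom: "comm_ring_hom (Dhom b)"
  unfolding Dhom_def by (rule comm_ring_hom_poly_eval[OF comm_ring_hom_fps_pconst])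

sublocale Dhom: comm_ring_hom "Dhom b" for b
  by (rule comm_ring_hom_Dhom)

lemma Dhom_pconst [simp]: "Dhom b (pconst c) = fps_const (pconst c)"
  by (simp add: Dhom_def poly_eval_pconst[OF comm_ring_hom_fps_pconst])

lemma Dhom_pvar [simp]: "Dhom b (pvar n) = fps_const (pvar n) + fps_const (pconst (b n)) * fps_X ^ w n"
  by (simp add: Dhom_def poly_eval_pvar[OF comm_ring_hom_fps_pconst])

lemma D_add: "D b k (F + G) = D b k F + D b k G"
  by (simp add: D_def Dhom.hom_add)

lemma D_0 [simp]: "D b k 0 = 0"
  by (simp add: D_def)

lemma D_sum: "D b k (\<Sum>x\<in>S. f x) = (\<Sum>x\<in>S. D b k (f x))"
  by (induction S rule: infinite_finite_induct) (simp_all add: D_add)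

lemma D_mult: "D b k (F * G) = (\<Sum>i\<le>k. D b i F * D b (k - i) G)"
  by (simp add: D_def Dhom.hom_mult fps_mult_nth atMost_atLeast0)

lemma D_pconst: "D b k (pconst c) = (if k = 0 then pconst c else 0)"
  by (simp add: D_def)

lemma D_one: "D b k 1 = (if k = 0 then 1 else 0)"
  using D_pconst[of b k 1] by simp

lemma D_pconst_mult [simp]: "D b k (pconst c * F) = pconst c * D b k F"
  by (simp add: D_def Dhom.hom_mult)

lemma D_pvar_mult: "D b k (pvar n * F) =
    pvar n * D b k F + (if w n \<le> k then pconst (b n) * D b (k - w n) F else 0)"
  by (simp add: D_def Dhom.hom_mult distrib_right mult.assoc fps_X_power_mult_nth)

lemma D_zero_index [simp]: "D b 0 F = F"
proof (induction F rule: pl_induct)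
  case (var i F)
  then show ?case using w_pos[of i] by (simp add: D_pvar_mult)
qed (simp_all add: D_pconst D_add)

text \<open>A translated polynomial is polynomial in the translation parameter; this makes the sums
  over all modes of a vertex operator finite.\<close>

lemma D_eventually_zero: "\<exists>N. \<forall>k>N. D b k F = 0"
proof (induction F rule: pl_induct)
  case (const c)
  then show ?case by (intro exI[of _ 0]) (simp add: D_pconst)
next
  case (add F G)
  then obtain M N where "\<forall>k>M. D b k F = 0" "\<forall>k>N. D b k G = 0" by blast
  then show ?case by (intro exI[of _ "max M N"]) (simp add: D_add)
next
  case (var n F)
  then obtain N where "\<forall>k>N. D b k F = 0" by blast
  then show ?case by (intro exI[of _ "N + w n"]) (simp add: D_pvar_mult)
qed

text \<open>Moving \<open>pvar n\<close> across the form produces a derivative, which by Leibniz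
  hits either \<open>F\<close> or the series coefficient. In the second case
  \<open>pdiff_Mser\<close> lowers the index by \<open>w n\<close>, and the two cases match the two
  terms of \<open>D_pvar_mult\<close>.\<close>

theorem Mser_adjoint:
  assumes b: "admissible b"
  shows "B (Mser b $ k * F) G = B F (D b k G)"
proof (induction G arbitrary: k F rule: pl_induct)
  case (const c)
  then show ?case by (auto simp: D_pconst lookup_mult_0 lookup_Mser_0)
next
  case (add G H)
  then show ?case by (simp add: form_add_right D_add)
next
  case (var n G)
  have "B (Mser b $ k * F) (pvar n * G) =
      B (pconst (g n) * pdiff n (Mser b $ k) * F) G + B (Mser b $ k * (pconst (g n) * pdiff n F)) G"
    unfolding form_pvar_mult_right pdiff_mult form_add_left distrib_left
    by (simp add: mult.assoc mult.left_commute[of _ "pconst c" for c] form_pconst_mult_left)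
  also have "\<dots> = B F (D b k (pvar n * G))"
    by (simp add: pdiff_Mser[OF b] D_pvar_mult form_add_right form_pvar_mult_right form_pconst_mult_right
        form_pconst_mult_left mult.assoc var)
  finally show ?case .
qed

text \<open>Multiplications commute, hence so do their adjoints.\<close>

lemma D_commute:
  assumes "admissible b" "admissible c"
  shows "D b j (D c k F) = D c k (D b j F)"
  by (rule form_eqI) (simp add: assms mult_ac flip: Mser_adjoint)

text \<open>Adjoint of \<open>Mser_add\<close>: composing two translations adds their
  parameters.\<close>

lemma D_convolution:
  assumes "admissible b" "admissible c"
  shows "(\<Sum>i\<le>k. D b i (D c (k - i) F)) = D (\<lambda>n. b n + c n) k F"
proof (rule form_eqI)
  fix G
  have "admissible (\<lambda>n. b n + c n)"
    unfolding admissible_def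
  proof
    fix k
    have "finite ({n. w n = k \<and> b n \<noteq> 0} \<union> {n. w n = k \<and> c n \<noteq> 0})"
      using assms by (simp add: admissible_def)
    then show "finite {n. w n = k \<and> b n + c n \<noteq> 0}"
      by (rule rev_finite_subset) auto
  qed
  then have "B G (D (\<lambda>n. b n + c n) k F) = B ((\<Sum>i\<le>k. Mser b $ i * Mser c $ (k - i)) * G) F"
    by (simp add: Mser_add assms fps_mult_nth atMost_atLeast0 flip: Mser_adjoint)
  also have "\<dots> = (\<Sum>i\<le>k. B (Mser c $ (k - i) * (Mser b $ i * G)) F)"
    unfolding sum_distrib_right form_sum_left by (simp add: mult_ac)
  also have "\<dots> = B G (\<Sum>i\<le>k. D b i (D c (k - i) F))"
    by (simp add: form_sum_right Mser_adjoint assms)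
  finally show "B G (\<Sum>i\<le>k. D b i (D c (k - i) F)) = B G (D (\<lambda>n. b n + c n) k F)" ..
qed

text \<open>The scalar series exp (\<Sum> b_n c_n z^(w n) / g_n), the factor produced when
  translation by \<open>b\<close> acts on \<open>Mser c\<close>.\<close>

definition cser :: "('i \<Rightarrow> 'k) \<Rightarrow> ('i \<Rightarrow> 'k) \<Rightarrow> 'k fps" where
  "cser b c = kexp.fexp (Abs_fps (\<lambda>k. \<Sum>n | w n = Suc k \<and> c n \<noteq> 0. of_nat (w n) * c n / g n * b n))"

text \<open>The logarithmic derivative of \<open>Mser c\<close> is linear in the variables, so
  translation adds a scalar part to it and thus multiplies the exponential by a scalar
  series.\<close>

theorem D_Mser:
  "D b i (Mser c $ l) = (if i \<le> l then pconst (cser b c $ i) * Mser c $ (l - i) else 0)"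
proof -
  let ?\<kappa> = "fps_const \<circ> (pconst :: 'k \<Rightarrow> ('i, 'k) pl)"
  interpret R: rat_algebra ?\<kappa>
    by (rule rat_algebra_comp[OF rat_algebra_pconst comm_ring_hom_fps_const])
  define a where "a = Abs_fps (\<lambda>k. \<Sum>n | w n = Suc k \<and> c n \<noteq> 0. of_nat (w n) * c n / g n * b n)"
  define U where "U = Abs_fps (\<lambda>k. fps_const (logder c $ k))"
  \<comment> \<open>A variable of degree \<open>k + 1\<close> is shifted by a multiple of
    \<open>fps_X ^ (k + 1)\<close>, so the added part is a scalar series with argument scaled by
    \<open>fps_X\<close>, and \<open>fexp_scale\<close> applies.\<close>
  define V where "V = Abs_fps (\<lambda>k. fps_X ^ Suc k * Abs_fps (\<lambda>k. fps_const (pconst (a $ k) :: ('i, 'k) pl)) $ k)"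
  have V: "R.fexp V $ j = fps_X ^ j * fps_const (pconst (cser b c $ j))" for j
  proof -
    have "(fps_const \<circ> pconst) (kexp.fexp a $ j) =
        R.fexp (Abs_fps (\<lambda>k. fps_const (pconst (a $ k)))) $ j"
      by (rule fexp_hom[OF rat_algebra_id R.rat_algebra_axioms comm_ring_hom_fps_pconst]) simp_all
    then show ?thesis
      unfolding V_def R.fexp_scale by (simp add: cser_def a_def)
  qed
  have "Dhom b (logder c $ k) = (U + V) $ k" for k
  proof -
    have "Dhom b (logder c $ k) =
        (\<Sum>n | w n = Suc k \<and> c n \<noteq> 0. fps_const (pconst (of_nat (w n) * c n / g n) * pvar n) +
          fps_X ^ Suc k * fps_const (pconst (of_nat (w n) * c n / g n * b n)))"
      unfolding logder_def fps_nth_Abs_fps Dhom.hom_sum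
    proof (rule sum.cong[OF refl])
      fix n assume n: "n \<in> {n. w n = Suc k \<and> c n \<noteq> 0}"
      define d where "d = of_nat (w n) * c n / g n"
      have "Dhom b (pconst d * pvar n) = fps_const (pconst d * pvar n) + fps_X ^ Suc k * fps_const (pconst (d * b n))"
        using n by (simp add: Dhom.hom_mult distrib_left pconst.hom_mult mult_ac flip: fps_const_mult)
      then show "Dhom b (pconst (of_nat (w n) * c n / g n) * pvar n) =
          fps_const (pconst (of_nat (w n) * c n / g n) * pvar n) +
          fps_X ^ Suc k * fps_const (pconst (of_nat (w n) * c n / g n * b n))"
        unfolding d_def .
    qed
    also have "\<dots> = (U + V) $ k"
      by (simp add: U_def V_def a_def logder_def sum.distrib fps_const.hom_sum pconst.hom_sum sum_distrib_left)
    finally show ?thesis .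
  qed
  then have "Dhom b (Mser c $ l) = R.fexp (U + V) $ l"
    unfolding Mser_def
    by (intro fexp_hom[OF rat_algebra_pconst R.rat_algebra_axioms comm_ring_hom_Dhom]) simp_all
  also have "\<dots> = (\<Sum>j=0..l. fps_const (Mser c $ j) * (fps_X ^ (l - j) * fps_const (pconst (cser b c $ (l - j)))))"
  proof -
    have "fps_const (Mser c $ j) = R.fexp U $ j" for j
      unfolding Mser_def
      by (rule fexp_hom[OF rat_algebra_pconst R.rat_algebra_axioms comm_ring_hom_fps_const])
        (simp_all add: U_def)
    then show ?thesis by (simp add: R.fexp_add fps_mult_nth V)
  qed
  finally have "D b i (Mser c $ l) =
      (\<Sum>j=0..l. if i = l - j then pconst (cser b c $ i) * Mser c $ j else 0)"
    by (auto simp: D_def fps_sum_nth fps_X_power_mult_nth mult.commute intro!: sum.cong)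
  \<comment> \<open>\<open>Suc l\<close> lies outside the range, so the delta sum vanishes when
    \<open>i > l\<close>.\<close>
  also have "\<dots> = (\<Sum>j\<in>{0..l}. if (if i \<le> l then l - i else Suc l) = j then pconst (cser b c $ i) * Mser c $ j else 0)"
    by (intro sum.cong) auto
  also have "\<dots> = (if i \<le> l then pconst (cser b c $ i) * Mser c $ (l - i) else 0)"
    by (subst sum.delta') auto
  finally show ?thesis .
qed

end


section \<open>Multivariate series\<close>

lemma mcoeff_add [simp]: "mcoeff (f + g) \<mu> = mcoeff f \<mu> + mcoeff g \<mu>"
  by (simp add: plus_mfps_def)

lemma mcoeff_diff [simp]: "mcoeff (f - g) \<mu> = mcoeff f \<mu> - mcoeff g \<mu>"
  by (simp add: minus_mfps_def)

lemma mcoeff_0 [simp]: "mcoeff 0 \<mu> = 0"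
  by (simp add: zero_mfps_def)

lemma mcoeff_1: "mcoeff 1 \<mu> = (if \<mu> = 0 then 1 else 0)"
  by (simp add: one_mfps_def)

lemma mcoeff_mconst: "mcoeff (mconst c) \<mu> = (if \<mu> = 0 then c else 0)"
  by (simp add: mconst_def)

lemma mcoeff_sum: "mcoeff (\<Sum>x\<in>S. f x) \<mu> = (\<Sum>x\<in>S. mcoeff (f x) \<mu>)"
  by (induction S rule: infinite_finite_induct) simp_all

lemma mcoeff_mult: "mcoeff (f * g) \<mu> = (\<Sum>(\<beta>, \<gamma>) | \<beta> + \<gamma> = \<mu>. mcoeff f \<beta> * mcoeff g \<gamma>)"
  by (simp add: times_mfps_def)

text \<open>When the first factor has sparse support, the splittings of \<mu> reduce to a finite
  family parametrising that support. Constants, variables and power sums are of this kind.\<close>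

lemma mcoeff_mult_sparse:
  assumes "finite I" "inj_on e I" "\<And>x. x \<in> I \<Longrightarrow> e x + r x = \<mu>"
    and "\<And>\<beta> \<gamma>. \<beta> + \<gamma> = \<mu> \<Longrightarrow> mcoeff f \<beta> \<noteq> 0 \<Longrightarrow> \<beta> \<in> e ` I"
  shows "mcoeff (f * g) \<mu> = (\<Sum>x\<in>I. mcoeff f (e x) * mcoeff g (r x))"
proof -
  have "mcoeff (f * g) \<mu> = (\<Sum>(\<beta>, \<gamma>) \<in> (\<lambda>x. (e x, r x)) ` I. mcoeff f \<beta> * mcoeff g \<gamma>)"
    unfolding mcoeff_mult
  proof (rule sum.mono_neutral_right)
    show "(\<lambda>x. (e x, r x)) ` I \<subseteq> {(\<beta>, \<gamma>). \<beta> + \<gamma> = \<mu>}"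
      using assms(3) by auto
    show "\<forall>p\<in>{(\<beta>, \<gamma>). \<beta> + \<gamma> = \<mu>} - (\<lambda>x. (e x, r x)) ` I.
        (case p of (\<beta>, \<gamma>) \<Rightarrow> mcoeff f \<beta> * mcoeff g \<gamma>) = 0"
    proof clarify
      fix \<beta> \<gamma> assume sum: "\<mu> = \<beta> + \<gamma>" and "(\<beta>, \<gamma>) \<notin> (\<lambda>x. (e x, r x)) ` I"
      moreover have "r x = \<gamma>" if "x \<in> I" "e x = \<beta>" for x
        using assms(3)[OF that(1)] that(2) sum by simp
      ultimately have "\<beta> \<notin> e ` I"
        by auto
      then show "mcoeff f \<beta> * mcoeff g \<gamma> = 0"
        using assms(4)[of \<beta> \<gamma>] sum by force
    qed
  qed (rule finite_monomial_splits)
  also have "\<dots> = (\<Sum>x\<in>I. mcoeff f (e x) * mcoeff g (r x))"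
    using assms(2) by (subst sum.reindex) (auto simp: inj_on_def)
  finally show ?thesis .
qed

lemma mcoeff_mconst_mult [simp]: "mcoeff (mconst c * f) \<mu> = c * mcoeff f \<mu>"
  by (subst mcoeff_mult_sparse[where I = "{()}" and e = "\<lambda>_. 0" and r = "\<lambda>_. \<mu>"])
     (auto simp: mcoeff_mconst split: if_splits)

lemma comm_ring_hom_mconst: "comm_ring_hom (mconst :: 'a::comm_ring_1 \<Rightarrow> ('v, 'a) mfps)"
  by unfold_locales (rule mfps_eqI; simp add: mcoeff_mconst mcoeff_1)+

interpretation mconst: comm_ring_hom "mconst :: 'a::comm_ring_1 \<Rightarrow> ('v, 'a) mfps"
  by (rule comm_ring_hom_mconst)

lemma rat_algebra_mconst: "rat_algebra (mconst :: 'a::field_char_0 \<Rightarrow> ('v, 'a) mfps)"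
  by (simp add: rat_algebra_def comm_ring_hom_mconst)

interpretation mexp: rat_algebra "mconst :: 'a::field_char_0 \<Rightarrow> ('v, 'a) mfps"
  by (rule rat_algebra_mconst)

text \<open>The power sum of a weighted alphabet, \<Sum> \<beta>_v z_v^k over possibly infinitely
  many variables. For \<open>k > 0\<close> the inner sum has at most one term.\<close>

definition psum :: "nat \<Rightarrow> ('v \<Rightarrow> 'a) \<Rightarrow> ('v, 'a::comm_ring_1) mfps" where
  "psum k \<beta> = Abs_mfps (\<lambda>\<mu>. \<Sum>v | \<mu> = Poly_Mapping.single v k. \<beta> v)"

lemma single_eq_single_iff:
  "n \<noteq> 0 \<Longrightarrow> Poly_Mapping.single u n = Poly_Mapping.single v n \<longleftrightarrow> u = v"
  by (metis lookup_single_eq lookup_single_not_eq)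

lemma mcoeff_psum_single: "k > 0 \<Longrightarrow> mcoeff (psum k \<beta>) (Poly_Mapping.single v k) = \<beta> v"
  by (simp add: psum_def single_eq_single_iff)

lemma mcoeff_psum_other: "(\<And>v. \<mu> \<noteq> Poly_Mapping.single v k) \<Longrightarrow> mcoeff (psum k \<beta>) \<mu> = 0"
  by (simp add: psum_def)

lemma psum_eqI:
  assumes "k > 0" "\<And>v. mcoeff f (Poly_Mapping.single v k) = \<beta> v"
    "\<And>\<mu>. (\<And>v. \<mu> \<noteq> Poly_Mapping.single v k) \<Longrightarrow> mcoeff f \<mu> = 0"
  shows "f = psum k \<beta>"
  by (rule mfps_eqI) (metis assms mcoeff_psum_single mcoeff_psum_other)

lemma mcoeff_psum_mult:
  assumes k: "k > 0"
  shows "mcoeff (psum k \<beta> * f) \<alpha> =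
    (\<Sum>v | v \<in> Poly_Mapping.keys \<alpha> \<and> k \<le> Poly_Mapping.lookup \<alpha> v. \<beta> v * mcoeff f (\<alpha> - Poly_Mapping.single v k))"
proof -
  let ?I = "{v. v \<in> Poly_Mapping.keys \<alpha> \<and> k \<le> Poly_Mapping.lookup \<alpha> v}"
  have "mcoeff (psum k \<beta> * f) \<alpha> =
      (\<Sum>v\<in>?I. mcoeff (psum k \<beta>) (Poly_Mapping.single v k) * mcoeff f (\<alpha> - Poly_Mapping.single v k))"
  proof (rule mcoeff_mult_sparse)
    show "inj_on (\<lambda>v. Poly_Mapping.single v k) ?I"
      using k by (auto simp: inj_on_def single_eq_single_iff)
    show "Poly_Mapping.single v k + (\<alpha> - Poly_Mapping.single v k) = \<alpha>" if "v \<in> ?I" for v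
      using that by (intro poly_mapping_eqI) (auto simp: lookup_add lookup_minus lookup_single when_def)
    fix \<beta>' \<gamma> assume sum: "\<beta>' + \<gamma> = \<alpha>" and "mcoeff (psum k \<beta>) \<beta>' \<noteq> 0"
    then obtain v where v: "\<beta>' = Poly_Mapping.single v k"
      by (metis mcoeff_psum_other)
    then have "k \<le> Poly_Mapping.lookup \<alpha> v"
      unfolding sum[symmetric] by (simp add: lookup_add)
    then show "\<beta>' \<in> (\<lambda>v. Poly_Mapping.single v k) ` ?I"
      using v k by (auto simp: in_keys_iff)
  qed simp
  then show ?thesis using k by (simp add: mcoeff_psum_single)
qed

lemma psum_mconst_mult: "mconst c * psum k \<beta> = psum k (\<lambda>v. c * \<beta> v)"
  by (rule mfps_eqI) (simp add: psum_def sum_distrib_left)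


section \<open>The reproducing property\<close>

context weights
begin

text \<open>On the left a variable of \<open>G\<close> becomes a weighted power sum, which lowers
  one exponent of \<alpha> by \<open>w i\<close>; on the right it becomes a derivative, which by the
  product rule and \<open>df\<close> does the same. Constants leave the values at 0, which \<sigma>
  has to supply: 1 for pure exponentials, \<open>sigma_Z\<close> in the rook case.\<close>

theorem reproducing:
  fixes f :: "'v \<Rightarrow> nat \<Rightarrow> ('i, 'k) pl"
  assumes f0: "\<And>v. f v 0 = 1"
    and df: "\<And>v i k. pconst (g i) * pdiff i (f v k) = (if w i \<le> k then pconst (b v i) * f v (k - w i) else 0)"
    and \<sigma>: "\<And>\<alpha>. mcoeff \<sigma> \<alpha> = (\<Prod>v\<in>Poly_Mapping.keys \<alpha>. Poly_Mapping.lookup (f v (Poly_Mapping.lookup \<alpha> v)) 0)"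
  shows "mcoeff (\<sigma> * poly_eval mconst (\<lambda>i. psum (w i) (\<lambda>v. b v i)) G) \<alpha> =
    B (\<Prod>v\<in>Poly_Mapping.keys \<alpha>. f v (Poly_Mapping.lookup \<alpha> v)) G"
proof -
  let ?\<Theta> = "poly_eval mconst (\<lambda>i. psum (w i) (\<lambda>v. b v i))"
  define M where "M \<alpha> = (\<Prod>v\<in>Poly_Mapping.keys \<alpha>. f v (Poly_Mapping.lookup \<alpha> v))" for \<alpha>
  have M_superset: "M \<alpha> = (\<Prod>v\<in>S. f v (Poly_Mapping.lookup \<alpha> v))"
    if "finite S" "Poly_Mapping.keys \<alpha> \<subseteq> S" for S \<alpha>
    unfolding M_def using that by (intro prod.mono_neutral_left) (auto simp: in_keys_iff f0)
  have M_minus: "M (\<alpha> - Poly_Mapping.single v k) =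
      f v (Poly_Mapping.lookup \<alpha> v - k) * (\<Prod>u\<in>Poly_Mapping.keys \<alpha> - {v}. f u (Poly_Mapping.lookup \<alpha> u))"
    if "v \<in> Poly_Mapping.keys \<alpha>" for v k \<alpha>
  proof -
    have "M (\<alpha> - Poly_Mapping.single v k) =
        (\<Prod>u\<in>Poly_Mapping.keys \<alpha>. f u (Poly_Mapping.lookup (\<alpha> - Poly_Mapping.single v k) u))"
      by (rule M_superset) (auto simp: in_keys_iff lookup_minus)
    also have "\<dots> = f v (Poly_Mapping.lookup \<alpha> v - k) *
        (\<Prod>u\<in>Poly_Mapping.keys \<alpha> - {v}. f u (Poly_Mapping.lookup (\<alpha> - Poly_Mapping.single v k) u))"
      using that by (subst prod.remove[of _ v]) (auto simp: lookup_minus)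
    also have "(\<Prod>u\<in>Poly_Mapping.keys \<alpha> - {v}. f u (Poly_Mapping.lookup (\<alpha> - Poly_Mapping.single v k) u)) =
        (\<Prod>u\<in>Poly_Mapping.keys \<alpha> - {v}. f u (Poly_Mapping.lookup \<alpha> u))"
      by (intro prod.cong) (auto simp: lookup_minus lookup_single when_def)
    finally show ?thesis .
  qed
  have "mcoeff (\<sigma> * ?\<Theta> G) \<alpha> = B (M \<alpha>) G"
  proof (induction G arbitrary: \<alpha> rule: pl_induct)
    case (const c)
    then show ?case
      by (simp add: mult.commute[of \<sigma>] poly_eval_pconst[OF comm_ring_hom_mconst] \<sigma> M_def lookup_prod_0)
  next
    case (add F G)
    then show ?case
      by (simp add: poly_eval_add[OF comm_ring_hom_mconst] distrib_left form_add_right)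
  next
    case (var i G)
    have "mcoeff (\<sigma> * ?\<Theta> (pvar i * G)) \<alpha> = mcoeff (psum (w i) (\<lambda>v. b v i) * (\<sigma> * ?\<Theta> G)) \<alpha>"
      by (simp add: poly_eval_mult[OF comm_ring_hom_mconst] poly_eval_pvar[OF comm_ring_hom_mconst] mult_ac)
    also have "\<dots> = (\<Sum>v | v \<in> Poly_Mapping.keys \<alpha> \<and> w i \<le> Poly_Mapping.lookup \<alpha> v.
        B (pconst (b v i) * M (\<alpha> - Poly_Mapping.single v (w i))) G)"
      by (simp add: mcoeff_psum_mult w_pos var form_pconst_mult_left)
    also have "\<dots> = (\<Sum>v\<in>Poly_Mapping.keys \<alpha>. if w i \<le> Poly_Mapping.lookup \<alpha> v then
        B (pconst (b v i) * M (\<alpha> - Poly_Mapping.single v (w i))) G else 0)"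
      by (simp add: sum.inter_filter[symmetric])
    also have "\<dots> = (\<Sum>v\<in>Poly_Mapping.keys \<alpha>. B (pconst (g i) * pdiff i (f v (Poly_Mapping.lookup \<alpha> v)) *
        (\<Prod>u\<in>Poly_Mapping.keys \<alpha> - {v}. f u (Poly_Mapping.lookup \<alpha> u))) G)"
      by (intro sum.cong) (simp_all add: df M_minus mult.assoc)
    also have "\<dots> = B (pconst (g i) * pdiff i (M \<alpha>)) G"
      by (simp add: M_def pdiff_prod sum_distrib_left form_sum_left mult.assoc)
    also have "\<dots> = B (M \<alpha>) (pvar i * G)"
      by (simp add: form_pvar_mult_right form_pconst_mult_left)
    finally show ?case .
  qed
  then show ?thesis by (simp add: M_def)
qed

corollary reproducing_Mser:
  fixes b :: "'v \<Rightarrow> 'i \<Rightarrow> 'k"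
  assumes "\<And>v. admissible (b v)"
  shows "mcoeff (poly_eval mconst (\<lambda>i. psum (w i) (\<lambda>v. b v i)) G) \<alpha> =
    B (\<Prod>v\<in>Poly_Mapping.keys \<alpha>. Mser (b v) $ Poly_Mapping.lookup \<alpha> v) G"
proof -
  have "mcoeff (1 * poly_eval mconst (\<lambda>i. psum (w i) (\<lambda>v. b v i)) G) \<alpha> =
    B (\<Prod>v\<in>Poly_Mapping.keys \<alpha>. Mser (b v) $ Poly_Mapping.lookup \<alpha> v) G"
  proof (rule reproducing)
    fix \<alpha> :: "'v \<Rightarrow>\<^sub>0 nat"
    show "mcoeff 1 \<alpha> = (\<Prod>v\<in>Poly_Mapping.keys \<alpha>. Poly_Mapping.lookup (Mser (b v) $ Poly_Mapping.lookup \<alpha> v) 0)"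
    proof (cases "\<alpha> = 0")
      case False
      then obtain v where "v \<in> Poly_Mapping.keys \<alpha>"
        by (metis in_keys_iff lookup_zero poly_mapping_eqI)
      then have "\<exists>v\<in>Poly_Mapping.keys \<alpha>. Poly_Mapping.lookup (Mser (b v) $ Poly_Mapping.lookup \<alpha> v) 0 = 0"
        by (auto simp: lookup_Mser_0 in_keys_iff)
      then have "(\<Prod>v\<in>Poly_Mapping.keys \<alpha>. Poly_Mapping.lookup (Mser (b v) $ Poly_Mapping.lookup \<alpha> v) 0) = 0"
        by (intro prod_zero) auto
      then show ?thesis using False by (simp add: mcoeff_1)
    qed (simp add: mcoeff_1)
  qed (use assms in \<open>simp_all add: pdiff_Mser\<close>)
  then show ?thesis by simp
qed

text \<open>Several alphabets put several variables into one degree. A family \<open>c\<close> that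
  meets the degree of \<open>i\<close> in \<open>i\<close> alone makes that coefficient of
  \<open>logder c\<close> a multiple of one variable.\<close>

definition isolates :: "('i \<Rightarrow> 'k) \<Rightarrow> 'i \<Rightarrow> bool" where
  "isolates c i \<longleftrightarrow> {n. w n = w i \<and> c n \<noteq> 0} = {i}"

lemma subspace_closed_imp_UNIV:
  assumes one: "1 \<in> V"
    and add: "\<And>F G. F \<in> V \<Longrightarrow> G \<in> V \<Longrightarrow> F + G \<in> V"
    and scale: "\<And>c F. F \<in> V \<Longrightarrow> pconst c * F \<in> V"
    and var: "\<And>i F. F \<in> V \<Longrightarrow> pvar i * F \<in> V"
  shows "F \<in> V"
proof (induction F rule: pl_induct)
  case (const c)
  then show ?case using scale[OF one, of c] by simp
qed (simp_all add: add var)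

text \<open>The recursion \<open>k M\<^sub>k = \<Sum> A\<^sub>j M\<^bsub>k-1-j\<^esub>\<close> expresses the variable isolated by \<open>c\<close> through the coefficients
  of the series \<open>M\<close>, with products of earlier variables as correction.\<close>

lemma closed_under_Mser_imp_var:
  assumes add: "\<And>F G. F \<in> V \<Longrightarrow> G \<in> V \<Longrightarrow> F + G \<in> V"
    and scale: "\<And>c F. F \<in> V \<Longrightarrow> pconst c * F \<in> V"
    and zero: "0 \<in> V"
    and Mser: "\<And>i. \<exists>c. isolates c i \<and> (\<forall>F\<in>V. \<forall>k. Mser c $ k * F \<in> V)"
    and F: "F \<in> V"
  shows "pvar i * F \<in> V"
  using F
proof (induction "w i" arbitrary: i F rule: less_induct)
  case less
  have sum: "(\<Sum>x\<in>S. h x) \<in> V" if "\<And>x. x \<in> S \<Longrightarrow> h x \<in> V" for S :: "'x set" and h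
    using that by (induction S rule: infinite_finite_induct) (auto simp: zero add)
  obtain c where c: "isolates c i" "\<And>F k. F \<in> V \<Longrightarrow> Mser c $ k * F \<in> V"
    using Mser by blast
  obtain v where v: "w i = Suc v"
    using w_pos[of i] gr0_conv_Suc by blast
  define a where "a = of_nat (w i) * c i / g i"
  have "c i \<noteq> 0"
    using c(1) by (auto simp: isolates_def)
  then have a: "a \<noteq> 0"
    using v g_nonzero[of i] by (simp add: a_def del: of_nat_Suc)
  have ld: "logder c $ v = pconst a * pvar i"
    using c(1) v by (simp add: logder_def isolates_def a_def)
  have "of_nat (Suc v) * (Mser c $ Suc v * F) = (\<Sum>j\<le>v. logder c $ j * (Mser c $ (v - j) * F))"
    using arg_cong[OF pexp.fexp_Suc[of v "logder c"], of "\<lambda>x. x * F"]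
    by (simp add: Mser_def sum_distrib_right mult.assoc)
  also have "\<dots> = (\<Sum>j<v. logder c $ j * (Mser c $ (v - j) * F)) + pconst a * (pvar i * F)"
    by (simp add: lessThan_Suc_atMost[symmetric] ld mult.assoc)
  finally have eq: "pconst a * (pvar i * F) = pconst (of_nat (Suc v)) * (Mser c $ Suc v * F) +
      pconst (- 1) * (\<Sum>j<v. logder c $ j * (Mser c $ (v - j) * F))"
    unfolding pconst.hom_uminus pconst.hom_one pconst.hom_of_nat by simp
  have "(\<Sum>j<v. logder c $ j * (Mser c $ (v - j) * F)) \<in> V"
  proof (rule sum)
    fix j assume j: "j \<in> {..<v}"
    have "logder c $ j * (Mser c $ (v - j) * F) =
        (\<Sum>n | w n = Suc j \<and> c n \<noteq> 0. pconst (of_nat (w n) * c n / g n) * (pvar n * (Mser c $ (v - j) * F)))"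
      by (simp add: logder_def sum_distrib_right mult.assoc)
    also have "\<dots> \<in> V"
      using j v c(2) less by (intro sum scale less(1)) auto
    finally show "logder c $ j * (Mser c $ (v - j) * F) \<in> V" .
  qed
  then have "pconst a * (pvar i * F) \<in> V"
    unfolding eq using c(2) less by (intro add scale) auto
  then have "pconst (inverse a) * (pconst a * (pvar i * F)) \<in> V"
    by (rule scale)
  then show ?case
    using a by (simp flip: mult.assoc pconst.hom_mult)
qed

text \<open>A polynomial in the kernel is orthogonal to all products of coefficients of the series
  \<open>Mser (b v)\<close>. Each required series belongs to infinitely many variables, so factors
  can be adjoined at will and orthogonality extends to all polynomials.\<close>

theorem poly_eval_psum_injective:
  fixes b :: "'v \<Rightarrow> 'i \<Rightarrow> 'k"
  assumes adm: "\<And>v. admissible (b v)"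
    and sep: "\<And>i. \<exists>c. isolates c i \<and> infinite {v. b v = c}"
    and zero: "poly_eval mconst (\<lambda>i. psum (w i) (\<lambda>v. b v i)) G = 0"
  shows "G = 0"
proof -
  define M where "M \<alpha> = (\<Prod>v\<in>Poly_Mapping.keys \<alpha>. Mser (b v) $ Poly_Mapping.lookup \<alpha> v)"
    for \<alpha> :: "'v \<Rightarrow>\<^sub>0 nat"
  have M: "B (M \<alpha>) G = 0" for \<alpha>
    using reproducing_Mser[of b G \<alpha>] adm zero by (simp add: M_def)
  define V where "V = {F. \<forall>\<alpha>. B (F * M \<alpha>) G = 0}"
  have V: "F + F' \<in> V" "pconst c * F \<in> V" if "F \<in> V" "F' \<in> V" for F F' c
    using that by (auto simp: V_def distrib_right form_add_left form_pconst_mult_left mult.assoc)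
  have Mser_V: "Mser c $ k * F \<in> V" if c: "infinite {v. b v = c}" and F: "F \<in> V" for c k F
    unfolding V_def
  proof (intro CollectI allI)
    fix \<alpha> :: "'v \<Rightarrow>\<^sub>0 nat"
    \<comment> \<open>Only finitely many variables occur in \<alpha>; a fresh one carries the new
      factor.\<close>
    obtain v where v: "b v = c" "v \<notin> Poly_Mapping.keys \<alpha>"
      using c finite_subset[OF _ finite_keys, of "{v. b v = c}" \<alpha>] by blast
    have "M (\<alpha> + Poly_Mapping.single v k) = Mser c $ k * M \<alpha>"
    proof (cases "k = 0")
      case False
      then have "Poly_Mapping.keys (\<alpha> + Poly_Mapping.single v k) = insert v (Poly_Mapping.keys \<alpha>)"
        using v by (auto simp: in_keys_iff lookup_add lookup_single when_def split: if_splits)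
      moreover have "(\<Prod>u\<in>Poly_Mapping.keys \<alpha>. Mser (b u) $ Poly_Mapping.lookup (\<alpha> + Poly_Mapping.single v k) u) = M \<alpha>"
        unfolding M_def using v by (intro prod.cong) (auto simp: lookup_add lookup_single when_def)
      ultimately show ?thesis
        using v by (simp add: M_def lookup_add in_keys_iff)
    qed simp
    then have "Mser c $ k * F * M \<alpha> = F * M (\<alpha> + Poly_Mapping.single v k)"
      by (simp add: mult_ac)
    then show "B (Mser c $ k * F * M \<alpha>) G = 0"
      using F by (simp add: V_def)
  qed
  have "F \<in> V" for F
  proof (rule subspace_closed_imp_UNIV)
    show "1 \<in> V"
      using M by (simp add: V_def)
    fix i F assume "F \<in> V"
    show "pvar i * F \<in> V"
    proof (rule closed_under_Mser_imp_var)
      show "\<exists>c. isolates c i \<and> (\<forall>F\<in>V. \<forall>k. Mser c $ k * F \<in> V)" for i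
        using sep Mser_V by blast
      show "0 \<in> V"
        by (simp add: V_def)
    qed (use \<open>F \<in> V\<close> V in auto)
  qed (use V in auto)
  then have "B F G = B F 0" for F
    using M[of 0] by (force simp: V_def M_def dest: spec[of _ 0])
  then show ?thesis by (rule form_eqI)
qed

lemma orthogonal_expansion:
  assumes orth: "\<And>s t. s \<in> I \<Longrightarrow> t \<in> I \<Longrightarrow> s \<noteq> t \<Longrightarrow> B (e s) (e t) = 0"
    and norm: "\<And>s. s \<in> I \<Longrightarrow> B (e s) (e s) \<noteq> 0"
    and F: "finite T" "T \<subseteq> I" "F = (\<Sum>s\<in>T. pconst (c s) * e s)"
  shows "finite {s \<in> I. B F (e s) \<noteq> 0}"
    and "F = (\<Sum>s | s \<in> I \<and> B F (e s) \<noteq> 0. pconst (B F (e s) / B (e s) (e s)) * e s)"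
proof -
  have BF: "B F (e t) = (if t \<in> T then c t * B (e t) (e t) else 0)" if "t \<in> I" for t
  proof -
    have "B F (e t) = (\<Sum>s\<in>T. if s = t then c t * B (e t) (e t) else 0)"
      unfolding F form_sum_left
      using that F(2) orth by (intro sum.cong) (auto simp: form_pconst_mult_left)
    then show ?thesis using F(1) by simp
  qed
  then have sub: "{s \<in> I. B F (e s) \<noteq> 0} \<subseteq> T"
    by (auto split: if_splits)
  then show "finite {s \<in> I. B F (e s) \<noteq> 0}"
    using F(1) by (rule finite_subset)
  have "F = (\<Sum>s\<in>T. pconst (B F (e s) / B (e s) (e s)) * e s)"
  proof -
    have "pconst (B F (e s) / B (e s) (e s)) * e s = pconst (c s) * e s" if "s \<in> T" for s
      using BF[of s] that F(2) norm[of s] by auto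
    then show ?thesis using F(3) by simp
  qed
  also have "\<dots> = (\<Sum>s | s \<in> I \<and> B F (e s) \<noteq> 0. pconst (B F (e s) / B (e s) (e s)) * e s)"
    using F(1,2) sub by (intro sum.mono_neutral_right) auto
  finally show "F = (\<Sum>s | s \<in> I \<and> B F (e s) \<noteq> 0. pconst (B F (e s) / B (e s) (e s)) * e s)" .
qed

end


section \<open>Stable limits and one-row Hall--Littlewood functions\<close>

instance fract :: ("{idom, ring_char_0}") field_char_0
proof
  have of_nat: "of_nat n = Fract (of_nat n) (1::'a)" for n
    by (induction n) (simp_all add: Zero_fract_def One_fract_def)
  show "inj (of_nat :: nat \<Rightarrow> 'a fract)"
    by (rule injI) (simp add: of_nat eq_fract)
qed

lemma recip_eqI: "x * y = 1 \<Longrightarrow> recip x = (y :: 'a::comm_ring_1)"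
  unfolding recip_def by (rule the_equality) (auto, metis mult.assoc mult.commute mult_1)

context rat_algebra
begin

lemma fexp_geometric: "fexp (Abs_fps (\<lambda>k. c ^ Suc k)) * (1 - fps_const c * fps_X) = 1"
proof -
  have "Abs_fps (\<lambda>k. c ^ k) = fexp (Abs_fps (\<lambda>k. c ^ Suc k))"
  proof (rule fexp_unique)
    show "fps_deriv (Abs_fps (\<lambda>k. c ^ k)) = Abs_fps (\<lambda>k. c ^ Suc k) * Abs_fps (\<lambda>k. c ^ k)"
    proof (rule fps_ext)
      fix n
      have "(\<Sum>i=0..n. c ^ Suc i * c ^ (n - i)) = (\<Sum>i=0..n. c ^ Suc n)"
        by (intro sum.cong) (auto simp flip: power_add power_Suc)
      then show "fps_deriv (Abs_fps (\<lambda>k. c ^ k)) $ n = (Abs_fps (\<lambda>k. c ^ Suc k) * Abs_fps (\<lambda>k. c ^ k)) $ n"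
        by (simp add: fps_mult_nth del: power_Suc of_nat_Suc)
    qed
  qed simp
  moreover have "Abs_fps (\<lambda>k. c ^ k) * (1 - fps_const c * fps_X) = 1"
  proof (rule fps_ext)
    fix n
    show "(Abs_fps (\<lambda>k. c ^ k) * (1 - fps_const c * fps_X)) $ n = 1 $ n"
      by (cases n) (simp_all add: right_diff_distrib mult.left_commute[of _ "fps_const c"])
  qed
  ultimately show ?thesis by simp
qed

text \<open>The inverse of each linear factor has a geometric series as logarithmic derivative, so a
  quotient of two has the difference. The product form avoids division in the ring.\<close>

lemma fexp_geometric_diff:
  "fexp (Abs_fps (\<lambda>k. c ^ Suc k - d ^ Suc k)) * (1 - fps_const c * fps_X) = 1 - fps_const d * fps_X"
proof -
  let ?C = "Abs_fps (\<lambda>k. c ^ Suc k)" and ?D = "Abs_fps (\<lambda>k. d ^ Suc k)"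
  have "Abs_fps (\<lambda>k. c ^ Suc k - d ^ Suc k) = ?C + (- ?D)"
    by (simp add: fps_eq_iff)
  then have "fexp (Abs_fps (\<lambda>k. c ^ Suc k - d ^ Suc k)) * (1 - fps_const c * fps_X) =
      fexp (- ?D) * (fexp ?C * (1 - fps_const c * fps_X))"
    by (simp only: fexp_add mult_ac)
  also have "\<dots> = fexp (- ?D) * (fexp ?D * (1 - fps_const d * fps_X))"
    unfolding fexp_geometric ..
  also have "\<dots> = fexp (- ?D) * fexp ?D * (1 - fps_const d * fps_X)"
    by (simp only: mult.assoc)
  also have "\<dots> = 1 - fps_const d * fps_X"
    by (simp only: fexp_uminus mult_1)
  finally show ?thesis .
qed

end

section \<open>Coefficientwise limits\<close>

lemma stable_limit_unique: "stable_limit F f \<Longrightarrow> stable_limit F g \<Longrightarrow> f = g"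
proof (rule mfps_eqI)
  fix \<mu>
  assume "stable_limit F f" "stable_limit F g"
  then have "\<forall>\<^sub>F n in sequentially. mcoeff (F n) \<mu> = mcoeff f \<mu> \<and> mcoeff (F n) \<mu> = mcoeff g \<mu>"
    by (simp add: stable_limit_def eventually_conj)
  then show "mcoeff f \<mu> = mcoeff g \<mu>"
    by (auto dest: eventually_happens)
qed

lemma mlim_eqI: "stable_limit F f \<Longrightarrow> mlim F = f"
  unfolding mlim_def by (rule the_equality) (auto intro: stable_limit_unique)

lemma stable_limit_const: "stable_limit (\<lambda>_. f) f"
  by (simp add: stable_limit_def)

lemma stable_limit_add:
  assumes "stable_limit F f" "stable_limit G g"
  shows "stable_limit (\<lambda>n. F n + G n) (f + g)"
  unfolding stable_limit_def
proof
  fix \<mu>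
  have "\<forall>\<^sub>F n in sequentially. mcoeff (F n) \<mu> = mcoeff f \<mu>" "\<forall>\<^sub>F n in sequentially. mcoeff (G n) \<mu> = mcoeff g \<mu>"
    using assms by (auto simp: stable_limit_def)
  then show "\<forall>\<^sub>F n in sequentially. mcoeff (F n + G n) \<mu> = mcoeff (f + g) \<mu>"
    by eventually_elim simp
qed

lemma stable_limit_sum:
  "(\<And>x. x \<in> S \<Longrightarrow> stable_limit (\<lambda>n. F n x) (f x)) \<Longrightarrow> stable_limit (\<lambda>n. \<Sum>x\<in>S. F n x) (\<Sum>x\<in>S. f x)"
  by (induction S rule: infinite_finite_induct) (auto intro: stable_limit_add stable_limit_const)

lemma stable_limit_mult:
  assumes "stable_limit F f" "stable_limit G g"
  shows "stable_limit (\<lambda>n. F n * G n) (f * g)"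
  unfolding stable_limit_def
proof
  fix \<mu>
  have "\<forall>\<^sub>F n in sequentially. \<forall>p\<in>{(\<beta>, \<gamma>). \<beta> + \<gamma> = \<mu>}.
      mcoeff (F n) (fst p) = mcoeff f (fst p) \<and> mcoeff (G n) (snd p) = mcoeff g (snd p)"
    using assms by (intro eventually_ball_finite finite_monomial_splits)
      (simp add: stable_limit_def eventually_conj)
  then show "\<forall>\<^sub>F n in sequentially. mcoeff (F n * G n) \<mu> = mcoeff (f * g) \<mu>"
  proof eventually_elim
    case (elim n)
    then show ?case
      unfolding mcoeff_mult by (intro sum.cong) auto
  qed
qed

lemma stable_limit_fexp:
  fixes A :: "nat \<Rightarrow> ('v, 'k::field_char_0) mfps fps"
  assumes "\<And>k. stable_limit (\<lambda>n. A n $ k) (A' $ k)"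
  shows "stable_limit (\<lambda>n. mexp.fexp (A n) $ k) (mexp.fexp A' $ k)"
proof (induction k rule: less_induct)
  case (less k)
  show ?case
  proof (cases k)
    case (Suc l)
    have "stable_limit (\<lambda>n. mconst (inverse (of_nat (Suc l))) * (\<Sum>i\<le>l. A n $ i * mexp.fexp (A n) $ (l - i)))
        (mconst (inverse (of_nat (Suc l))) * (\<Sum>i\<le>l. A' $ i * mexp.fexp A' $ (l - i)))"
      using less Suc by (intro stable_limit_mult stable_limit_sum stable_limit_const assms) auto
    then show ?thesis
      by (simp add: Suc mexp.fexp_def)
  qed (simp add: stable_limit_const)
qed

lemma mvar_power:
  fixes i :: 'v
  assumes "k > 0"
  shows "mvar i ^ k = (psum k (\<lambda>v. if v = i then 1 else 0) :: ('v, 'a::comm_ring_1) mfps)"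
proof -
  have *: "mcoeff (mvar i ^ k) \<mu> = (if \<mu> = Poly_Mapping.single i k then 1 else 0 :: 'a)" for k \<mu>
  proof (induction k arbitrary: \<mu>)
    case 0
    then show ?case by (simp add: mcoeff_1)
  next
    case (Suc k)
    show ?case
    proof (cases "Poly_Mapping.lookup \<mu> i = 0")
      case True
      then have "\<mu> \<noteq> Poly_Mapping.single i (Suc k)" by auto
      moreover have "mcoeff (mvar i * mvar i ^ k :: ('v, 'a) mfps) \<mu> = (\<Sum>x\<in>({}::unit set). 0)"
        by (subst mcoeff_mult_sparse[where I = "{}" and e = "\<lambda>_. 0" and r = "\<lambda>_. 0"])
           (use True in \<open>auto simp: mvar_def lookup_add split: if_splits\<close>)
      ultimately show ?thesis by simp
    next
      case False
      then have sum: "Poly_Mapping.single i 1 + (\<mu> - Poly_Mapping.single i 1) = \<mu>"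
        by (intro poly_mapping_eqI) (auto simp: lookup_add lookup_minus lookup_single when_def)
      have "mcoeff (mvar i * mvar i ^ k :: ('v, 'a) mfps) \<mu> = mcoeff (mvar i ^ k :: ('v, 'a) mfps) (\<mu> - Poly_Mapping.single i 1)"
        by (subst mcoeff_mult_sparse[where I = "{()}" and e = "\<lambda>_. Poly_Mapping.single i 1"
              and r = "\<lambda>_. \<mu> - Poly_Mapping.single i 1"])
           (use sum in \<open>auto simp: mvar_def split: if_splits\<close>)
      moreover have "\<mu> - Poly_Mapping.single i 1 = Poly_Mapping.single i k \<longleftrightarrow> \<mu> = Poly_Mapping.single i (Suc k)"
        using sum by (metis add_diff_cancel_left' plus_1_eq_Suc single_add)
      ultimately show ?thesis by (simp add: Suc)
    qed
  qed
  show ?thesis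
    using assms by (intro psum_eqI) (auto simp: * single_eq_single_iff)
qed

text \<open>The logarithmic derivative in z of the generating product is the sum of (1 - t^(i+1))
  p_(i+1) z^i, and variable \<open>i\<close> stands for p_(i+1).\<close>

definition hl_poly :: "'k \<Rightarrow> nat \<Rightarrow> (nat, 'k::field_char_0) pl" where
  "hl_poly t k = pexp.fexp (Abs_fps (\<lambda>i. pconst (1 - t ^ Suc i) * pvar i)) $ k"

definition at_X :: "(nat, 'k) pl \<Rightarrow> (nat, 'k::field_char_0) mfps" where
  "at_X = poly_eval mconst (\<lambda>n. psum (Suc n) (\<lambda>_. 1))"

lemma comm_ring_hom_at_X: "comm_ring_hom at_X"
  unfolding at_X_def by (rule comm_ring_hom_poly_eval[OF comm_ring_hom_mconst])

interpretation at_X: comm_ring_hom "at_X :: (nat, 'k::field_char_0) pl \<Rightarrow> _"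
  by (rule comm_ring_hom_at_X)

lemma at_X_pconst [simp]: "at_X (pconst c) = mconst c"
  by (simp add: at_X_def poly_eval_pconst[OF comm_ring_hom_mconst])

lemma at_X_pvar [simp]: "at_X (pvar n) = psum (Suc n) (\<lambda>_. 1)"
  by (simp add: at_X_def poly_eval_pvar[OF comm_ring_hom_mconst])

text \<open>The product over the first \<open>n\<close> variables is the exponential built from
  their power sums. These stabilise coefficientwise as \<open>n\<close> grows, and exponentials
  preserve stable limits.\<close>

theorem hall_littlewood_q_eq: "hall_littlewood_q t k = at_X (hl_poly t k)"
proof -
  define A where "A n = Abs_fps (\<lambda>k. \<Sum>i<n. mconst (1 - t ^ Suc k) * mvar i ^ Suc k)" for n :: nat
  define A' :: "(nat, K) mfps fps" where "A' = Abs_fps (\<lambda>k. mconst (1 - t ^ Suc k) * psum (Suc k) (\<lambda>_. 1))"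
  have factor: "(1 - fps_const (mconst t * mvar i) * fps_X) * recip (1 - fps_const (mvar i) * fps_X) =
      mexp.fexp (Abs_fps (\<lambda>k. mconst (1 - t ^ Suc k) * mvar i ^ Suc k))" for i :: nat
  proof -
    let ?c = "mvar i :: (nat, K) mfps" and ?d = "mconst t * mvar i :: (nat, K) mfps"
    have "recip (1 - fps_const ?c * fps_X) = mexp.fexp (Abs_fps (\<lambda>k. ?c ^ Suc k))"
      by (rule recip_eqI[OF trans[OF mult.commute mexp.fexp_geometric]])
    then have "(1 - fps_const ?d * fps_X) * recip (1 - fps_const ?c * fps_X) =
        mexp.fexp (Abs_fps (\<lambda>k. ?c ^ Suc k - ?d ^ Suc k)) *
          (mexp.fexp (Abs_fps (\<lambda>k. ?c ^ Suc k)) * (1 - fps_const ?c * fps_X))"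
      unfolding mexp.fexp_geometric_diff[of ?c ?d, symmetric] by (simp only: mult_ac)
    then show ?thesis
      by (simp only: mexp.fexp_geometric mult_1_right)
        (simp add: left_diff_distrib mconst.hom_minus mconst.hom_power power_mult_distrib del: power_Suc)
  qed
  have "(\<Prod>i<n. (1 - fps_const (mconst t * mvar i) * fps_X) * recip (1 - fps_const (mvar i) * fps_X)) =
      mexp.fexp (A n)" for n
  proof -
    have "A n = (\<Sum>i<n. Abs_fps (\<lambda>k. mconst (1 - t ^ Suc k) * mvar i ^ Suc k))"
      by (simp add: A_def fps_eq_iff fps_sum_nth)
    then show ?thesis by (simp only: factor mexp.fexp_sum)
  qed
  moreover have "stable_limit (\<lambda>n. mexp.fexp (A n) $ k) (mexp.fexp A' $ k)"
  proof (rule stable_limit_fexp)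
    fix k
    have "A n $ k = mconst (1 - t ^ Suc k) * psum (Suc k) (\<lambda>v. if v < n then 1 else 0)" for n
    proof -
      have "(\<Sum>i<n. mvar i ^ Suc k) = psum (Suc k) (\<lambda>v. if v < n then (1::K) else 0)"
        by (rule psum_eqI)
           (auto simp: mvar_power mcoeff_sum mcoeff_psum_single mcoeff_psum_other simp del: power_Suc)
      then show ?thesis by (simp add: A_def sum_distrib_left[symmetric] del: power_Suc)
    qed
    moreover have "stable_limit (\<lambda>n. psum (Suc k) (\<lambda>v. if v < n then (1::K) else 0)) (psum (Suc k) (\<lambda>_. 1))"
      unfolding stable_limit_def
    proof
      fix \<mu>
      show "\<forall>\<^sub>F n in sequentially. mcoeff (psum (Suc k) (\<lambda>v. if v < n then (1::K) else 0)) \<mu> = mcoeff (psum (Suc k) (\<lambda>_. 1)) \<mu>"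
      proof (cases "\<exists>v. \<mu> = Poly_Mapping.single v (Suc k)")
        case True
        then obtain v where v: "\<mu> = Poly_Mapping.single v (Suc k)" by blast
        have "\<forall>\<^sub>F n in sequentially. v < n" by (rule eventually_gt_at_top)
        then show ?thesis
          by eventually_elim (simp add: v mcoeff_psum_single)
      next
        case False
        then show ?thesis by (simp add: mcoeff_psum_other)
      qed
    qed
    ultimately show "stable_limit (\<lambda>n. A n $ k) (A' $ k)"
      by (simp add: A'_def stable_limit_mult stable_limit_const del: power_Suc)
  qed
  ultimately have "hall_littlewood_q t k = mexp.fexp A' $ k"
    unfolding hall_littlewood_q_def by (simp add: mlim_eqI)
  also have "\<dots> = at_X (hl_poly t k)"
    unfolding hl_poly_def
    by (rule sym, rule fexp_hom[OF rat_algebra_pconst rat_algebra_mconst comm_ring_hom_at_X])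
       (simp_all add: A'_def at_X.hom_mult del: power_Suc)
  finally show ?thesis .
qed


section \<open>The base field and plethysm\<close>

lemma K_const_simps [simp]: "K_const 0 = 0" "K_const 1 = 1" "K_const (- 1) = - 1"
  by (simp_all add: K_const_def Zero_fract_def One_fract_def single_uminus)

lemma qq_nonzero [simp]: "qq \<noteq> 0" and qq_neq_1 [simp]: "qq \<noteq> 1"
proof -
  have "Poly_Mapping.single (Poly_Mapping.single 0 1) 1 \<noteq> (0 :: (nat \<Rightarrow>\<^sub>0 nat) \<Rightarrow>\<^sub>0 complex)"
    by (metis lookup_single_eq lookup_zero one_neq_zero)
  then show "qq \<noteq> 0"
    by (simp add: qq_def K_var_def Zero_fract_def eq_fract)
  have "Poly_Mapping.lookup (Poly_Mapping.single (Poly_Mapping.single 0 1) 1) (0 :: nat \<Rightarrow>\<^sub>0 nat) = (0::complex)"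
    by (metis lookup_single_not_eq lookup_single_eq lookup_zero one_neq_zero)
  then have "Poly_Mapping.single (Poly_Mapping.single 0 1) 1 \<noteq> (1 :: (nat \<Rightarrow>\<^sub>0 nat) \<Rightarrow>\<^sub>0 complex)"
    by (metis lookup_one_zero one_neq_zero)
  then show "qq \<noteq> 1"
    by (simp add: qq_def K_var_def One_fract_def eq_fract)
qed

lemma lookup_map_scale: "Poly_Mapping.lookup (Poly_Mapping.map ((*) r) \<mu>) v = r * Poly_Mapping.lookup (\<mu> :: 'v \<Rightarrow>\<^sub>0 nat) v"
  by (simp add: Poly_Mapping.map.rep_eq when_def)

lemma map_scale_inj: "r > 0 \<Longrightarrow> Poly_Mapping.map ((*) r) \<mu> = Poly_Mapping.map ((*) r) \<nu> \<longleftrightarrow> \<mu> = (\<nu> :: 'v \<Rightarrow>\<^sub>0 nat)"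
  by (auto simp: poly_mapping_eq_iff fun_eq_iff lookup_map_scale)

lemma mcoeff_power_sum_map:
  "r > 0 \<Longrightarrow> mcoeff (power_sum r A) (Poly_Mapping.map ((*) r) \<mu>) = poly (map_poly K_const (mcoeff A \<mu>)) (qq ^ r)"
  by (simp add: power_sum_def map_scale_inj)

lemma mcoeff_power_sum_other:
  "(\<And>\<mu>. \<nu> \<noteq> Poly_Mapping.map ((*) r) \<mu>) \<Longrightarrow> mcoeff (power_sum r A) \<nu> = 0"
  unfolding power_sum_def mcoeff_Abs by (rule sum.neutral) auto

lemma map_scale_single: "Poly_Mapping.map ((*) r) (Poly_Mapping.single v (Suc 0)) = Poly_Mapping.single v (r::nat)"
  by (rule poly_mapping_eqI) (simp add: lookup_map_scale lookup_single when_def)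

text \<open>For an expression of degree one in its alphabet, the r-th powers of the monomials are
  the monomials of a power sum.\<close>

lemma power_sum_linear:
  assumes r: "r > 0" and A: "\<And>\<mu>. (\<And>v. \<mu> \<noteq> Poly_Mapping.single v (Suc 0)) \<Longrightarrow> mcoeff A \<mu> = 0"
  shows "power_sum r A = psum r (\<lambda>v. poly (map_poly K_const (mcoeff A (Poly_Mapping.single v (Suc 0)))) (qq ^ r))"
proof (rule psum_eqI[OF r])
  show "mcoeff (power_sum r A) (Poly_Mapping.single v r) =
      poly (map_poly K_const (mcoeff A (Poly_Mapping.single v (Suc 0)))) (qq ^ r)" for v
    unfolding map_scale_single[of r, symmetric] using r by (rule mcoeff_power_sum_map)
next
  fix \<nu> :: "'a \<Rightarrow>\<^sub>0 nat"
  assume \<nu>: "\<And>v. \<nu> \<noteq> Poly_Mapping.single v r"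
  show "mcoeff (power_sum r A) \<nu> = 0"
  proof (cases "\<exists>\<mu>. \<nu> = Poly_Mapping.map ((*) r) \<mu>")
    case True
    then obtain \<mu> where \<mu>: "\<nu> = Poly_Mapping.map ((*) r) \<mu>" by blast
    then have "mcoeff A \<mu> = 0"
      using \<nu> by (intro A) (metis map_scale_single)
    then show ?thesis using r by (simp add: \<mu> mcoeff_power_sum_map)
  qed (auto intro: mcoeff_power_sum_other)
qed

lemma mcoeff_alphabet_single: "mcoeff (alphabet V) (Poly_Mapping.single v (Suc 0)) = (if v \<in> V then 1 else 0)"
  by (simp add: alphabet_def single_eq_single_iff)

lemma mcoeff_alphabet_other: "(\<And>v. \<mu> \<noteq> Poly_Mapping.single v (Suc 0)) \<Longrightarrow> mcoeff (alphabet V) \<mu> = 0"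
  by (auto simp: alphabet_def)

lemma power_sum_alphabet:
  "power_sum (Suc n) (alphabet V) = psum (Suc n) (\<lambda>v. if v \<in> V then 1 else 0)"
  by (subst power_sum_linear)
     (auto simp: mcoeff_alphabet_single mcoeff_alphabet_other intro!: arg_cong[of _ _ "psum (Suc n)"])

lemma power_sum_q_minus_1_alphabet:
  "power_sum (Suc n) (q_minus_1 * alphabet V) = psum (Suc n) (\<lambda>v. if v \<in> V then qq ^ Suc n - 1 else 0)"
proof -
  have "mcoeff (q_minus_1 * alphabet V) (Poly_Mapping.single v (Suc 0)) = (if v \<in> V then [:-1, 1:] else 0)" for v
    by (simp add: q_minus_1_def mcoeff_alphabet_single one_pCons)
  moreover have "poly (map_poly K_const [:-1, 1:]) x = x - 1" for x
    by (simp add: map_poly_pCons)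
  ultimately show ?thesis
    by (subst power_sum_linear)
       (auto simp: q_minus_1_def mcoeff_alphabet_other intro!: arg_cong[of _ _ "psum (Suc n)"])
qed

lemma power_sum_one_plus_alphabet: "power_sum (Suc n) (1 + alphabet UNIV) = 1 + psum (Suc n) (\<lambda>_. 1)"
proof (rule mfps_eqI)
  fix \<nu> :: "'a \<Rightarrow>\<^sub>0 nat"
  show "mcoeff (power_sum (Suc n) (1 + alphabet UNIV)) \<nu> = mcoeff (1 + psum (Suc n) (\<lambda>_. 1)) \<nu>"
  proof (cases "\<exists>\<mu>. \<nu> = Poly_Mapping.map ((*) (Suc n)) \<mu>")
    case True
    then obtain \<mu> where \<mu>: "\<nu> = Poly_Mapping.map ((*) (Suc n)) \<mu>" by blast
    have zero: "Poly_Mapping.map ((*) (Suc n)) (0 :: 'a \<Rightarrow>\<^sub>0 nat) = 0"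
      by (rule poly_mapping_eqI) (simp add: lookup_map_scale)
    consider "\<mu> = 0" | v where "\<mu> = Poly_Mapping.single v (Suc 0)" | "\<mu> \<noteq> 0" "\<And>v. \<mu> \<noteq> Poly_Mapping.single v (Suc 0)"
      by blast
    then show ?thesis
    proof cases
      case 1
      have "0 \<noteq> Poly_Mapping.single v (m::nat)" if "m > 0" for v :: 'a and m
        using that by (metis lookup_single_eq lookup_zero less_irrefl)
      then show ?thesis
        using 1 zero mcoeff_power_sum_map[of "Suc n" "1 + alphabet UNIV" "0 :: 'a \<Rightarrow>\<^sub>0 nat"]
        by (simp add: \<mu> mcoeff_1 mcoeff_alphabet_other mcoeff_psum_other)
    next
      case (2 v)
      have "Poly_Mapping.single v (m::nat) \<noteq> 0" if "m > 0" for m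
        using that by (metis lookup_single_eq lookup_zero less_irrefl)
      then show ?thesis
        using mcoeff_power_sum_map[of "Suc n" "1 + alphabet UNIV" "Poly_Mapping.single v (Suc 0)"]
        by (simp add: \<mu> 2 map_scale_single mcoeff_alphabet_single mcoeff_1 mcoeff_psum_single)
    next
      case 3
      have "\<nu> \<noteq> 0"
        using 3(1) \<mu> zero map_scale_inj[of "Suc n" \<mu> 0] by auto
      moreover have "\<nu> \<noteq> Poly_Mapping.single v (Suc n)" for v
        using 3(2) \<mu> map_scale_inj[of "Suc n" \<mu> "Poly_Mapping.single v (Suc 0)"] by (auto simp: map_scale_single)
      ultimately show ?thesis
        using 3 by (simp add: \<mu> mcoeff_power_sum_map mcoeff_1 mcoeff_alphabet_other mcoeff_psum_other)
    qed
  next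
    case False
    then have "\<nu> \<noteq> 0" "\<And>v. \<nu> \<noteq> Poly_Mapping.single v (Suc n)"
      by (metis lookup_map_scale lookup_zero mult_0_right poly_mapping_eqI, metis map_scale_single)
    then show ?thesis
      using False by (simp add: mcoeff_power_sum_other mcoeff_1 mcoeff_psum_other)
  qed
qed

text \<open>Variable \<open>n\<close> is p_(n+1), and the Hall norm of p_k is k.\<close>

definition hall_norm :: "nat \<Rightarrow> 'k::field_char_0" where
  "hall_norm n = of_nat (Suc n)"

interpretation hall: weights Suc "hall_norm :: nat \<Rightarrow> 'k::field_char_0"
  by unfold_locales (simp_all add: hall_norm_def del: of_nat_Suc)

text \<open>Algebraic independence of the power sums: in one alphabet every variable carries the
  constant family 1, which isolates every degree.\<close>

lemma at_X_injective: "at_X F = at_X G \<Longrightarrow> F = G"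
proof -
  assume "at_X F = at_X G"
  then have "at_X (F - G) = 0"
    by (simp add: at_X.hom_minus)
  then have zero: "poly_eval mconst (\<lambda>i. psum (Suc i) (\<lambda>v::nat. 1)) (F - G) = 0"
    by (simp only: at_X_def)
  have adm: "hall.admissible (\<lambda>_. 1 :: 'a)"
    by (auto simp: hall.admissible_def intro: finite_subset[of _ "{..k}" for k])
  have sep: "\<exists>c. hall.isolates c i \<and> infinite {v::nat. (\<lambda>_. 1 :: 'a) = c}" for i
    by (rule exI[of _ "\<lambda>_. 1"]) (simp add: hall.isolates_def)
  show ?thesis
    using hall.poly_eval_psum_injective[of "\<lambda>v n. 1", OF adm sep zero] by simp
qed

text \<open>Injectivity of \<open>at_X\<close> pins down the polynomial chosen in the definition of
  \<open>plethysm\<close>; from here on plethysm is an evaluation homomorphism.\<close>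

theorem plethysm_at_X: "plethysm (at_X F) A = poly_eval mconst (\<lambda>n. power_sum (Suc n) A) F"
proof -
  have eval: "eval_power_sums P A = poly_eval mconst (\<lambda>n. power_sum (Suc n) A) P" for P A
    unfolding eval_power_sums_def poly_eval_def ..
  have "(THE P. eval_power_sums P (alphabet UNIV) = at_X F) = F"
    unfolding eval by (rule the_equality) (simp_all add: power_sum_alphabet at_X_injective flip: at_X_def)
  then show ?thesis by (simp add: plethysm_def eval)
qed


section \<open>Vertex operators\<close>

lemma sum_nat_triangle:
  fixes f :: "nat \<Rightarrow> nat \<Rightarrow> 'a::comm_monoid_add"
  shows "(\<Sum>k\<le>n. \<Sum>i\<le>k. f i (k - i)) = (\<Sum>i\<le>n. \<Sum>j\<le>n - i. f i j)"
  unfolding sum.triangle_reindex_eq[symmetric]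
  by (subst sum.Sigma) (auto intro!: sum.cong)

lemma sum_atMost_cut:
  fixes l :: int
  assumes "\<And>a. int a > l \<Longrightarrow> f a = 0" "0 \<le> l" "l \<le> int A"
  shows "(\<Sum>a\<le>A. f a) = (\<Sum>a\<le>nat l. f a)"
proof (rule sum.mono_neutral_right)
  show "\<forall>a\<in>{..A} - {..nat l}. f a = 0"
    using assms(2) by (auto intro!: assms(1))
qed (use assms in auto)

section \<open>Finite linear combinations\<close>

definition lspan :: "'s set \<Rightarrow> ('s \<Rightarrow> ('i, 'k::comm_ring_1) pl) \<Rightarrow> ('i, 'k) pl set" where
  "lspan I e = {F. \<exists>T c. finite T \<and> T \<subseteq> I \<and> F = (\<Sum>s\<in>T. pconst (c s) * e s)}"

lemma lspan_zero: "0 \<in> lspan I e"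
  unfolding lspan_def by (intro CollectI exI[of _ "{}"]) simp

lemma lspan_base: "s \<in> I \<Longrightarrow> e s \<in> lspan I e"
  unfolding lspan_def by (intro CollectI exI[of _ "{s}"] exI[of _ "\<lambda>_. 1"]) simp

lemma lspan_scale: "F \<in> lspan I e \<Longrightarrow> pconst a * F \<in> lspan I e"
proof -
  assume "F \<in> lspan I e"
  then obtain T c where T: "finite T" "T \<subseteq> I" "F = (\<Sum>s\<in>T. pconst (c s) * e s)"
    by (auto simp: lspan_def)
  show ?thesis
    unfolding lspan_def
    by (intro CollectI exI[of _ T] exI[of _ "\<lambda>s. a * c s"])
       (simp add: T sum_distrib_left pconst.hom_mult mult.assoc)
qed

lemma lspan_add:
  assumes "F \<in> lspan I e" "G \<in> lspan I e"
  shows "F + G \<in> lspan I e"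
proof -
  obtain T c where T: "finite T" "T \<subseteq> I" "F = (\<Sum>s\<in>T. pconst (c s) * e s)"
    using assms by (auto simp: lspan_def)
  obtain U d where U: "finite U" "U \<subseteq> I" "G = (\<Sum>s\<in>U. pconst (d s) * e s)"
    using assms by (auto simp: lspan_def)
  let ?c = "\<lambda>s. if s \<in> T then c s else 0" and ?d = "\<lambda>s. if s \<in> U then d s else 0"
  have "F = (\<Sum>s\<in>T \<union> U. pconst (?c s) * e s)" "G = (\<Sum>s\<in>T \<union> U. pconst (?d s) * e s)"
    unfolding T U by (intro sum.mono_neutral_cong_left; use T U in auto)+
  then have "F + G = (\<Sum>s\<in>T \<union> U. pconst (?c s + ?d s) * e s)"
    by (simp add: pconst.hom_add distrib_right sum.distrib)
  then show ?thesis
    unfolding lspan_def using T U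
    by (intro CollectI exI[of _ "T \<union> U"] exI[of _ "\<lambda>s. ?c s + ?d s"]) auto
qed

lemma lspan_sum: "(\<And>x. x \<in> S \<Longrightarrow> h x \<in> lspan I e) \<Longrightarrow> (\<Sum>x\<in>S. h x) \<in> lspan I e"
  by (induction S rule: infinite_finite_induct) (auto intro: lspan_zero lspan_add)

lemma lspan_induct [consumes 1, case_names zero base add scale]:
  assumes "F \<in> lspan I e"
    and "P 0" "\<And>s. s \<in> I \<Longrightarrow> P (e s)" "\<And>F G. P F \<Longrightarrow> P G \<Longrightarrow> P (F + G)"
    "\<And>c F. P F \<Longrightarrow> P (pconst c * F)"
  shows "P F"
proof -
  obtain T c where T: "finite T" "T \<subseteq> I" "F = (\<Sum>s\<in>T. pconst (c s) * e s)"
    using assms by (auto simp: lspan_def)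
  from T(1,2) have "P (\<Sum>s\<in>T. pconst (c s) * e s)"
    by (induction T rule: finite_induct) (auto simp: assms)
  then show ?thesis by (simp add: T)
qed

text \<open>Finitely many variables in each degree make the constant families 1 and -1 admissible.
  The variables of several alphabets, infinitely many in each degree, form only a
  \<open>weights\<close> structure.\<close>

locale vertex = weights w g for w :: "'i \<Rightarrow> nat" and g :: "'i \<Rightarrow> 'k::field_char_0" +
  assumes finite_weight: "finite {n. w n = k}"
begin

lemma admissible [simp]: "admissible b"
  using finite_weight by (auto simp: admissible_def intro: rev_finite_subset)

text \<open>Integer indices with value 0 below zero let index shifts run freely in the commutation
  relations. In the Hall case \<open>mz l\<close> is the complete function h_l and
  \<open>mbz l\<close> is (-1)^l e_l.\<close>

definition mz :: "int \<Rightarrow> ('i, 'k) pl" where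
  "mz l = (if l < 0 then 0 else Mser (\<lambda>_. 1) $ nat l)"

definition mbz :: "int \<Rightarrow> ('i, 'k) pl" where
  "mbz l = (if l < 0 then 0 else Mser (\<lambda>_. - 1) $ nat l)"

definition Dz :: "'k \<Rightarrow> int \<Rightarrow> ('i, 'k) pl \<Rightarrow> ('i, 'k) pl" where
  "Dz s k F = (if k < 0 then 0 else D (\<lambda>_. s) (nat k) F)"

text \<open>The structure series of the commutation relations: (1 - z)^(-s) in the Hall case and ((1
  + z) / (1 - z))^s for Q-functions.\<close>

definition ccoeff :: "'k \<Rightarrow> nat \<Rightarrow> 'k" where
  "ccoeff s i = cser (\<lambda>_. s) (\<lambda>_. 1) $ i"

lemma ccoeff_0 [simp]: "ccoeff s 0 = 1"
  by (simp add: ccoeff_def cser_def)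

lemma mz_neg [simp]: "l < 0 \<Longrightarrow> mz l = 0" and mbz_neg [simp]: "l < 0 \<Longrightarrow> mbz l = 0"
  and Dz_neg [simp]: "k < 0 \<Longrightarrow> Dz s k F = 0"
  by (simp_all add: mz_def mbz_def Dz_def)

lemma mz_0 [simp]: "mz 0 = 1" and mbz_0 [simp]: "mbz 0 = 1" and Dz_0 [simp]: "Dz s 0 F = F"
  by (simp_all add: mz_def mbz_def Dz_def)

lemma Dz_add: "Dz s k (F + G) = Dz s k F + Dz s k G"
  by (simp add: Dz_def D_add)

lemma Dz_zero [simp]: "Dz s k 0 = 0"
  by (simp add: Dz_def)

lemma Dz_sum: "Dz s k (\<Sum>x\<in>S. f x) = (\<Sum>x\<in>S. Dz s k (f x))"
  by (simp add: Dz_def D_sum)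

lemma Dz_pconst_mult [simp]: "Dz s k (pconst c * F) = pconst c * Dz s k F"
  by (simp add: Dz_def)

lemma Dz_one: "Dz s k 1 = (if k = 0 then 1 else 0)"
  by (auto simp: Dz_def D_one)

lemma Dz_commute: "Dz s j (Dz t k F) = Dz t k (Dz s j F)"
  by (simp add: Dz_def D_commute)

lemma Dz_eventually_zero: "\<exists>N::nat. \<forall>s\<in>{1, - 1}. \<forall>k>int N. Dz s k F = 0"
proof -
  obtain M N where "\<forall>k>M. D (\<lambda>_. 1) k F = 0" "\<forall>k>N. D (\<lambda>_. - 1) k F = 0"
    using D_eventually_zero by meson
  then have "\<forall>s\<in>{1, - 1}. \<forall>k>int (max M N). Dz s k F = 0"
    by (auto simp: Dz_def)
  then show ?thesis by blast
qed

lemma Dz_mz: "Dz s (int i) (mz l) = pconst (ccoeff s i) * mz (l - int i)"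
  by (auto simp: Dz_def mz_def D_Mser ccoeff_def nat_diff_distrib)

lemma Dz_mbz: "Dz s (int i) (mbz l) = pconst (ccoeff (- s) i) * mbz (l - int i)"
proof -
  have "cser (\<lambda>_. s) (\<lambda>_. - 1) = cser (\<lambda>_. - s) (\<lambda>_. 1)"
    unfolding cser_def by (intro arg_cong[of _ _ kexp.fexp] fps_ext) (auto simp del: of_nat_Suc intro!: sum.cong)
  then show ?thesis
    by (auto simp: Dz_def mbz_def D_Mser ccoeff_def nat_diff_distrib)
qed

lemma Dz_mult:
  assumes "k \<le> int I"
  shows "Dz s k (F * G) = (\<Sum>i\<le>I. Dz s (int i) F * Dz s (k - int i) G)"
proof (cases "k < 0")
  case False
  have "Dz s k (F * G) = (\<Sum>i\<le>nat k. Dz s (int i) F * Dz s (k - int i) G)"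
    using False by (auto simp: Dz_def D_mult nat_diff_distrib intro!: sum.cong)
  also have "\<dots> = (\<Sum>i\<le>I. Dz s (int i) F * Dz s (k - int i) G)"
    using assms False by (intro sum_atMost_cut[symmetric]) auto
  finally show ?thesis .
qed simp

lemma Dz_mz_mult:
  "k \<le> int I \<Longrightarrow> Dz s k (mz l * F) = (\<Sum>i\<le>I. pconst (ccoeff s i) * (mz (l - int i) * Dz s (k - int i) F))"
  by (simp add: Dz_mult Dz_mz mult.assoc)

lemma Dz_mbz_mult:
  "k \<le> int I \<Longrightarrow> Dz s k (mbz l * F) = (\<Sum>i\<le>I. pconst (ccoeff (- s) i) * (mbz (l - int i) * Dz s (k - int i) F))"
  by (simp add: Dz_mult Dz_mbz mult.assoc)

lemma sum_mz_mbz: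
  assumes "l \<le> int A"
  shows "(\<Sum>a\<le>A. mbz (int a) * mz (l - int a)) = (if l = 0 then 1 else 0)"
proof (cases "l < 0")
  case False
  have "(\<Sum>a\<le>A. mbz (int a) * mz (l - int a)) = (\<Sum>a\<le>nat l. mbz (int a) * mz (l - int a))"
    using assms False by (intro sum_atMost_cut) auto
  also have "\<dots> = (Mser (\<lambda>_. - 1) * Mser (\<lambda>_. 1)) $ nat l"
    using False by (auto simp: fps_mult_nth atMost_atLeast0 mz_def mbz_def nat_diff_distrib intro!: sum.cong)
  also have "\<dots> = (if l = 0 then 1 else 0)"
    using False by (simp flip: Mser_add)
  finally show ?thesis .
qed simp

lemma sum_Dz_inverse:
  assumes "l \<le> int A"
  shows "(\<Sum>a\<le>A. Dz 1 (int a) (Dz (- 1) (l - int a) F)) = (if l = 0 then F else 0)"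
proof (cases "l < 0")
  case False
  have D0: "D (\<lambda>_. 0) n F = (if n = 0 then F else 0)" for n
    by (rule form_eqI) (auto simp flip: Mser_adjoint)
  have "(\<Sum>a\<le>A. Dz 1 (int a) (Dz (- 1) (l - int a) F)) = (\<Sum>a\<le>nat l. Dz 1 (int a) (Dz (- 1) (l - int a) F))"
    using assms False by (intro sum_atMost_cut) auto
  also have "\<dots> = (\<Sum>a\<le>nat l. D (\<lambda>_. 1) a (D (\<lambda>_. - 1) (nat l - a) F))"
    using False by (auto simp: Dz_def nat_diff_distrib intro!: sum.cong)
  also have "\<dots> = (if l = 0 then F else 0)"
    using False by (simp add: D_convolution D0)
  finally show ?thesis .
qed simp

text \<open>\<open>Vop n\<close> is the coefficient of \<open>z\<^sup>n\<close> in \<open>M(z) T(1/z)\<close>, where \<open>M(z)\<close> is multiplication by \<open>Mser (\<lambda>_. 1)\<close> and \<open>T\<close> the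
  translation by \<open>-1\<close>; \<open>Top n\<close> is its adjoint. Only finitely many terms are nonzero on a given polynomial.\<close>

definition Vop :: "int \<Rightarrow> ('i, 'k) pl \<Rightarrow> ('i, 'k) pl" where
  "Vop n F = (\<Sum>k | Dz (- 1) (int k) F \<noteq> 0. mz (n + int k) * Dz (- 1) (int k) F)"

definition Top :: "int \<Rightarrow> ('i, 'k) pl \<Rightarrow> ('i, 'k) pl" where
  "Top n F = (\<Sum>k | Dz 1 (n + int k) F \<noteq> 0. mbz (int k) * Dz 1 (n + int k) F)"

lemma Vop_eq:
  assumes "\<And>k. k > N \<Longrightarrow> Dz (- 1) (int k) F = 0"
  shows "Vop n F = (\<Sum>k\<le>N. mz (n + int k) * Dz (- 1) (int k) F)"
  unfolding Vop_def
  by (rule sum.mono_neutral_left) (auto, metis assms not_le)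

lemma Top_eq:
  assumes "\<And>k. k > N \<Longrightarrow> Dz 1 (n + int k) F = 0"
  shows "Top n F = (\<Sum>k\<le>N. mbz (int k) * Dz 1 (n + int k) F)"
  unfolding Top_def
  by (rule sum.mono_neutral_left) (auto, metis assms not_le)

lemma Vop_add: "Vop n (F + G) = Vop n F + Vop n G"
proof -
  obtain M N where MN: "\<And>k. k > int M \<Longrightarrow> Dz (- 1) k F = 0" "\<And>k. k > int N \<Longrightarrow> Dz (- 1) k G = 0"
    using Dz_eventually_zero by (meson insertI1 insertI2)
  have *: "Vop n H = (\<Sum>k\<le>max M N. mz (n + int k) * Dz (- 1) (int k) H)" if "H \<in> {F, G, F + G}" for H
    by (rule Vop_eq) (use that MN in \<open>auto simp: Dz_add\<close>)
  show ?thesis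
    by (simp add: * Dz_add distrib_left sum.distrib)
qed

lemma Vop_pconst_mult: "Vop n (pconst c * F) = pconst c * Vop n F"
proof -
  obtain N where N: "\<And>k. k > int N \<Longrightarrow> Dz (- 1) k F = 0"
    using Dz_eventually_zero by (meson insertI1 insertI2)
  have *: "Vop n H = (\<Sum>k\<le>N. mz (n + int k) * Dz (- 1) (int k) H)" if "H \<in> {F, pconst c * F}" for H
    by (rule Vop_eq) (use that N in auto)
  show ?thesis
    by (simp add: * sum_distrib_left mult.left_commute)
qed

lemma Vop_0 [simp]: "Vop n 0 = 0"
  by (simp add: Vop_def)

lemma Vop_sum: "Vop n (\<Sum>x\<in>S. f x) = (\<Sum>x\<in>S. Vop n (f x))"
  by (induction S rule: infinite_finite_induct) (simp_all add: Vop_add)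

lemma Vop_one: "Vop n 1 = mz n"
  by (subst Vop_eq[where N = 0]) (auto simp: Dz_one)

lemma Dz_Vop:
  assumes N: "\<And>k. k > int N \<Longrightarrow> Dz (- 1) k F = 0" and I: "t \<le> int I"
  shows "Dz s t (Vop n F) = (\<Sum>k\<le>N. \<Sum>i\<le>I. pconst (ccoeff s i) *
    (mz (n + int k - int i) * Dz s (t - int i) (Dz (- 1) (int k) F)))"
  by (subst Vop_eq[where N = N]) (simp_all add: N Dz_sum Dz_mz_mult[OF I])

text \<open>Translation by 1 passes a vertex operator at the cost of the structure series; later
  this is covariance in one slot.\<close>

lemma Dz_Vop_commute: "Dz 1 (int k) (Vop n F) = (\<Sum>i\<le>k. pconst (ccoeff 1 i) * Vop (n - int i) (Dz 1 (int k - int i) F))"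
proof -
  obtain N where N: "\<And>k. k > int N \<Longrightarrow> Dz (- 1) k F = 0"
    using Dz_eventually_zero by (meson insertI1 insertI2)
  have "Vop p (Dz 1 l F) = (\<Sum>j\<le>N. mz (p + int j) * Dz 1 l (Dz (- 1) (int j) F))" for p l
    by (subst Vop_eq[where N = N]) (simp_all add: N Dz_commute[of "- 1"])
  then show ?thesis
    by (simp add: Dz_Vop[OF N order_refl] sum_distrib_left algebra_simps)
       (subst sum.swap, simp)
qed

text \<open>Translation is multiplicative, so moving \<open>mz l\<close> out of the operator costs
  only the structure series. This serves to show that spans of iterated vertex operators are closed
  under multiplication by \<open>mz\<close>.\<close>

lemma Vop_mult_mz:
  "Vop n (mz (int l) * F) = (\<Sum>i\<le>l. pconst (ccoeff (- 1) i) * (mz (int l - int i) * Vop (n + int i) F))"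
proof -
  obtain N where N: "\<And>k. k > int N \<Longrightarrow> Dz (- 1) k F = 0"
    using Dz_eventually_zero by (meson insertI1 insertI2)
  have D: "Dz (- 1) (int k) (mz (int l) * F) =
      (\<Sum>i\<le>k. pconst (ccoeff (- 1) i) * (mz (int l - int i) * Dz (- 1) (int (k - i)) F))" for k
    by (subst Dz_mz_mult[where I = k]) (auto simp: of_nat_diff intro!: sum.cong)
  have "Vop n (mz (int l) * F) = (\<Sum>k\<le>N + l. mz (n + int k) * Dz (- 1) (int k) (mz (int l) * F))"
  proof (rule Vop_eq)
    \<comment> \<open>A nonzero term needs \<open>i \<le> l\<close> for \<open>mz\<close> and
      \<open>k - i \<le> N\<close> for the translation.\<close>
    fix k assume "k > N + l"
    then show "Dz (- 1) (int k) (mz (int l) * F) = 0"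
      unfolding D by (intro sum.neutral ballI) (case_tac "x \<le> l"; simp add: N)
  qed
  also have "\<dots> = (\<Sum>k\<le>N + l. \<Sum>i\<le>k. pconst (ccoeff (- 1) i) * (mz (int l - int i) *
      (mz (n + int i + int (k - i)) * Dz (- 1) (int (k - i)) F)))"
    unfolding D sum_distrib_left by (intro sum.cong refl) (simp add: of_nat_diff mult_ac)
  also have "\<dots> = (\<Sum>i\<le>N + l. \<Sum>j\<le>N + l - i. pconst (ccoeff (- 1) i) * (mz (int l - int i) *
      (mz (n + int i + int j) * Dz (- 1) (int j) F)))"
    by (rule sum_nat_triangle)
  also have "\<dots> = (\<Sum>i\<le>l. \<Sum>j\<le>N + l - i. pconst (ccoeff (- 1) i) * (mz (int l - int i) *
      (mz (n + int i + int j) * Dz (- 1) (int j) F)))"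
    by (rule sum.mono_neutral_right) auto
  also have "\<dots> = (\<Sum>i\<le>l. pconst (ccoeff (- 1) i) * (mz (int l - int i) * Vop (n + int i) F))"
  proof (intro sum.cong refl)
    fix i assume "i \<in> {..l}"
    then have "Vop (n + int i) F = (\<Sum>j\<le>N + l - i. mz (n + int i + int j) * Dz (- 1) (int j) F)"
      by (intro Vop_eq) (simp add: N)
    then show "(\<Sum>j\<le>N + l - i. pconst (ccoeff (- 1) i) * (mz (int l - int i) *
        (mz (n + int i + int j) * Dz (- 1) (int j) F))) =
        pconst (ccoeff (- 1) i) * (mz (int l - int i) * Vop (n + int i) F)"
      by (simp add: sum_distrib_left)
  qed
  finally show ?thesis .
qed

text \<open>Normal ordering: multiplications are moved to the left of all translations. As
  translations commute, the symmetry of the product is decided by the bilinear kernel in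
  \<open>mz\<close>.\<close>

theorem Vop_Vop:
  assumes N: "\<And>k. k > int N \<Longrightarrow> Dz (- 1) k F = 0" and I: "n + int N \<le> int I"
  shows "Vop p (Vop n F) = (\<Sum>j\<le>N. \<Sum>k\<le>N.
    (\<Sum>i\<le>I. pconst (ccoeff (- 1) i) * (mz (p + int j + int i) * mz (n + int k - int i))) *
    Dz (- 1) (int j) (Dz (- 1) (int k) F))"
proof -
  let ?X = "\<lambda>j k. Dz (- 1) j (Dz (- 1) (int k) F)"
  have X0: "?X j k = 0" if "j > int N" for j k
    using N[OF that] by (simp add: Dz_commute[of _ j])
  have D: "Dz (- 1) (int t) (Vop n F) = (\<Sum>k\<le>N. \<Sum>i\<le>t. pconst (ccoeff (- 1) i) *
    (mz (n + int k - int i) * ?X (int (t - i)) k))" for t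
    by (subst Dz_Vop[OF N, where I = t]) (auto simp: of_nat_diff intro!: sum.cong)
  have "Vop p (Vop n F) = (\<Sum>t\<le>N + I. mz (p + int t) * Dz (- 1) (int t) (Vop n F))"
  proof (rule Vop_eq)
    \<comment> \<open>For \<open>i \<le> I\<close> the translation index \<open>t - i\<close>
      exceeds \<open>N\<close>; for larger \<open>i\<close> the index \<open>n + k - i\<close> is
      negative.\<close>
    fix t assume t: "t > N + I"
    show "Dz (- 1) (int t) (Vop n F) = 0"
      unfolding D
    proof (intro sum.neutral ballI)
      fix k i assume "k \<in> {..N}" "i \<in> {..t}"
      then show "pconst (ccoeff (- 1) i) * (mz (n + int k - int i) * ?X (int (t - i)) k) = 0"
        using t I by (cases "i \<le> I") (simp_all add: X0)
    qed
  qed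
  also have "\<dots> = (\<Sum>k\<le>N. \<Sum>t\<le>N + I. \<Sum>i\<le>t. pconst (ccoeff (- 1) i) *
      (mz (p + int i + int (t - i)) * mz (n + int k - int i)) * ?X (int (t - i)) k)"
    unfolding D sum_distrib_left
    by (subst sum.swap, intro sum.cong refl) (simp add: of_nat_diff mult_ac)
  also have "\<dots> = (\<Sum>k\<le>N. \<Sum>i\<le>N + I. \<Sum>j\<le>N + I - i. pconst (ccoeff (- 1) i) *
      (mz (p + int i + int j) * mz (n + int k - int i)) * ?X (int j) k)"
    by (rule sum.cong[OF refl]) (rule sum_nat_triangle)
  also have "\<dots> = (\<Sum>k\<le>N. \<Sum>i\<le>I. \<Sum>j\<le>N + I - i. pconst (ccoeff (- 1) i) *
      (mz (p + int i + int j) * mz (n + int k - int i)) * ?X (int j) k)"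
    using I by (intro sum.cong refl sum.mono_neutral_right) auto
  also have "\<dots> = (\<Sum>k\<le>N. \<Sum>i\<le>I. \<Sum>j\<le>N. pconst (ccoeff (- 1) i) *
      (mz (p + int i + int j) * mz (n + int k - int i)) * ?X (int j) k)"
    by (intro sum.cong refl sum.mono_neutral_right) (auto simp: X0)
  also have "\<dots> = (\<Sum>k\<le>N. \<Sum>j\<le>N. \<Sum>i\<le>I. pconst (ccoeff (- 1) i) *
      (mz (p + int i + int j) * mz (n + int k - int i)) * ?X (int j) k)"
    by (rule sum.cong[OF refl]) (rule sum.swap)
  also have "\<dots> = (\<Sum>j\<le>N. \<Sum>k\<le>N. \<Sum>i\<le>I. pconst (ccoeff (- 1) i) *
      (mz (p + int i + int j) * mz (n + int k - int i)) * ?X (int j) k)"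
    by (rule sum.swap)
  finally show ?thesis
    by (simp add: sum_distrib_right add_ac)
qed

text \<open>In \<open>Vop_mult_mz\<close> the term \<open>i = 0\<close> has coefficient 1 and is the
  wanted product; the other terms have smaller \<open>l\<close> and shifted \<open>n\<close>, hence
  the strong induction for all \<open>n\<close>.\<close>

lemma mz_mult_Vop_closed:
  assumes add: "\<And>F G. F \<in> V \<Longrightarrow> G \<in> V \<Longrightarrow> F + G \<in> V"
    and scale: "\<And>c F. F \<in> V \<Longrightarrow> pconst c * F \<in> V"
    and zero: "0 \<in> V"
    and Vop: "\<And>n F. F \<in> V \<Longrightarrow> Vop n F \<in> V"
    and F: "\<And>l. mz (int l) * F \<in> V"
  shows "mz (int l) * Vop n F \<in> V"
proof (induction l arbitrary: n rule: less_induct)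
  case (less l)
  have sum: "(\<Sum>x\<in>S. h x) \<in> V" if "\<And>x. x \<in> S \<Longrightarrow> h x \<in> V" for S :: "nat set" and h
    using that by (induction S rule: infinite_finite_induct) (auto simp: zero add)
  let ?h = "\<lambda>i. pconst (ccoeff (- 1) i) * (mz (int l - int i) * Vop (n + int i) F)"
  have "Vop n (mz (int l) * F) = mz (int l) * Vop n F + (\<Sum>i=1..l. ?h i)"
  proof -
    have "{..l} = insert 0 {1..l}" by auto
    then show ?thesis by (simp add: Vop_mult_mz)
  qed
  then have "mz (int l) * Vop n F = Vop n (mz (int l) * F) + pconst (- 1) * (\<Sum>i=1..l. ?h i)"
    unfolding pconst.hom_uminus pconst.hom_one by simp
  also have "\<dots> \<in> V"
  proof (intro add scale Vop F sum)
    fix i assume "i \<in> {1..l}"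
    then have "mz (int (l - i)) * Vop (n + int i) F \<in> V"
      by (intro less) auto
    then show "mz (int l - int i) * Vop (n + int i) F \<in> V"
      using \<open>i \<in> {1..l}\<close> by (simp add: of_nat_diff)
  qed
  finally show ?case .
qed

text \<open>With at most one variable per degree the family 1 isolates each of them, so the
  coefficients \<open>mz l\<close> generate all polynomials.\<close>

lemma closed_under_mz_imp_UNIV:
  assumes "inj w"
    and one: "1 \<in> V"
    and add: "\<And>F G. F \<in> V \<Longrightarrow> G \<in> V \<Longrightarrow> F + G \<in> V"
    and scale: "\<And>c F. F \<in> V \<Longrightarrow> pconst c * F \<in> V"
    and mz: "\<And>l F. F \<in> V \<Longrightarrow> mz (int l) * F \<in> V"
  shows "F \<in> V"
proof (rule subspace_closed_imp_UNIV[OF one add scale])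
  fix i F assume "F \<in> V"
  then show "pvar i * F \<in> V"
  proof (rule closed_under_Mser_imp_var[rotated 4])
    show "0 \<in> V"
      using scale[OF one, of 0] by simp
    show "\<exists>c. isolates c i \<and> (\<forall>F\<in>V. \<forall>k. Mser c $ k * F \<in> V)" for i
      using mz assms(1) by (intro exI[of _ "\<lambda>_. 1"]) (auto simp: isolates_def mz_def inj_def)
  qed (use add scale in auto)
qed auto

lemma Mser_adjoint_mz: "B (mz l * F) G = B F (Dz 1 l G)"
  by (simp add: mz_def Dz_def Mser_adjoint)

lemma Mser_adjoint_mbz: "B (Dz (- 1) l F) G = B F (mbz l * G)"
  by (simp add: form_commute[of g _ G] form_commute[of g F] mbz_def Dz_def Mser_adjoint)

theorem Vop_adjoint: "B (Vop n F) G = B F (Top n G)"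
proof -
  obtain M N where MN: "\<And>k. k > int M \<Longrightarrow> Dz (- 1) k F = 0" "\<And>k. k > int N \<Longrightarrow> Dz 1 k G = 0"
    using Dz_eventually_zero by (meson insertI1 insertI2)
  let ?N = "M + N + nat \<bar>n\<bar>"
  have "B (Vop n F) G = (\<Sum>k\<le>?N. B (mz (n + int k) * Dz (- 1) (int k) F) G)"
    by (subst Vop_eq[where N = ?N]) (simp_all add: MN form_sum_left)
  also have "\<dots> = (\<Sum>k\<le>?N. B F (mbz (int k) * Dz 1 (n + int k) G))"
    by (simp add: Mser_adjoint_mz Mser_adjoint_mbz)
  also have "\<dots> = B F (Top n G)"
    by (subst Top_eq[where N = ?N]) (simp_all add: MN form_sum_right)
  finally show ?thesis .
qed

end


section \<open>Schur functions\<close>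

interpretation hall: vertex Suc "hall_norm :: nat \<Rightarrow> 'k::field_char_0"
proof
  show "finite {n. Suc n = k}" for k
    by (rule finite_subset[of _ "{..k}"]) auto
qed

lemma hall_ccoeff: "hall.ccoeff (s :: 'k::field_char_0) i = kexp.fexp (Abs_fps (\<lambda>_. s)) $ i"
proof -
  have "1 + of_nat k \<noteq> (0 :: 'k)" for k
    by (metis of_nat_Suc of_nat_neq_0)
  then show ?thesis
    by (simp add: hall.ccoeff_def hall.cser_def hall_norm_def)
qed

lemma hall_ccoeff_1: "hall.ccoeff 1 i = (1 :: 'k::field_char_0)"
proof -
  have "Abs_fps (\<lambda>_. 1) = kexp.fexp (Abs_fps (\<lambda>_. 1 :: 'k))"
    by (rule kexp.fexp_unique) (simp_all add: fps_eq_iff fps_mult_nth)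
  then show ?thesis
    by (metis fps_nth_Abs_fps hall_ccoeff)
qed

lemma hall_ccoeff_minus: "hall.ccoeff (- 1) i = (if i = 0 then 1 else if i = 1 then - 1 else 0 :: 'k::field_char_0)"
proof -
  have "(1 - fps_X) = kexp.fexp (Abs_fps (\<lambda>_. - 1 :: 'k))"
  proof (rule kexp.fexp_unique)
    show "fps_deriv (1 - fps_X) = Abs_fps (\<lambda>_. - 1) * (1 - fps_X :: 'k fps)"
    proof (rule fps_ext)
      fix n
      show "fps_deriv (1 - fps_X) $ n = (Abs_fps (\<lambda>_. - 1) * (1 - fps_X :: 'k fps)) $ n"
        by (cases n) (simp_all add: right_diff_distrib)
    qed
  qed simp
  then have "hall.ccoeff (- 1) i = (1 - fps_X :: 'k fps) $ i"
    by (simp add: hall_ccoeff)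
  then show ?thesis
    by (simp add: fps_X_def)
qed

text \<open>The structure series 1 - z has two terms, so the kernel of \<open>Vop_Vop\<close> is
  \<open>mz p * mz q - mz (p + 1) * mz (q - 1)\<close>, which changes sign when (p, q) becomes (q -
  1, p + 1).\<close>

lemma Bernstein_anticommute: "hall.Vop m (hall.Vop n F) = - hall.Vop (n - 1) (hall.Vop (m + 1) F)"
proof -
  obtain N where N: "\<And>k. k > int N \<Longrightarrow> hall.Dz (- 1) k F = 0"
    using hall.Dz_eventually_zero by (meson insertI1 insertI2)
  let ?X = "\<lambda>j k. hall.Dz (- 1) (int j) (hall.Dz (- 1) (int k) F)"
  define I where "I = Suc (N + nat \<bar>m\<bar> + nat \<bar>n\<bar>)"
  then have I: "1 \<le> I" "n + int N \<le> int I" "m + 1 + int N \<le> int I"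
    by auto
  have *: "(\<Sum>i\<le>I. pconst (hall.ccoeff (- 1) i) * (hall.mz (p + int i) * hall.mz (q - int i))) =
      hall.mz p * hall.mz q - hall.mz (p + 1) * hall.mz (q - 1)" for p q
  proof -
    have "(\<Sum>i\<le>I. pconst (hall.ccoeff (- 1) i) * (hall.mz (p + int i) * hall.mz (q - int i))) =
      (\<Sum>i\<in>{0, 1}. pconst (hall.ccoeff (- 1) i) * (hall.mz (p + int i) * hall.mz (q - int i)))"
      using I by (intro sum.mono_neutral_right) (auto simp: hall_ccoeff_minus)
    then show ?thesis
      unfolding hall_ccoeff_minus by (simp add: pconst.hom_uminus)
  qed
  have "hall.Vop m (hall.Vop n F) = (\<Sum>j\<le>N. \<Sum>k\<le>N. (hall.mz (m + int j) * hall.mz (n + int k) -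
      hall.mz (m + int j + 1) * hall.mz (n + int k - 1)) * ?X j k)"
    by (subst hall.Vop_Vop[where N = N and I = I]) (simp_all add: N I *)
  moreover have "hall.Vop (n - 1) (hall.Vop (m + 1) F) = (\<Sum>j\<le>N. \<Sum>k\<le>N. (hall.mz (n - 1 + int j) * hall.mz (m + 1 + int k) -
      hall.mz (n - 1 + int j + 1) * hall.mz (m + 1 + int k - 1)) * ?X j k)"
    by (subst hall.Vop_Vop[where N = N and I = I]) (simp_all add: N I *)
  then have "hall.Vop (n - 1) (hall.Vop (m + 1) F) = (\<Sum>j\<le>N. \<Sum>k\<le>N. (hall.mz (n + int k - 1) * hall.mz (m + int j + 1) -
      hall.mz (n + int k) * hall.mz (m + int j)) * ?X k j)"
    by (subst (asm) sum.swap) (simp add: algebra_simps)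
  then have "hall.Vop (n - 1) (hall.Vop (m + 1) F) = - (\<Sum>j\<le>N. \<Sum>k\<le>N. (hall.mz (m + int j) * hall.mz (n + int k) -
      hall.mz (m + int j + 1) * hall.mz (n + int k - 1)) * ?X k j)"
    by (simp add: sum_negf[symmetric] algebra_simps)
  moreover have "?X k j = ?X j k" for j k
    by (rule hall.Dz_commute)
  ultimately show ?thesis by simp
qed

text \<open>The index sets will be convenient boxes between which the maps are no bijections; only
  the nonzero terms have to correspond.\<close>

lemma sum_reindex_support:
  assumes "finite S" "finite T"
    and "\<And>a. a \<in> S \<Longrightarrow> g a \<noteq> 0 \<Longrightarrow> j a \<in> T \<and> i (j a) = a \<and> h (j a) = g a"
    and "\<And>b. b \<in> T \<Longrightarrow> h b \<noteq> 0 \<Longrightarrow> i b \<in> S \<and> j (i b) = b \<and> g (i b) = h b"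
  shows "sum g S = (sum h T :: 'a::comm_monoid_add)"
proof -
  have "sum g S = sum g {a \<in> S. g a \<noteq> 0}"
    using assms(1) by (intro sum.mono_neutral_right) auto
  also have "\<dots> = sum h {b \<in> T. h b \<noteq> 0}"
    by (rule sum.reindex_bij_witness[of _ i j]) (use assms(3,4) in \<open>force+\<close>)
  also have "\<dots> = sum h T"
    using assms(2) by (intro sum.mono_neutral_left) auto
  finally show ?thesis .
qed

text \<open>Both products are sums of the same terms \<open>Y c d a\<close>, as one structure series
  is expanded in opposite directions: the first collects \<open>c \<le> m + a\<close>, the second
  the rest. The unrestricted sum over \<open>a\<close> collapses because \<open>mz\<close> and
  \<open>mbz\<close> belong to inverse series, and what remains is a translation composed with its
  inverse.\<close>

theorem Bernstein_adjoint_relation: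
  "hall.Top m (hall.Vop n F) + hall.Vop (n + 1) (hall.Top (m + 1) F) = (if m = n then F else 0)"
proof -
  obtain N where N: "\<And>k. k > int N \<Longrightarrow> hall.Dz (- 1) k F = 0" "\<And>k. k > int N \<Longrightarrow> hall.Dz 1 k F = 0"
    using hall.Dz_eventually_zero by (meson insertI1 insertI2)
  \<comment> \<open>\<open>A\<close>, and \<open>I\<close> below, exceed the indices at which terms
    can be nonzero.\<close>
  define A where "A = 2 * N + nat \<bar>n\<bar> + nat \<bar>m\<bar> + 1"
  define X where "X c d = hall.Dz 1 c (hall.Dz (- 1) d F)" for c d
  have X0: "X c d = 0" if "c < 0 \<or> d < 0 \<or> c > int N \<or> d > int N" for c d
    using that N unfolding X_def by (metis hall.Dz_commute hall.Dz_neg hall.Dz_zero)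
  have X_nz: "0 \<le> c \<and> c \<le> int N \<and> 0 \<le> d \<and> d \<le> int N" if "X c d \<noteq> 0" for c d
    using X0[of c d] that by fastforce
  define Y where "Y c d a = hall.mbz a * hall.mz (n - m + c + d - a) * X c d" for c d a
  define I where "I = 3 * A"
  have TS: "hall.Top m (hall.Vop n F) = (\<Sum>(c, d, a)\<in>{..N} \<times> {..N} \<times> {..A}.
      if int c \<le> m + int a then Y (int c) (int d) (int a) else 0)"
  proof -
    have D: "hall.Dz 1 (m + int a) (hall.Vop n F) =
        (\<Sum>d\<le>N. \<Sum>i\<le>I. hall.mz (n + int d - int i) * X (m + int a - int i) (int d))" if "a \<le> A" for a
      using that by (subst hall.Dz_Vop[OF N(1), where I = I]) (auto simp: I_def A_def hall_ccoeff_1 X_def)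
    have "hall.Top m (hall.Vop n F) = (\<Sum>a\<le>A. hall.mbz (int a) * hall.Dz 1 (m + int a) (hall.Vop n F))"
    proof (rule hall.Top_eq)
      fix a assume a: "a > A"
      have "hall.Dz 1 (m + int a) (hall.Vop n F) = (\<Sum>d\<le>N. \<Sum>i\<le>nat (\<bar>m\<bar> + int a).
          hall.mz (n + int d - int i) * X (m + int a - int i) (int d))"
        by (subst hall.Dz_Vop[OF N(1), where I = "nat (\<bar>m\<bar> + int a)"]) (auto simp: hall_ccoeff_1 X_def)
      also have "\<dots> = 0"
      proof (intro sum.neutral ballI)
        fix d i assume d: "d \<in> {..N}"
        show "hall.mz (n + int d - int i) * X (m + int a - int i) (int d) = 0"
        proof (cases "int i \<le> n + int d")
          case True
          then have "m + int a - int i > int N"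
            using a d by (auto simp: A_def)
          then show ?thesis by (simp add: X0)
        qed simp
      qed
      finally show "hall.Dz 1 (m + int a) (hall.Vop n F) = 0" .
    qed
    also have "\<dots> = (\<Sum>(a, d, i)\<in>{..A} \<times> {..N} \<times> {..I}.
        hall.mbz (int a) * hall.mz (n + int d - int i) * X (m + int a - int i) (int d))"
      by (simp add: D sum_distrib_left sum.cartesian_product mult.assoc split_def)
    also have "\<dots> = (\<Sum>(c, d, a)\<in>{..N} \<times> {..N} \<times> {..A}.
        if int c \<le> m + int a then Y (int c) (int d) (int a) else 0)"
    \<comment> \<open>Substitution \<open>c = m + a - i\<close>, the index of the translation by
      1.\<close>
    proof (rule sum_reindex_support[where
          i = "\<lambda>(c, d, a). (a, d, nat (m + int a - int c))" and
          j = "\<lambda>(a, d, i). (nat (m + int a - int i), d, a)"], goal_cases)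
      case (3 x)
      then obtain a d i where x: "x = (a, d, i)" and le: "a \<le> A" "d \<le> N" "i \<le> I"
        and nz: "X (m + int a - int i) (int d) \<noteq> 0"
        by (auto split: prod.splits)
      then show ?case
        using X_nz[OF nz] by (auto simp: Y_def algebra_simps)
    next
      case (4 x)
      then obtain c d a where x: "x = (c, d, a)" and le: "c \<le> N" "d \<le> N" "a \<le> A" "int c \<le> m + int a"
        by (auto split: prod.splits if_splits)
      then show ?case
        by (auto simp: Y_def I_def A_def algebra_simps)
    qed auto
    finally show ?thesis .
  qed
  have ST: "hall.Vop (n + 1) (hall.Top (m + 1) F) = (\<Sum>(c, d, a)\<in>{..N} \<times> {..N} \<times> {..A}.
      if int c \<le> m + int a then 0 else Y (int c) (int d) (int a))"
  proof -
    have T: "hall.Top (m + 1) F = (\<Sum>k\<le>A. hall.mbz (int k) * hall.Dz 1 (m + 1 + int k) F)"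
      by (rule hall.Top_eq) (simp add: N A_def)
    have D: "hall.Dz (- 1) (int t) (hall.Top (m + 1) F) =
        (\<Sum>k\<le>A. \<Sum>i\<le>I. hall.mbz (int k - int i) * X (m + 1 + int k) (int t - int i))" if "t \<le> I" for t
      using that unfolding T hall.Dz_sum
      by (subst hall.Dz_mbz_mult[where I = I]) (auto simp: hall_ccoeff_1 X_def hall.Dz_commute[of "- 1" _ 1])
    have "hall.Vop (n + 1) (hall.Top (m + 1) F) =
        (\<Sum>t\<le>I. hall.mz (n + 1 + int t) * hall.Dz (- 1) (int t) (hall.Top (m + 1) F))"
    proof (rule hall.Vop_eq)
      fix t assume t: "t > I"
      have "hall.Dz (- 1) (int t) (hall.Top (m + 1) F) =
          (\<Sum>k\<le>A. \<Sum>i\<le>t. hall.mbz (int k - int i) * X (m + 1 + int k) (int t - int i))"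
        unfolding T hall.Dz_sum
        by (subst hall.Dz_mbz_mult[where I = t]) (auto simp: hall_ccoeff_1 X_def hall.Dz_commute[of "- 1" _ 1])
      also have "\<dots> = 0"
      proof (intro sum.neutral ballI)
        fix k i assume k: "k \<in> {..A}"
        show "hall.mbz (int k - int i) * X (m + 1 + int k) (int t - int i) = 0"
        proof (cases "i \<le> k")
          case True
          then have "int t - int i > int N"
            using t k by (auto simp: I_def A_def)
          then show ?thesis by (simp add: X0)
        qed simp
      qed
      finally show "hall.Dz (- 1) (int t) (hall.Top (m + 1) F) = 0" .
    qed
    also have "\<dots> = (\<Sum>(t, k, i)\<in>{..I} \<times> {..A} \<times> {..I}.
        hall.mz (n + 1 + int t) * (hall.mbz (int k - int i) * X (m + 1 + int k) (int t - int i)))"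
      by (simp add: D sum_distrib_left sum.cartesian_product split_def)
    also have "\<dots> = (\<Sum>(c, d, a)\<in>{..N} \<times> {..N} \<times> {..A}.
        if int c \<le> m + int a then 0 else Y (int c) (int d) (int a))"
    \<comment> \<open>Substitution \<open>c = m + 1 + k\<close>, \<open>d = t - i\<close>,
      \<open>a = k - i\<close>; the condition \<open>i \<ge> 0\<close> becomes
      \<open>c > m + a\<close>.\<close>
    proof (rule sum_reindex_support[where
          i = "\<lambda>(c, d, a). (d + nat (int c - m - 1 - int a), nat (int c - m - 1), nat (int c - m - 1 - int a))" and
          j = "\<lambda>(t, k, i). (nat (m + 1 + int k), t - i, k - i)"], goal_cases)
      case (3 x)
      obtain t k i where x: "x = (t, k, i)"
        by (rule prod_cases3)
      then have le: "t \<le> I" "k \<le> A" "i \<le> I"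
        and nz: "X (m + 1 + int k) (int t - int i) \<noteq> 0"
        and "hall.mbz (int k - int i) * X (m + 1 + int k) (int t - int i) \<noteq> 0"
        using 3 by auto
      then have "i \<le> k"
        by (intro leI notI) simp
      then show ?case
        using x le X_nz[OF nz] by (auto simp: Y_def of_nat_diff algebra_simps)
    next
      case (4 x)
      then obtain c d a where x: "x = (c, d, a)" and le: "c \<le> N" "d \<le> N" "a \<le> A" "\<not> int c \<le> m + int a"
        by (auto split: prod.splits if_splits)
      then show ?case
        by (auto simp: Y_def I_def A_def algebra_simps)
    qed auto
    finally show ?thesis .
  qed
  have "hall.Top m (hall.Vop n F) + hall.Vop (n + 1) (hall.Top (m + 1) F) =
      (\<Sum>(c, d, a)\<in>{..N} \<times> {..N} \<times> {..A}. Y (int c) (int d) (int a))"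
    unfolding TS ST sum.distrib[symmetric] by (intro sum.cong) auto
  also have "\<dots> = (\<Sum>c\<le>N. \<Sum>d\<le>N. \<Sum>a\<le>A. Y (int c) (int d) (int a))"
    by (simp add: sum.cartesian_product)
  also have "\<dots> = (\<Sum>c\<le>N. \<Sum>d\<le>N. if n - m + int c + int d = 0 then X (int c) (int d) else 0)"
  proof (intro sum.cong refl)
    fix c d assume "c \<in> {..N}" "d \<in> {..N}"
    then have *: "(\<Sum>a\<le>A. hall.mbz (int a) * hall.mz (n - m + int c + int d - int a)) =
        (if n - m + int c + int d = 0 then 1 else 0)"
      by (intro hall.sum_mz_mbz) (auto simp: A_def)
    then show "(\<Sum>a\<le>A. Y (int c) (int d) (int a)) = (if n - m + int c + int d = 0 then X (int c) (int d) else 0)"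
      unfolding Y_def sum_distrib_right[symmetric] * by simp
  qed
  also have "\<dots> = (\<Sum>c\<le>N. X (int c) (m - n - int c))"
  proof (intro sum.cong refl)
    fix c assume "c \<in> {..N}"
    show "(\<Sum>d\<le>N. if n - m + int c + int d = 0 then X (int c) (int d) else 0) = X (int c) (m - n - int c)"
    proof (cases "0 \<le> m - n - int c \<and> m - n - int c \<le> int N")
      case True
      have "(\<Sum>d\<le>N. if n - m + int c + int d = 0 then X (int c) (int d) else 0) =
          (\<Sum>d\<le>N. if d = nat (m - n - int c) then X (int c) (m - n - int c) else 0)"
        using True by (intro sum.cong) auto
      then show ?thesis using True by (simp add: nat_le_iff)
    next
      case False
      then show ?thesis by (subst X0) (auto intro!: sum.neutral)
    qed
  qed
  also have "\<dots> = (\<Sum>c\<le>A. X (int c) (m - n - int c))"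
    by (rule sum.mono_neutral_left) (auto simp: A_def X0)
  also have "\<dots> = (if m = n then F else 0)"
    unfolding X_def by (subst hall.sum_Dz_inverse) (auto simp: A_def)
  finally show ?thesis .
qed

section \<open>Schur functions from creation operators\<close>

definition schur_poly :: "nat list \<Rightarrow> (nat, K) pl" where
  "schur_poly \<pi> = foldr (\<lambda>a. hall.Vop (int a)) \<pi> 1"

lemma schur_poly_simps [simp]:
  "schur_poly [] = 1" "schur_poly (a # \<pi>) = hall.Vop (int a) (schur_poly \<pi>)"
  by (simp_all add: schur_poly_def)

lemma partitions_Nil [simp]: "[] \<in> partitions"
  by (simp add: partitions_def)

lemma partitions_Cons: "a # \<pi> \<in> partitions \<longleftrightarrow> 0 < a \<and> (\<pi> = [] \<or> hd \<pi> \<le> a) \<and> \<pi> \<in> partitions"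
  by (cases \<pi>) (auto simp: partitions_def)

text \<open>Each creation operator is passed at the price of raising the index of \<open>Top\<close>
  by 1. It stays above the parts, so the scalar term never appears, and positive translation modes
  kill 1.\<close>

lemma Top_schur_poly_zero:
  "\<pi> \<in> partitions \<Longrightarrow> m > 0 \<Longrightarrow> \<pi> = [] \<or> int (hd \<pi>) < m \<Longrightarrow> hall.Top m (schur_poly \<pi>) = 0"
proof (induction \<pi> arbitrary: m)
  case Nil
  then show ?case by (simp add: hall.Top_def hall.Dz_one)
next
  case (Cons a \<pi>)
  then have "hall.Top (m + 1) (schur_poly \<pi>) = 0"
    by (intro Cons) (auto simp: partitions_Cons)
  then show ?case
    using Bernstein_adjoint_relation[of m "int a" "schur_poly \<pi>"] Cons by simp
qed

lemma Top_schur_poly_Cons: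
  assumes "a # \<pi> \<in> partitions"
  shows "hall.Top (int a) (schur_poly (a # \<pi>)) = schur_poly \<pi>"
proof -
  have "hall.Top (int a + 1) (schur_poly \<pi>) = 0"
    using assms by (intro Top_schur_poly_zero) (auto simp: partitions_Cons)
  then show ?thesis
    using Bernstein_adjoint_relation[of "int a" "int a" "schur_poly \<pi>"] by simp
qed

text \<open>The larger of the two first parts is moved across the form: \<open>Top\<close> removes
  it from a partition with the same first part and kills one with a smaller first part.\<close>

theorem schur_poly_orthonormal:
  "\<pi> \<in> partitions \<Longrightarrow> \<rho> \<in> partitions \<Longrightarrow> hall.B (schur_poly \<pi>) (schur_poly \<rho>) = (if \<pi> = \<rho> then 1 else 0)"
proof (induction \<pi> arbitrary: \<rho>)
  case Nil
  then show ?case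
  proof (cases \<rho>)
    case (Cons b \<rho>')
    then have "hall.B 1 (schur_poly \<rho>) = hall.B (schur_poly \<rho>') (hall.Top (int b) (schur_poly []))"
      by (simp add: form_commute[of _ 1] hall.Vop_adjoint del: form_one_left form_one_right)
    then show ?thesis
      using Cons Nil by (subst (asm) Top_schur_poly_zero) (auto simp: partitions_Cons)
  qed simp
next
  case (Cons a \<pi>)
  show ?case
  proof (cases "\<rho> = [] \<or> hd \<rho> < a")
    case True
    then have "hall.Top (int a) (schur_poly \<rho>) = 0"
      using Cons.prems by (intro Top_schur_poly_zero) (auto simp: partitions_Cons)
    then show ?thesis
      using True by (auto simp: hall.Vop_adjoint)
  next
    case False
    then obtain b \<rho>' where \<rho>: "\<rho> = b # \<rho>'" "a \<le> b"
      by (cases \<rho>) auto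
    show ?thesis
    proof (cases "a = b")
      case True
      then show ?thesis
        using Cons \<rho> Top_schur_poly_Cons[of a \<rho>'] by (auto simp: hall.Vop_adjoint partitions_Cons)
    next
      case False
      then have "hall.Top (int b) (schur_poly (a # \<pi>)) = 0"
        using Cons.prems \<rho> by (intro Top_schur_poly_zero) (auto simp: partitions_Cons)
      then show ?thesis
        using False \<rho> by (simp add: form_commute[of _ "hall.Vop (int a) (schur_poly \<pi>)"] hall.Vop_adjoint)
    qed
  qed
qed

text \<open>Straightening. An index that is too small is exchanged with the first part
  \<open>a\<close>, becoming \<open>n + 1\<close> inside and leaving \<open>a - 1\<close> outside.
  The bound on the first part of \<mu> allows \<open>a - 1\<close> to be put in front.\<close>

lemma Vop_schur_poly:
  "\<pi> \<in> partitions \<Longrightarrow> \<exists>c. \<exists>\<mu>\<in>partitions. (\<mu> = [] \<or> int (hd \<mu>) \<le> max n (if \<pi> = [] then n else int (hd \<pi>) - 1)) \<and>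
    hall.Vop n (schur_poly \<pi> :: (nat, K) pl) = pconst c * schur_poly \<mu>"
proof (induction \<pi> arbitrary: n)
  case Nil
  consider "n < 0" | "n = 0" | "n > 0" by linarith
  then show ?case
  proof cases
    case 1
    then show ?thesis by (intro exI[of _ 0] bexI[of _ "[]"]) (simp_all add: hall.Vop_one)
  next
    case 2
    then show ?thesis by (intro exI[of _ 1] bexI[of _ "[]"]) (simp_all add: hall.Vop_one)
  next
    case 3
    then show ?thesis by (intro exI[of _ 1] bexI[of _ "[nat n]"]) (simp_all add: partitions_Cons)
  qed
next
  case (Cons a \<pi>)
  consider "n \<ge> int a" | "n = int a - 1" | "n < int a - 1" by linarith
  then show ?case
  proof cases
    case 1
    then show ?thesis
      using Cons.prems by (intro exI[of _ 1] bexI[of _ "nat n # a # \<pi>"]) (auto simp: partitions_Cons)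
  next
    case 2
    \<comment> \<open>For \<open>n = a - 1\<close> the exchange fixes the pair of indices, so the
      product equals its negative.\<close>
    have eq: "hall.Vop n (hall.Vop (int a) (schur_poly \<pi>)) = - hall.Vop n (hall.Vop (int a) (schur_poly \<pi>))"
      using Bernstein_anticommute[of n "int a" "schur_poly \<pi>"] 2 by simp
    have "F = - F \<Longrightarrow> F = 0" for F :: "(nat, K) pl"
      by (simp add: poly_mapping_eq_iff fun_eq_iff)
    then have "hall.Vop n (schur_poly (a # \<pi>) :: (nat, K) pl) = 0"
      using eq by simp
    then show ?thesis by (intro exI[of _ 0] bexI[of _ "[]"]) simp_all
  next
    case 3
    obtain c \<mu> where \<mu>: "\<mu> \<in> partitions" "\<mu> = [] \<or> int (hd \<mu>) \<le> max (n + 1) (if \<pi> = [] then n + 1 else int (hd \<pi>) - 1)"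
      "hall.Vop (n + 1) (schur_poly \<pi> :: (nat, K) pl) = pconst c * schur_poly \<mu>"
      using Cons.IH[of "n + 1"] Cons.prems by (auto simp: partitions_Cons)
    have eq: "hall.Vop n (schur_poly (a # \<pi>) :: (nat, K) pl) = pconst (- c) * hall.Vop (int a - 1) (schur_poly \<mu>)"
      using Bernstein_anticommute[of n "int a" "schur_poly \<pi> :: (nat, K) pl"]
      by (simp add: \<mu>(3) hall.Vop_pconst_mult pconst.hom_uminus)
    have \<mu>_le: "\<mu> = [] \<or> hd \<mu> \<le> a - 1"
      using \<mu>(2) 3 Cons.prems by (auto simp: partitions_Cons split: if_splits)
    show ?thesis
    \<comment> \<open>If \<open>a - 1 = 0\<close>, it is no part; but then \<mu> is empty and
      \<open>hall.Vop 0 1\<close> is 1.\<close>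
    proof (cases "a = 1")
      case True
      then have "\<mu> = []"
        using \<mu>_le \<mu>(1) by (cases \<mu>) (auto simp: partitions_Cons)
      then show ?thesis
        using eq True by (intro exI[of _ "- c"] bexI[of _ "[]"]) (simp_all add: hall.Vop_one)
    next
      case False
      then have "(a - 1) # \<mu> \<in> partitions"
        using \<mu> \<mu>_le Cons.prems by (auto simp: partitions_Cons)
      then show ?thesis
        using eq False Cons.prems
        by (intro exI[of _ "- c"] bexI[of _ "(a - 1) # \<mu>"]) (auto simp: of_nat_diff partitions_Cons)
    qed
  qed
qed

text \<open>Straightening closes the span under vertex operators, \<open>mz_mult_Vop_closed\<close>
  under multiplication by \<open>mz\<close>, and these elements generate the ring.\<close>

theorem schur_poly_spanning: "(F :: (nat, K) pl) \<in> lspan partitions schur_poly"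
proof -
  let ?V = "lspan partitions schur_poly :: (nat, K) pl set"
  have Vop: "hall.Vop n F \<in> ?V" if "F \<in> ?V" for n F
    using that
  proof (induction F rule: lspan_induct)
    case (base \<pi>)
    then show ?case
      using Vop_schur_poly[of \<pi> n] by (metis lspan_base lspan_scale)
  qed (simp_all add: lspan_zero lspan_add lspan_scale hall.Vop_add hall.Vop_pconst_mult)
  have one: "1 \<in> ?V"
    using lspan_base[of "[]" partitions schur_poly] by simp
  have mz: "hall.mz (int l) * schur_poly \<pi> \<in> ?V" if "\<pi> \<in> partitions" for \<pi> l
    using that
  proof (induction \<pi> arbitrary: l)
    case Nil
    then show ?case
      using Vop[OF one, of "int l"] by (simp add: hall.Vop_one)
  next
    case (Cons a \<pi>)
    then show ?case
      by (auto simp: partitions_Cons intro!: hall.mz_mult_Vop_closed[where V = ?V] lspan_zero lspan_add lspan_scale Vop)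
  qed
  show ?thesis
  proof (rule hall.closed_under_mz_imp_UNIV[OF inj_Suc one lspan_add lspan_scale])
    fix l and F :: "(nat, K) pl"
    assume "F \<in> ?V"
    then show "hall.mz (int l) * F \<in> ?V"
    proof (induction F rule: lspan_induct)
      case (scale c F)
      then show ?case by (simp add: mult.left_commute lspan_scale)
    qed (simp_all add: lspan_zero lspan_add mz distrib_left)
  qed
qed


section \<open>The Jacobi--Trudi determinant\<close>

definition jt_mat :: "nat list \<Rightarrow> (nat, K) pl mat" where
  "jt_mat \<pi> = mat (length \<pi>) (length \<pi>) (\<lambda>(i, j). hall.mz (int (\<pi> ! i) - int i + int j))"

text \<open>The bordered matrix with first row \<open>1, y, y\<^sup>2, \<dots>\<close>: multiplied by a unipotent bidiagonal matrix it becomes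
  the image of \<open>jt_mat \<pi>\<close> under \<open>X \<mapsto> X - y\<close>.\<close>

definition jt_border :: "nat list \<Rightarrow> (nat, K) pl fps mat" where
  "jt_border \<pi> = mat (Suc (length \<pi>)) (Suc (length \<pi>)) (\<lambda>(i, j). if i = 0 then fps_X ^ j
     else fps_const (hall.mz (int (\<pi> ! (i - 1)) - int i + int j)))"

definition bidiag :: "nat \<Rightarrow> (nat, K) pl fps mat" where
  "bidiag n = mat n n (\<lambda>(i, j). if i = j then 1 else if Suc i = j then - fps_X else 0)"

lemma jt_border_dims [simp]: "dim_row (jt_border \<pi>) = Suc (length \<pi>)" "dim_col (jt_border \<pi>) = Suc (length \<pi>)"
  by (simp_all add: jt_border_def)

lemma bidiag_dims [simp]: "dim_row (bidiag n) = n" "dim_col (bidiag n) = n"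
  by (simp_all add: bidiag_def)

lemma jt_mat_dims [simp]: "dim_row (jt_mat \<pi>) = length \<pi>" "dim_col (jt_mat \<pi>) = length \<pi>"
  by (simp_all add: jt_mat_def)

lemma jt_border_first_row: "j < Suc (length \<pi>) \<Longrightarrow> jt_border \<pi> $$ (0, j) = fps_X ^ j"
  by (simp add: jt_border_def)

lemma det_bidiag: "det (bidiag n :: (nat, K) pl fps mat) = 1"
proof -
  have "det (bidiag n :: (nat, K) pl fps mat) = prod_list (diag_mat (bidiag n))"
    by (rule det_upper_triangular) (auto simp: bidiag_def)
  also have "diag_mat (bidiag n :: (nat, K) pl fps mat) = map (\<lambda>_. 1) [0..<n]"
    by (auto simp: diag_mat_def bidiag_def)
  also have "prod_list \<dots> = 1"
    by (simp add: map_replicate_const)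
  finally show ?thesis .
qed

text \<open>The familiar h_l[X - y] = h_l - y h_(l-1), with \<open>fps_X\<close> as y.\<close>

lemma Dhom_mz: "hall.Dhom (\<lambda>_. - 1) (hall.mz l) = fps_const (hall.mz l) - fps_X * fps_const (hall.mz (l - 1))"
proof (rule fps_ext)
  fix n
  have "hall.Dhom (\<lambda>_. - 1) (hall.mz l) $ n = hall.Dz (- 1) (int n) (hall.mz l)"
    by (simp add: hall.Dz_def hall.D_def)
  also have "\<dots> = (fps_const (hall.mz l) - fps_X * fps_const (hall.mz (l - 1))) $ n"
    unfolding hall.Dz_mz by (cases n) (auto simp: hall_ccoeff_minus pconst.hom_uminus)
  finally show "hall.Dhom (\<lambda>_. - 1) (hall.mz l) $ n = (fps_const (hall.mz l) - fps_X * fps_const (hall.mz (l - 1))) $ n" .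
qed

lemma jt_border_times_bidiag:
  assumes "i < Suc (length \<pi>)" "j < Suc (length \<pi>)"
  shows "(jt_border \<pi> * bidiag (Suc (length \<pi>))) $$ (i, j) =
    (if i = 0 then (if j = 0 then 1 else 0)
     else if j = 0 then fps_const (hall.mz (int (\<pi> ! (i - 1)) - int i))
     else hall.Dhom (\<lambda>_. - 1) (hall.mz (int (\<pi> ! (i - 1)) - int i + int j)))"
proof -
  let ?n = "Suc (length \<pi>)"
  have "(jt_border \<pi> * bidiag ?n) $$ (i, j) = (\<Sum>k<?n. jt_border \<pi> $$ (i, k) * bidiag ?n $$ (k, j))"
    using assms by (simp add: jt_border_def bidiag_def scalar_prod_def lessThan_atLeast0)
  also have "\<dots> = (\<Sum>k\<in>(if j = 0 then {0} else {j - 1, j}). jt_border \<pi> $$ (i, k) * bidiag ?n $$ (k, j))"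
    using assms by (intro sum.mono_neutral_right) (auto simp: bidiag_def)
  also have "\<dots> = (if i = 0 then (if j = 0 then 1 else 0)
     else if j = 0 then fps_const (hall.mz (int (\<pi> ! (i - 1)) - int i))
     else hall.Dhom (\<lambda>_. - 1) (hall.mz (int (\<pi> ! (i - 1)) - int i + int j)))"
    using assms by (cases j) (auto simp: jt_border_def bidiag_def Dhom_mz algebra_simps)
  finally show ?thesis .
qed

text \<open>Subtracting y times the preceding column turns the first row into 1, 0, 0, ...; deleting
  the first row and column then leaves the translated matrix.\<close>

lemma det_jt_border: "det (jt_border \<pi>) = hall.Dhom (\<lambda>_. - 1) (det (jt_mat \<pi>))"
proof -
  let ?n = "Suc (length \<pi>)"
  let ?L = "jt_border \<pi> * bidiag ?n"
  have carrier: "jt_border \<pi> \<in> carrier_mat ?n ?n" "bidiag ?n \<in> carrier_mat ?n ?n"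
    unfolding jt_border_def bidiag_def by (rule mat_carrier)+
  then have L: "?L \<in> carrier_mat ?n ?n"
    by (rule mult_carrier_mat)
  have "det (jt_border \<pi>) = det ?L"
    by (simp only: det_mult[OF carrier] det_bidiag mult_1_right)
  also have "\<dots> = (\<Sum>j<?n. ?L $$ (0, j) * cofactor ?L 0 j)"
    by (rule laplace_expansion_row[OF L]) simp
  also have "\<dots> = (\<Sum>j\<in>{0}. ?L $$ (0, j) * cofactor ?L 0 j)"
    by (rule sum.mono_neutral_right) (auto simp: jt_border_times_bidiag simp del: index_mult_mat(1))
  also have "\<dots> = det (mat_delete ?L 0 0)"
    by (simp add: jt_border_times_bidiag cofactor_def del: index_mult_mat(1))
  also have "mat_delete ?L 0 0 = map_mat (hall.Dhom (\<lambda>_. - 1)) (jt_mat \<pi>)"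
    using L by (intro eq_matI) (auto simp: mat_delete_def jt_border_times_bidiag jt_mat_def algebra_simps simp del: index_mult_mat(1))
  also have "det \<dots> = hall.Dhom (\<lambda>_. - 1) (det (jt_mat \<pi>))"
    by (rule hall.Dhom.hom_det)
  finally show ?thesis .
qed

text \<open>Below their first rows the two matrices agree, up to the embedding of constants.\<close>

lemma cofactor_jt_border:
  assumes "j < Suc (length \<pi>)"
  shows "cofactor (jt_border \<pi> :: (nat, K) pl fps mat) 0 j = fps_const (cofactor (jt_mat (a # \<pi>)) 0 j)"
proof -
  have "mat_delete (jt_border \<pi> :: (nat, K) pl fps mat) 0 j = map_mat fps_const (mat_delete (jt_mat (a # \<pi>)) 0 j)"
    using assms by (intro eq_matI) (auto simp: mat_delete_def jt_border_def jt_mat_def)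
  then show ?thesis
    by (simp add: cofactor_def fps_const.hom_det fps_const.hom_mult fps_const.hom_power fps_const.hom_uminus)
qed

text \<open>Expanding the bordered determinant along its row of powers displays the modes of the
  translation as cofactors.\<close>

lemma Dz_det_jt:
  "hall.Dz (- 1) (int k) (det (jt_mat \<pi>)) = (if k \<le> length \<pi> then cofactor (jt_mat (a # \<pi>)) 0 k else 0)"
proof -
  let ?n = "Suc (length \<pi>)"
  have "hall.Dz (- 1) (int k) (det (jt_mat \<pi>)) = det (jt_border \<pi>) $ k"
    by (simp add: det_jt_border hall.Dz_def hall.D_def)
  also have "det (jt_border \<pi>) = (\<Sum>j<?n. jt_border \<pi> $$ (0, j) * cofactor (jt_border \<pi>) 0 j)"
    by (rule laplace_expansion_row[of _ ?n]) (auto intro: carrier_matI)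
  also have "\<dots> = (\<Sum>j<?n. fps_X ^ j * fps_const (cofactor (jt_mat (a # \<pi>)) 0 j))"
    by (intro sum.cong) (simp_all add: cofactor_jt_border[where a = a] jt_border_first_row)
  also have "\<dots> $ k = (\<Sum>j<?n. if j = k then cofactor (jt_mat (a # \<pi>)) 0 k else 0)"
    unfolding fps_sum_nth by (intro sum.cong) (auto simp: fps_X_power_mult_nth)
  also have "\<dots> = (if k \<le> length \<pi> then cofactor (jt_mat (a # \<pi>)) 0 k else 0)"
    by auto
  finally show ?thesis .
qed

text \<open>As the translation modes are cofactors, the sum defining the creation operator is the
  Laplace expansion along the new first row.\<close>

theorem schur_poly_eq_det: "schur_poly \<pi> = det (jt_mat \<pi>)"
proof (induction \<pi>)
  case Nil
  then show ?case by (simp add: jt_mat_def)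
next
  case (Cons a \<pi>)
  let ?n = "Suc (length \<pi>)"
  have "schur_poly (a # \<pi>) = hall.Vop (int a) (det (jt_mat \<pi>))"
    using Cons by simp
  also have "\<dots> = (\<Sum>k\<le>length \<pi>. hall.mz (int a + int k) * cofactor (jt_mat (a # \<pi>)) 0 k)"
    by (subst hall.Vop_eq[where N = "length \<pi>"]) (simp_all add: Dz_det_jt[where a = a])
  also have "\<dots> = (\<Sum>k<?n. jt_mat (a # \<pi>) $$ (0, k) * cofactor (jt_mat (a # \<pi>)) 0 k)"
    by (intro sum.cong) (auto simp: jt_mat_def)
  also have "\<dots> = det (jt_mat (a # \<pi>))"
    by (rule laplace_expansion_row[symmetric]) (auto intro: carrier_matI)
  finally show ?case .
qed

lemma complete_h_eq: "complete_h k = at_X (hall.mz k)"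
proof (cases "k < 0")
  case False
  have "hl_poly 0 (nat k) = (hall.mz k :: (nat, K) pl)"
  proof -
    have "Abs_fps (\<lambda>i. pconst (1 - 0 ^ Suc i) * pvar i) = (hall.logder (\<lambda>_. 1) :: (nat, K) pl fps)"
      by (simp add: hall.logder_def hall_norm_def fps_eq_iff del: of_nat_Suc)
    then show ?thesis using False by (simp add: hl_poly_def hall.mz_def hall.Mser_def)
  qed
  then show ?thesis using False by (simp add: complete_h_def hall_littlewood_q_eq)
qed (simp add: complete_h_def)

theorem schur_eq: "schur \<pi> = at_X (schur_poly \<pi>)"
proof -
  have "map_mat at_X (jt_mat \<pi>) = mat (length \<pi>) (length \<pi>) (\<lambda>(i, j). complete_h (int (\<pi> ! i) - int i + int j))"
    by (intro eq_matI) (auto simp: jt_mat_def complete_h_eq)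
  then show ?thesis
    by (simp add: schur_def schur_poly_eq_det at_X.hom_det[symmetric])
qed


section \<open>Schur Q-functions\<close>

text \<open>Variable \<open>n\<close> stands for the power sum of degree \<open>2n + 1\<close>, and the norm of \<open>p\<^sub>k\<close> is \<open>k / 2\<close>.\<close>

definition q_weight :: "nat \<Rightarrow> nat" where
  "q_weight n = Suc (2 * n)"

definition q_norm :: "nat \<Rightarrow> K" where
  "q_norm n = of_nat (q_weight n) / 2"

interpretation qf: vertex q_weight q_norm
proof
  show "q_weight i > 0" "q_norm i \<noteq> 0" for i
    by (simp_all add: q_weight_def q_norm_def del: of_nat_Suc)
  show "finite {n. q_weight n = k}" for k
    by (rule finite_subset[of _ "{..k}"]) (auto simp: q_weight_def)
qed

lemma inj_q_weight: "inj q_weight"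
  by (simp add: q_weight_def inj_def)

definition par :: "int \<Rightarrow> K" where
  "par k = (if even k then 1 else - 1)"

lemma par_add: "par (a + b) = par a * par b" and par_diff: "par (a - b) = par a * par b"
  and par_uminus [simp]: "par (- a) = par a" and par_square [simp]: "par a * par a = 1"
  and par_0 [simp]: "par 0 = 1" and par_int: "par (int n) = (- 1) ^ n"
  by (auto simp: par_def uminus_power_if)

lemma par_nonzero [simp]: "par k \<noteq> 0"
  by (simp add: par_def)

lemma qf_ccoeff: "qf.ccoeff s i = kexp.fexp (Abs_fps (\<lambda>k. if even k then 2 * s else 0)) $ i"
proof -
  have "(\<Sum>n | q_weight n = Suc k \<and> (1::K) \<noteq> 0. of_nat (q_weight n) * 1 / q_norm n * s) = (if even k then 2 * s else 0)" for k
  proof (cases "even k")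
    case True
    then obtain l where l: "k = 2 * l" by blast
    then have "{n. q_weight n = Suc k \<and> (1::K) \<noteq> 0} = {l}"
      by (auto simp: q_weight_def)
    then show ?thesis
      using l qf.g_nonzero[of l] by (simp add: q_norm_def)
  next
    case False
    then have "{n. q_weight n = Suc k \<and> (1::K) \<noteq> 0} = {}"
      by (auto simp: q_weight_def)
    then show ?thesis using False by (simp only: sum.empty if_False)
  qed
  then show ?thesis
    by (simp only: qf.ccoeff_def qf.cser_def)
qed

text \<open>The norm k/2 puts a 2 in front of the odd terms z^k / k, whose doubled sum is the
  logarithm of (1 + z) / (1 - z).\<close>

lemma qf_ccoeff_1: "qf.ccoeff 1 i = (if i = 0 then 1 else 2)"
proof -
  let ?E = "kexp.fexp (Abs_fps (\<lambda>k. if even k then 2 else 0 :: K))"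
  have "Abs_fps (\<lambda>k. 1 ^ Suc k - (- 1) ^ Suc k) = Abs_fps (\<lambda>k. if even k then 2 else 0 :: K)"
    by (auto simp: fps_eq_iff)
  then have E: "?E * (1 - fps_const 1 * fps_X) = 1 - fps_const (- 1) * fps_X"
    using kexp.fexp_geometric_diff[of 1 "- 1 :: K"] by (simp only:)
  have "?E $ Suc n = ?E $ n + (if n = 0 then 1 else 0)" for n
    using arg_cong[OF E, of "\<lambda>f. f $ Suc n"] by (cases n) (simp_all add: right_diff_distrib)
  then have "?E $ i = (if i = 0 then 1 else 2)"
    by (induction i) simp_all
  then show ?thesis by (simp only: qf_ccoeff mult_1_right)
qed

lemma qf_ccoeff_minus: "qf.ccoeff (- 1) i = par (int i) * qf.ccoeff 1 i"
proof -
  let ?A = "Abs_fps (\<lambda>k. if even k then 2 else 0 :: K)"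
  have "Abs_fps (\<lambda>k. (- 1) ^ Suc k * ?A $ k) = Abs_fps (\<lambda>k. if even k then 2 * (- 1) else 0 :: K)"
    by (auto simp: fps_eq_iff)
  then show ?thesis
    using kexp.fexp_scale[of "- 1" ?A i] by (simp only: qf_ccoeff par_int mult_1_right)
qed

text \<open>With only odd power sums, negating the exponent is the same as negating z, so the
  inverse series is Q(-z).\<close>

lemma qf_mbz: "qf.mbz l = pconst (par l) * qf.mz l"
proof (cases "l < 0")
  case False
  have "qf.logder (\<lambda>_. - 1) = Abs_fps (\<lambda>i. (pconst (- 1)) ^ Suc i * qf.logder (\<lambda>_. 1) $ i)"
  proof (rule fps_ext)
    fix k
    have "pconst (of_nat (q_weight n) * - 1 / q_norm n) * pvar n =
        (pconst (- 1)) ^ Suc k * (pconst (of_nat (q_weight n) * 1 / q_norm n) * pvar n :: (nat, K) pl)"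
      if "q_weight n = Suc k" for n
    proof -
      have "even k" using that by (auto simp: q_weight_def)
      then have "(pconst (- 1) :: (nat, K) pl) ^ Suc k = pconst (- 1)"
        by (simp flip: pconst.hom_power)
      then show ?thesis
        by (simp only: pconst.hom_mult[symmetric] mult.assoc[symmetric]) simp
    qed
    then show "qf.logder (\<lambda>_. - 1) $ k =
        Abs_fps (\<lambda>i. (pconst (- 1)) ^ Suc i * qf.logder (\<lambda>_. 1) $ i) $ k"
      unfolding qf.logder_def fps_nth_Abs_fps sum_distrib_left by (intro sum.cong) auto
  qed
  moreover have "(pconst (- 1) :: (nat, K) pl) ^ nat l = pconst (par l)"
    using False par_int[of "nat l"] by (simp flip: pconst.hom_power)
  ultimately show ?thesis
    using False by (simp only: qf.mbz_def qf.mz_def qf.Mser_def if_False pexp.fexp_scale)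
qed simp

text \<open>Adjoint of \<open>qf_mbz\<close>: opposite translations differ only in the signs of
  their modes.\<close>

lemma qf_Dz: "qf.Dz (- 1) l F = pconst (par l) * qf.Dz 1 l F"
proof (rule qf.form_eqI)
  fix G
  have "qf.B G (qf.Dz (- 1) l F) = qf.B (qf.mbz l * G) F"
    by (simp add: qf.Mser_adjoint_mbz form_commute[of _ G] form_commute[of _ "qf.mbz l * G"])
  then show "qf.B G (qf.Dz (- 1) l F) = qf.B G (pconst (par l) * qf.Dz 1 l F)"
    by (simp add: qf_mbz mult.assoc form_pconst_mult_left form_pconst_mult_right qf.Mser_adjoint_mz)
qed

lemma mz_mult_nonzero: "F * (qf.mz a * qf.mz b) \<noteq> 0 \<Longrightarrow> 0 \<le> a \<and> 0 \<le> b"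
  by (cases "a < 0"; cases "b < 0") auto

text \<open>The kernel of \<open>Vop_Vop\<close>, and at the same time the two-row Q-function
  extended to all integer indices.\<close>

definition qf2 :: "int \<Rightarrow> int \<Rightarrow> (nat, K) pl" where
  "qf2 r s = (\<Sum>i\<le>nat s. pconst (qf.ccoeff (- 1) i) * (qf.mz (r + int i) * qf.mz (s - int i)))"

lemma qf2_eq:
  assumes "s \<le> int I"
  shows "qf2 r s = (\<Sum>i\<le>I. pconst (qf.ccoeff (- 1) i) * (qf.mz (r + int i) * qf.mz (s - int i)))"
  unfolding qf2_def using assms by (intro sum.mono_neutral_left) auto

text \<open>The summands are the two one-sided expansions of one kernel. Together their coefficients
  are constant up to sign, and the sum collapses by Q(z) Q(-z) = 1.\<close>

lemma qf2_antisymmetric: "qf2 r s + qf2 s r = (if r + s = 0 then pconst (2 * par r) else 0)"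
proof (cases "r + s < 0")
  case True
  then have "qf2 r s = 0" if "r + s < 0" for r s
    unfolding qf2_def using that by (intro sum.neutral ballI) (case_tac "s - int x < 0"; simp)
  then show ?thesis using True by (simp add: add.commute)
next
  case False
  define n where "n = nat (r + s)"
  then have n: "int n = r + s" using False by simp
  \<comment> \<open>The coefficients 1, 2, 2, ... of (1 + z) / (1 - z). The halves \<open>?t\<close>
    and \<open>?u\<close> meet at \<open>b = s\<close>, where each gives 1, so their sum is 2
    everywhere up to sign.\<close>
  let ?w = "\<lambda>d::int. if d < 0 then 0 else if d = 0 then 1 else 2 :: K"
  let ?t = "\<lambda>b. par (s - int b) * ?w (s - int b)"
  let ?u = "\<lambda>b. par (s - int b) * ?w (int b - s)"
  have "qf2 r s = (\<Sum>b\<le>n. pconst (?t b) * (qf.mz (r + s - int b) * qf.mz (int b)))"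
    unfolding qf2_def
  proof (rule sum_reindex_support[where i = "\<lambda>b. nat (s - int b)" and j = "\<lambda>i. nat (s - int i)"], goal_cases)
    case (3 i)
    then have "0 \<le> r + int i \<and> 0 \<le> s - int i"
      by (intro mz_mult_nonzero)
    then show ?case using n by (auto simp: qf_ccoeff_minus qf_ccoeff_1 split: if_splits)
  next
    case (4 b)
    then have "s - int b \<ge> 0" by (force split: if_splits)
    then show ?case by (auto simp: qf_ccoeff_minus qf_ccoeff_1 add_diff_eq split: if_splits)
  qed auto
  moreover have "qf2 s r = (\<Sum>b\<le>n. pconst (?u b) * (qf.mz (r + s - int b) * qf.mz (int b)))"
    unfolding qf2_def
  proof (rule sum_reindex_support[where i = "\<lambda>b. nat (int b - s)" and j = "\<lambda>i. nat (s + int i)"], goal_cases)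
    case (3 i)
    then have "0 \<le> s + int i \<and> 0 \<le> r - int i"
      by (intro mz_mult_nonzero)
    then show ?case using n by (auto simp: qf_ccoeff_minus qf_ccoeff_1 algebra_simps split: if_splits)
  next
    case (4 b)
    then have "int b - s \<ge> 0" by (force split: if_splits)
    moreover have "par (int b - s) = par (s - int b)"
      using par_uminus[of "int b - s"] by simp
    ultimately show ?case using 4 n by (auto simp: qf_ccoeff_minus qf_ccoeff_1 algebra_simps split: if_splits)
  qed auto
  ultimately have "qf2 r s + qf2 s r =
      (\<Sum>b\<le>n. pconst (?t b + ?u b) * (qf.mz (r + s - int b) * qf.mz (int b)))"
    by (simp add: pconst.hom_add distrib_right sum.distrib)
  also have "\<dots> = (\<Sum>b\<le>n. pconst (2 * par s) * (qf.mbz (int b) * qf.mz (r + s - int b)))"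
  proof (intro sum.cong refl)
    fix b
    have "?t b + ?u b = 2 * par s * par (int b)"
      by (auto simp: par_diff)
    then show "pconst (?t b + ?u b) * (qf.mz (r + s - int b) * qf.mz (int b)) =
        pconst (2 * par s) * (qf.mbz (int b) * qf.mz (r + s - int b))"
      by (simp only: qf_mbz pconst.hom_mult mult_ac)
  qed
  also have "\<dots> = pconst (2 * par s) * (if r + s = 0 then 1 else 0)"
    unfolding sum_distrib_left[symmetric] by (subst qf.sum_mz_mbz) (simp_all add: n)
  also have "\<dots> = (if r + s = 0 then pconst (2 * par r) else 0)"
    by (auto simp: add_eq_0_iff)
  finally show ?thesis .
qed

text \<open>By \<open>qf2_antisymmetric\<close> the symmetrised kernel survives only where the
  indices sum to 0, which ties \<open>k\<close> to \<open>j\<close>. The sign turns one translation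
  by -1 into a translation by 1, and the two cancel.\<close>

theorem Clifford_relation:
  "qf.Vop m (qf.Vop n F) + qf.Vop n (qf.Vop m F) = (if m + n = 0 then pconst (2 * par m) * F else 0)"
proof -
  obtain N where N: "\<And>k. k > int N \<Longrightarrow> qf.Dz (- 1) k F = 0" and N': "\<And>k. k > int N \<Longrightarrow> qf.Dz 1 k F = 0"
    using qf.Dz_eventually_zero by (meson insertI1 insertI2)
  define I where "I = N + nat \<bar>m\<bar> + nat \<bar>n\<bar>"
  let ?X = "\<lambda>j k. qf.Dz (- 1) (int j) (qf.Dz (- 1) (int k) F)"
  have VV: "qf.Vop p (qf.Vop q F) = (\<Sum>j\<le>N. \<Sum>k\<le>N. qf2 (p + int j) (q + int k) * ?X j k)" if "\<bar>q\<bar> \<le> \<bar>m\<bar> + \<bar>n\<bar>" for p q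
  proof -
    have "q + int k \<le> int I" if "k \<le> N" for k
      using that \<open>\<bar>q\<bar> \<le> _\<close> by (auto simp: I_def)
    then have "qf2 (p + int j) (q + int k) = (\<Sum>i\<le>I. pconst (qf.ccoeff (- 1) i) *
        (qf.mz (p + int j + int i) * qf.mz (q + int k - int i)))" if "k \<le> N" for j k
      using that by (intro qf2_eq) auto
    then show ?thesis
      using \<open>\<bar>q\<bar> \<le> _\<close> by (subst qf.Vop_Vop[where N = N and I = I]) (auto simp: N I_def)
  qed
  have comm: "?X k j = ?X j k" for j k
    by (rule qf.Dz_commute)
  have "qf.Vop n (qf.Vop m F) = (\<Sum>j\<le>N. \<Sum>k\<le>N. qf2 (n + int k) (m + int j) * ?X j k)"
    by (subst VV) (simp, subst sum.swap, simp add: comm)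
  then have "qf.Vop m (qf.Vop n F) + qf.Vop n (qf.Vop m F) =
      (\<Sum>j\<le>N. \<Sum>k\<le>N. (qf2 (m + int j) (n + int k) + qf2 (n + int k) (m + int j)) * ?X j k)"
    by (simp add: VV sum.distrib distrib_right)
  also have "\<dots> = (\<Sum>j\<le>N. \<Sum>k\<le>N. if int k = - m - n - int j then
      pconst (2 * par m) * qf.Dz 1 (int j) (qf.Dz (- 1) (int k) F) else 0)"
  proof (intro sum.cong refl)
    fix j k
    have "pconst (2 * par (m + int j)) * ?X j k = pconst (2 * par m) * qf.Dz 1 (int j) (qf.Dz (- 1) (int k) F)"
      unfolding qf_Dz[of "int j"] mult.assoc[symmetric] pconst.hom_mult[symmetric]
      by (simp add: par_add par_def)
    then show "(qf2 (m + int j) (n + int k) + qf2 (n + int k) (m + int j)) * ?X j k =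
        (if int k = - m - n - int j then pconst (2 * par m) * qf.Dz 1 (int j) (qf.Dz (- 1) (int k) F) else 0)"
      unfolding qf2_antisymmetric by auto
  qed
  also have "\<dots> = (\<Sum>j\<le>N. pconst (2 * par m) * qf.Dz 1 (int j) (qf.Dz (- 1) (- m - n - int j) F))"
  proof (intro sum.cong refl)
    fix j
    show "(\<Sum>k\<le>N. if int k = - m - n - int j then
        pconst (2 * par m) * qf.Dz 1 (int j) (qf.Dz (- 1) (int k) F) else 0) =
        pconst (2 * par m) * qf.Dz 1 (int j) (qf.Dz (- 1) (- m - n - int j) F)"
    proof (cases "0 \<le> - m - n - int j \<and> - m - n - int j \<le> int N")
      case True
      then have "(\<Sum>k\<le>N. if int k = - m - n - int j then
        pconst (2 * par m) * qf.Dz 1 (int j) (qf.Dz (- 1) (int k) F) else 0) =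
        (\<Sum>k\<le>N. if k = nat (- m - n - int j) then
        pconst (2 * par m) * qf.Dz 1 (int j) (qf.Dz (- 1) (- m - n - int j) F) else 0)"
        by (intro sum.cong) auto
      then show ?thesis using True by (simp add: nat_le_iff)
    next
      case False
      then have "qf.Dz (- 1) (- m - n - int j) F = 0"
        using N[of "- m - n - int j"] by (cases "- m - n - int j < 0") auto
      then show ?thesis using False by (auto intro!: sum.neutral)
    qed
  qed
  also have "\<dots> = (\<Sum>j\<le>I. pconst (2 * par m) * qf.Dz 1 (int j) (qf.Dz (- 1) (- m - n - int j) F))"
    by (rule sum.mono_neutral_left) (auto simp: I_def qf.Dz_commute[of 1] N')
  also have "\<dots> = (if m + n = 0 then pconst (2 * par m) * F else 0)"
    unfolding sum_distrib_left[symmetric] by (subst qf.sum_Dz_inverse) (auto simp: I_def)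
  finally show ?thesis .
qed

text \<open>\<open>mbz\<close> and translation by 1 agree up to signs with \<open>mz\<close> and
  translation by -1. Thus the same operators create and annihilate, and the Clifford relation also
  governs the adjoints.\<close>

lemma qf_Top: "qf.Top n F = pconst (par n) * qf.Vop (- n) F"
proof -
  obtain N where N: "\<And>k. k > int N \<Longrightarrow> qf.Dz (- 1) k F = 0" "\<And>k. k > int N \<Longrightarrow> qf.Dz 1 k F = 0"
    using qf.Dz_eventually_zero by (meson insertI1 insertI2)
  let ?M = "N + nat \<bar>n\<bar>"
  have eq: "pconst (par n) * (qf.mz (- n + l) * qf.Dz (- 1) l F) = qf.mbz (int k) * qf.Dz 1 l F"
    if "l = n + int k" for k l
  proof -
    have "pconst (par n) * pconst (par l) = (pconst (par (int k)) :: (nat, K) pl)"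
      using that by (auto simp: par_def simp flip: pconst.hom_mult)
    moreover have "pconst (par n) * (qf.mz (- n + l) * qf.Dz (- 1) l F) =
        (pconst (par n) * pconst (par l)) * (qf.mz (int k) * qf.Dz 1 l F)"
      unfolding qf_Dz[of l] using that by (simp add: mult_ac)
    ultimately show ?thesis by (simp only: qf_mbz mult.assoc)
  qed
  have "qf.Top n F = (\<Sum>k\<le>?M. qf.mbz (int k) * qf.Dz 1 (n + int k) F)"
    by (rule qf.Top_eq) (simp add: N)
  also have "\<dots> = (\<Sum>k\<le>?M. pconst (par n) * (qf.mz (- n + int k) * qf.Dz (- 1) (int k) F))"
  proof (rule sum_reindex_support[where i = "\<lambda>l. nat (int l - n)" and j = "\<lambda>k. nat (n + int k)"], goal_cases)
    case (3 k)
    then have "0 \<le> n + int k \<and> n + int k \<le> int N"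
      using N(2)[of "n + int k"] by (cases "n + int k < 0"; cases "n + int k > int N") auto
    then show ?case using eq[of "n + int k" k] by (auto simp: nat_le_iff)
  next
    case (4 l)
    then have "0 \<le> int l - n \<and> int l \<le> int N"
      using N(1)[of "int l"] by (cases "- n + int l < 0"; cases "int l > int N") auto
    then show ?case using eq[of "int l" "nat (int l - n)"] by (auto simp: nat_le_iff)
  qed auto
  also have "\<dots> = pconst (par n) * qf.Vop (- n) F"
    unfolding sum_distrib_left[symmetric] by (subst qf.Vop_eq[where N = ?M]) (simp_all add: N)
  finally show ?thesis .
qed

section \<open>Q-functions from creation operators\<close>

definition Q_poly :: "nat list \<Rightarrow> (nat, K) pl" where
  "Q_poly \<nu> = foldr (\<lambda>a. qf.Vop (int a)) \<nu> 1"

lemma Q_poly_simps [simp]: "Q_poly [] = 1" "Q_poly (a # \<nu>) = qf.Vop (int a) (Q_poly \<nu>)"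
  by (simp_all add: Q_poly_def)

lemma strict_partitions_Nil [simp]: "[] \<in> strict_partitions"
  by (simp add: strict_partitions_def)

lemma strict_partitions_Cons:
  "a # \<nu> \<in> strict_partitions \<longleftrightarrow> 0 < a \<and> (\<forall>x\<in>set \<nu>. x < a) \<and> \<nu> \<in> strict_partitions"
  by (auto simp: strict_partitions_def)

text \<open>All parts are below \<open>m\<close>, so the Clifford scalar never appears; the operator
  anticommutes through to 1, where \<open>qf.mz (- m)\<close> is 0.\<close>

lemma Vop_Q_poly_zero:
  "\<nu> \<in> strict_partitions \<Longrightarrow> m > 0 \<Longrightarrow> (\<forall>x\<in>set \<nu>. int x < m) \<Longrightarrow> qf.Vop (- m) (Q_poly \<nu>) = 0"
proof (induction \<nu>)
  case Nil
  then show ?case by (simp add: qf.Vop_one)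
next
  case (Cons a \<nu>)
  then have "qf.Vop (- m) (Q_poly \<nu>) = 0"
    by (intro Cons) (auto simp: strict_partitions_Cons)
  then show ?case
    using Clifford_relation[of "- m" "int a" "Q_poly \<nu>"] Cons.prems by auto
qed

lemma Vop_Q_poly_strip:
  assumes "a # \<nu> \<in> strict_partitions"
  shows "qf.Vop (- int a) (Q_poly (a # \<nu>)) = pconst (2 * par (int a)) * Q_poly \<nu>"
proof -
  have "qf.Vop (- int a) (Q_poly \<nu>) = 0"
    using assms by (intro Vop_Q_poly_zero) (auto simp: strict_partitions_Cons)
  then show ?thesis
    using Clifford_relation[of "- int a" "int a" "Q_poly \<nu>"] by simp
qed

lemma form_Vop_left: "qf.B (qf.Vop n F) G = par n * qf.B F (qf.Vop (- n) G)"
  by (simp add: qf.Vop_adjoint qf_Top form_pconst_mult_right)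

text \<open>As for Schur functions, but removing a part yields the Clifford scalar, hence a factor 2
  for each part.\<close>

theorem Q_poly_orthogonal:
  "\<nu> \<in> strict_partitions \<Longrightarrow> \<rho> \<in> strict_partitions \<Longrightarrow>
    qf.B (Q_poly \<nu>) (Q_poly \<rho>) = (if \<nu> = \<rho> then 2 ^ length \<nu> else 0)"
proof (induction \<nu> arbitrary: \<rho>)
  case Nil
  then show ?case
  proof (cases \<rho>)
    case (Cons b \<rho>')
    then have "qf.B 1 (Q_poly \<rho>) = par (int b) * qf.B (Q_poly \<rho>') (qf.Vop (- int b) (Q_poly []))"
      by (simp add: form_commute[of _ 1] form_Vop_left del: form_one_left form_one_right)
    then show ?thesis
      using Cons Nil by (subst (asm) Vop_Q_poly_zero) (auto simp: strict_partitions_Cons)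
  qed simp
next
  case (Cons a \<nu>)
  show ?case
  proof (cases "\<forall>x\<in>set \<rho>. x < a")
    case True
    then have "qf.Vop (- int a) (Q_poly \<rho>) = 0"
      using Cons.prems by (intro Vop_Q_poly_zero) (auto simp: strict_partitions_Cons)
    then show ?thesis
      using True by (auto simp: form_Vop_left)
  next
    case False
    then obtain b \<rho>' where \<rho>: "\<rho> = b # \<rho>'" "a \<le> b"
      using Cons.prems by (cases \<rho>) (auto simp: strict_partitions_Cons)
    show ?thesis
    proof (cases "a = b")
      case True
      then have "qf.B (Q_poly (a # \<nu>)) (Q_poly \<rho>) = 2 * qf.B (Q_poly \<nu>) (Q_poly \<rho>')"
        using Vop_Q_poly_strip[of a \<rho>'] Cons.prems \<rho>
        by (auto simp: form_Vop_left form_pconst_mult_right par_def)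
      then show ?thesis
        using Cons \<rho> True by (auto simp: strict_partitions_Cons)
    next
      case False
      then have "qf.Vop (- int b) (Q_poly (a # \<nu>)) = 0"
        using Cons.prems \<rho> by (intro Vop_Q_poly_zero) (auto simp: strict_partitions_Cons)
      then have "qf.B (Q_poly \<rho>) (Q_poly (a # \<nu>)) = 0"
        by (simp only: \<rho> Q_poly_simps(2)[of b] form_Vop_left form_0_right mult_zero_right)
      then show ?thesis
        using False \<rho> by (simp add: form_commute[of _ "qf.Vop (int a) (Q_poly \<nu>)"])
    qed
  qed
qed

text \<open>Clifford scalars produce further terms, so straightening yields a combination of
  functions. The bound on the parts is carried along to know that \<open>a\<close> exceeds every
  part it is put in front of.\<close>

lemma Vop_Q_poly_lspan:
  "\<nu> \<in> strict_partitions \<Longrightarrow> n \<le> int M \<Longrightarrow> \<forall>x\<in>set \<nu>. x \<le> M \<Longrightarrow>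
    qf.Vop n (Q_poly \<nu>) \<in> lspan {\<mu> \<in> strict_partitions. \<forall>x\<in>set \<mu>. x \<le> M} Q_poly"
proof (induction \<nu> arbitrary: n M)
  case Nil
  consider "n < 0" | "n = 0" | "n > 0" by linarith
  then show ?case
  proof cases
    case 2
    then show ?thesis
      using lspan_base[of "[]" "{\<mu> \<in> strict_partitions. \<forall>x\<in>set \<mu>. x \<le> M}" Q_poly] by (simp add: qf.Vop_one)
  next
    case 3
    then show ?thesis
      using lspan_base[of "[nat n]" "{\<mu> \<in> strict_partitions. \<forall>x\<in>set \<mu>. x \<le> M}" Q_poly] Nil
      by (simp add: strict_partitions_Cons)
  qed (simp add: qf.Vop_one lspan_zero)
next
  case (Cons a \<nu>)
  let ?I = "\<lambda>M. {\<mu> \<in> strict_partitions. \<forall>x\<in>set \<mu>. x \<le> M}"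
  consider "n > int a" | "n = int a" | "n < int a" by linarith
  then show ?case
  proof cases
    case 1
    then have "nat n # a # \<nu> \<in> ?I M"
      using Cons.prems by (auto simp: strict_partitions_Cons)
    then show ?thesis
      using lspan_base[of "nat n # a # \<nu>" "?I M" Q_poly] 1 by simp
  next
    case 2
    then have "qf.Vop n (Q_poly (a # \<nu>)) + qf.Vop n (Q_poly (a # \<nu>)) = 0"
      using Clifford_relation[of n n "Q_poly \<nu>"] Cons.prems by (auto simp: strict_partitions_Cons)
    moreover have "F = 0" if "F + F = 0" for F :: "(nat, K) pl"
    proof (rule poly_mapping_eqI)
      fix \<mu>
      have "Poly_Mapping.lookup F \<mu> + Poly_Mapping.lookup F \<mu> = 0"
        using arg_cong[OF that, of "\<lambda>G. Poly_Mapping.lookup G \<mu>"] by (simp only: lookup_add lookup_zero)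
      then show "Poly_Mapping.lookup F \<mu> = Poly_Mapping.lookup 0 \<mu>"
        by (simp flip: mult_2)
    qed
    ultimately have "qf.Vop n (Q_poly (a # \<nu>)) = 0"
      by blast
    then show ?thesis by (simp add: lspan_zero)
  next
    case 3
    \<comment> \<open>After the exchange, \<open>n < a\<close> acts on parts smaller than
      \<open>a\<close>, so the bound \<open>a - 1\<close> is available.\<close>
    have "qf.Vop n (Q_poly \<nu>) \<in> lspan (?I (a - 1)) Q_poly"
      using Cons.prems 3 by (intro Cons.IH) (auto simp: strict_partitions_Cons)
    then have "qf.Vop (int a) (qf.Vop n (Q_poly \<nu>)) \<in> lspan (?I M) Q_poly"
    proof (induction rule: lspan_induct)
      case (base \<mu>)
      then have "a # \<mu> \<in> ?I M"
        using Cons.prems by (force simp: strict_partitions_Cons)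
      then show ?case
        using lspan_base[of "a # \<mu>" "?I M" Q_poly] by simp
    qed (simp_all add: lspan_zero lspan_add lspan_scale qf.Vop_add qf.Vop_pconst_mult)
    moreover have "Q_poly \<nu> \<in> lspan (?I M) Q_poly"
      using Cons.prems by (intro lspan_base) (auto simp: strict_partitions_Cons)
    moreover have "qf.Vop n (Q_poly (a # \<nu>)) = pconst (if n + int a = 0 then 2 * par n else 0) * Q_poly \<nu> +
        pconst (- 1) * qf.Vop (int a) (qf.Vop n (Q_poly \<nu>))"
      using Clifford_relation[of n "int a" "Q_poly \<nu>"]
      by (auto simp: pconst.hom_uminus eq_diff_eq[symmetric])
    ultimately show ?thesis
      by (simp only: lspan_add lspan_scale)
  qed
qed

theorem Q_poly_spanning: "F \<in> lspan strict_partitions Q_poly"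
proof -
  let ?V = "lspan strict_partitions Q_poly"
  have Vop: "qf.Vop n F \<in> ?V" if "F \<in> ?V" for n F
    using that
  proof (induction F rule: lspan_induct)
    case (base \<nu>)
    obtain M where M: "n \<le> int M" "\<forall>x\<in>set \<nu>. x \<le> M"
    proof
      show "n \<le> int (nat \<bar>n\<bar> + sum_list \<nu>)" by simp
      show "\<forall>x\<in>set \<nu>. x \<le> nat \<bar>n\<bar> + sum_list \<nu>"
        by (auto intro: trans_le_add2 member_le_sum_list)
    qed
    have "qf.Vop n (Q_poly \<nu>) \<in> lspan {\<mu> \<in> strict_partitions. \<forall>x\<in>set \<mu>. x \<le> M} Q_poly"
      by (rule Vop_Q_poly_lspan[OF base M])
    then show ?case
      by (induction rule: lspan_induct) (auto simp: lspan_zero lspan_add lspan_scale lspan_base)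
  qed (simp_all add: lspan_zero lspan_add lspan_scale qf.Vop_add qf.Vop_pconst_mult)
  have one: "1 \<in> ?V"
    using lspan_base[of "[]" strict_partitions Q_poly] by simp
  have mz: "qf.mz (int l) * Q_poly \<nu> \<in> ?V" if "\<nu> \<in> strict_partitions" for \<nu> l
    using that
  proof (induction \<nu> arbitrary: l)
    case Nil
    then show ?case
      using Vop[OF one, of "int l"] by (simp add: qf.Vop_one)
  next
    case (Cons a \<nu>)
    then show ?case
      by (auto simp: strict_partitions_Cons intro!: qf.mz_mult_Vop_closed[where V = ?V] lspan_zero lspan_add lspan_scale Vop)
  qed
  show ?thesis
  proof (rule qf.closed_under_mz_imp_UNIV[OF inj_q_weight one lspan_add lspan_scale])
    fix l and F :: "(nat, K) pl"
    assume "F \<in> ?V"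
    then show "qf.mz (int l) * F \<in> ?V"
    proof (induction F rule: lspan_induct)
      case (scale c F)
      then show ?case by (simp add: mult.left_commute lspan_scale)
    qed (simp_all add: lspan_zero lspan_add mz distrib_left)
  qed
qed


section \<open>Compositions of a number indexed by a finite set\<close>

definition weak_comps :: "nat set \<Rightarrow> nat \<Rightarrow> (nat \<Rightarrow> nat) set" where
  "weak_comps S k = {c. (\<forall>r. r \<notin> S \<longrightarrow> c r = 0) \<and> sum c S = k}"

lemma finite_weak_comps: "finite S \<Longrightarrow> finite (weak_comps S k)"
proof -
  assume S: "finite S"
  have "weak_comps S k \<subseteq> {c. \<forall>r. (r \<in> S \<longrightarrow> c r \<in> {..k}) \<and> (r \<notin> S \<longrightarrow> c r = 0)}"
    using S by (auto simp: weak_comps_def intro: member_le_sum)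
  then show ?thesis
    using S by (rule finite_subset[OF _ finite_set_of_finite_funs]) auto
qed

lemma weak_comps_empty: "weak_comps {} k = (if k = 0 then {\<lambda>_. 0} else {})"
  by (auto simp: weak_comps_def)

lemma sum_weak_comps_insert:
  fixes h :: "(nat \<Rightarrow> nat) \<Rightarrow> 'a::comm_monoid_add"
  assumes "finite S" "s \<notin> S"
  shows "(\<Sum>c\<in>weak_comps (insert s S) k. h c) = (\<Sum>i\<le>k. \<Sum>c\<in>weak_comps S (k - i). h (c(s := i)))"
proof -
  have upd: "(\<Sum>x\<in>S. if x = s then i else c x) = sum c S" for c :: "nat \<Rightarrow> nat" and i
    using assms by (intro sum.cong) auto
  have "(\<Sum>i\<le>k. \<Sum>c\<in>weak_comps S (k - i). h (c(s := i))) =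
      (\<Sum>(i, c)\<in>(SIGMA i:{..k}. weak_comps S (k - i)). h (c(s := i)))"
    using assms by (intro sum.Sigma) (auto intro: finite_weak_comps)
  also have "\<dots> = (\<Sum>c\<in>weak_comps (insert s S) k. h c)"
    by (rule sum.reindex_bij_witness[where i = "\<lambda>c. (c s, c(s := 0))" and j = "\<lambda>(i, c). c(s := i)"])
       (use assms in \<open>auto simp: weak_comps_def upd fun_eq_iff\<close>)
  finally show ?thesis ..
qed

lemma fps_prod_nth_weak_comps:
  fixes F :: "nat \<Rightarrow> 'a::comm_ring_1 fps"
  assumes "finite S"
  shows "(\<Prod>r\<in>S. F r) $ k = (\<Sum>c\<in>weak_comps S k. \<Prod>r\<in>S. F r $ c r)"
  using assms
proof (induction S arbitrary: k rule: finite_induct)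
  case empty
  then show ?case by (simp add: weak_comps_empty)
next
  case (insert s S)
  have "(\<Prod>r\<in>S. F r $ (c(s := i)) r) = (\<Prod>r\<in>S. F r $ c r)" for c i
    using insert by (intro prod.cong) auto
  then show ?case
    using insert by (simp add: sum_weak_comps_insert fps_mult_nth atMost_atLeast0 sum_distrib_left)
qed


section \<open>Pfaffian form of the Q-functions\<close>

text \<open>Indices form a function with integer values, so that deleting or choosing slots is a
  composition.\<close>

fun Wf :: "nat \<Rightarrow> (nat \<Rightarrow> int) \<Rightarrow> (nat, K) pl \<Rightarrow> (nat, K) pl" where
  "Wf 0 a F = F"
| "Wf (Suc n) a F = qf.Vop (a 0) (Wf n (a \<circ> Suc) F)"

abbreviation W :: "nat \<Rightarrow> (nat \<Rightarrow> int) \<Rightarrow> (nat, K) pl" where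
  "W n a \<equiv> Wf n a 1"

abbreviation ct :: "(nat, K) pl \<Rightarrow> K" where
  "ct F \<equiv> Poly_Mapping.lookup F 0"

text \<open>\<open>del j\<close> enumerates the numbers other than \<open>j\<close>, and \<open>skip j\<close> those other than \<open>0\<close> and \<open>j + 1\<close>.\<close>

definition del :: "nat \<Rightarrow> nat \<Rightarrow> nat" where
  "del j k = (if k < j then k else Suc k)"

definition skip :: "nat \<Rightarrow> nat \<Rightarrow> nat" where
  "skip j k = Suc (del j k)"

lemma Wf_cong: "(\<And>i. i < n \<Longrightarrow> a i = b i) \<Longrightarrow> Wf n a F = Wf n b F"
proof (induction n arbitrary: a b)
  case (Suc n)
  have "Wf n (a \<circ> Suc) F = Wf n (b \<circ> Suc) F"
    by (rule Suc.IH) (simp add: Suc.prems)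
  then show ?case using Suc.prems[of 0] by simp
qed simp

lemma Wf_0 [simp]: "Wf n a 0 = 0"
  by (induction n arbitrary: a) auto

text \<open>One operator travels through a word: contraction with slot \<open>j\<close> leaves a
  scalar and the sign of \<open>j\<close> exchanges, and the uncontracted word ends with the
  operator applied to \<open>F\<close>.\<close>

lemma Clifford_move:
  "qf.Vop c (Wf n a F) = (\<Sum>j<n. pconst ((- 1) ^ j * (if c + a j = 0 then 2 * par c else 0)) * Wf (n - 1) (a \<circ> del j) F) +
    pconst ((- 1) ^ n) * Wf n a (qf.Vop c F)"
proof (induction n arbitrary: a)
  case (Suc n)
  let ?u = "\<lambda>x. if c + x = 0 then 2 * par c else 0"
  let ?w = "Wf n (a \<circ> Suc) F"
  have "qf.Vop c (Wf (Suc n) a F) = pconst (?u (a 0)) * ?w - qf.Vop (a 0) (qf.Vop c ?w)"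
    using Clifford_relation[of c "a 0" ?w] by (auto simp: eq_diff_eq)
  also have "qf.Vop (a 0) (qf.Vop c ?w) =
      (\<Sum>j<n. pconst ((- 1) ^ j * ?u (a (Suc j))) * qf.Vop (a 0) (Wf (n - 1) (a \<circ> Suc \<circ> del j) F)) +
      pconst ((- 1) ^ n) * Wf (Suc n) a (qf.Vop c F)"
    by (simp add: Suc qf.Vop_add qf.Vop_sum qf.Vop_pconst_mult o_def)
  also have "(\<Sum>j<n. pconst ((- 1) ^ j * ?u (a (Suc j))) * qf.Vop (a 0) (Wf (n - 1) (a \<circ> Suc \<circ> del j) F)) =
      (\<Sum>j<n. pconst ((- 1) ^ j * ?u (a (Suc j))) * Wf n (a \<circ> del (Suc j)) F)"
  proof (rule sum.cong[OF refl])
    fix j assume "j \<in> {..<n}"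
    then obtain m where m: "n = Suc m" by (cases n) auto
    have "(\<lambda>x. a (Suc (del j x))) = (\<lambda>x. a (del (Suc j) (Suc x)))"
      by (auto simp: del_def fun_eq_iff)
    then show "pconst ((- 1) ^ j * ?u (a (Suc j))) * qf.Vop (a 0) (Wf (n - 1) (a \<circ> Suc \<circ> del j) F) =
        pconst ((- 1) ^ j * ?u (a (Suc j))) * Wf n (a \<circ> del (Suc j)) F"
      by (simp add: m o_def) (simp add: del_def)
  qed
  finally have eq: "qf.Vop c (Wf (Suc n) a F) = pconst (?u (a 0)) * ?w -
      ((\<Sum>j<n. pconst ((- 1) ^ j * ?u (a (Suc j))) * Wf n (a \<circ> del (Suc j)) F) +
      pconst ((- 1) ^ n) * Wf (Suc n) a (qf.Vop c F))" .
  have "Wf n (a \<circ> del 0) F = ?w"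
    by (rule Wf_cong) (simp add: del_def)
  then have head: "pconst ((- 1) ^ 0 * ?u (a 0)) * Wf (Suc n - 1) (a \<circ> del 0) F = pconst (?u (a 0)) * ?w"
    by (simp only: power_0 mult_1 diff_Suc_1)
  have tail: "(\<Sum>j<n. pconst ((- 1) ^ Suc j * ?u (a (Suc j))) * Wf (Suc n - 1) (a \<circ> del (Suc j)) F) =
      - (\<Sum>j<n. pconst ((- 1) ^ j * ?u (a (Suc j))) * Wf n (a \<circ> del (Suc j)) F)"
    unfolding sum_negf[symmetric] by (intro sum.cong refl) (simp add: pconst.hom_uminus)
  have rest: "pconst ((- 1) ^ Suc n) * G = - (pconst ((- 1) ^ n) * G)" for G :: "(nat, K) pl"
    by (simp add: pconst.hom_uminus)
  show ?case
    unfolding sum.lessThan_Suc_shift head tail rest eq by (simp only: diff_conv_add_uminus minus_add_distrib add.assoc)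
qed simp

section \<open>Constant terms of words in vertex operators\<close>

lemma ct_Vop_pos: "c > 0 \<Longrightarrow> ct (qf.Vop c F) = 0"
  by (simp add: qf.Vop_def lookup_sum lookup_mult_0 qf.mz_def qf.lookup_Mser_0)

lemma ct_mz: "ct (qf.mz c) = (if c = 0 then 1 else 0)"
  by (auto simp: qf.mz_def qf.lookup_Mser_0)

lemma ct_Vop_0: "ct (qf.Vop 0 F) = ct F"
proof -
  obtain N where "\<And>k. k > int N \<Longrightarrow> qf.Dz (- 1) k F = 0"
    using qf.Dz_eventually_zero by (meson insertI1 insertI2)
  then have "ct (qf.Vop 0 F) = (\<Sum>k\<le>N. (if k = 0 then 1 else 0) * ct (qf.Dz (- 1) (int k) F))"
    by (subst qf.Vop_eq[where N = N]) (simp_all add: lookup_sum lookup_mult_0 ct_mz)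
  also have "\<dots> = (\<Sum>k\<le>N. if k = 0 then ct F else 0)"
    by (intro sum.cong) auto
  finally show ?thesis by simp
qed

lemma ct_pair: "ct (qf.Vop c (qf.mz b)) = (if c > 0 then 0 else if c = 0 then (if b = 0 then 1 else 0)
   else if c + b = 0 then 2 * par c else 0)"
proof (cases "c < 0")
  case True
  have "qf.Vop c (qf.Vop b 1) + qf.Vop b (qf.Vop c 1) = (if c + b = 0 then pconst (2 * par c) * 1 else 0)"
    by (rule Clifford_relation)
  then show ?thesis
    using True by (auto simp: qf.Vop_one lookup_pconst)
qed (auto simp: ct_Vop_pos ct_Vop_0 ct_mz)

text \<open>A positive \<open>a 0\<close> makes the constant terms on both sides vanish; a negative
  one is moved to the right end, where it kills 1. Index 0 acts trivially on the constant term and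
  on 1, so moving it through the odd word returns the same constant term negated; this doubles the
  left side, as the Clifford scalar doubles the contractions.\<close>

lemma Wick: "ct (W (2 * n + 2) a) =
    (\<Sum>j<2 * n + 1. (- 1) ^ j * ct (qf.Vop (a 0) (qf.mz (a (Suc j)))) * ct (W (2 * n) (a \<circ> skip j)))"
proof -
  let ?w = "W (2 * n + 1) (a \<circ> Suc)"
  let ?u = "\<lambda>x. if a 0 + x = 0 then 2 * par (a 0) else 0"
  have skip: "a \<circ> Suc \<circ> del j = a \<circ> skip j" for j
    by (auto simp: skip_def)
  have W: "ct (W (2 * n + 2) a) = ct (qf.Vop (a 0) ?w)"
    by simp
  have move: "ct (qf.Vop (a 0) ?w) =
      (\<Sum>j<2 * n + 1. (- 1) ^ j * ?u (a (Suc j)) * ct (W (2 * n) (a \<circ> skip j))) -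
      ct (Wf (2 * n + 1) (a \<circ> Suc) (qf.Vop (a 0) 1))"
    unfolding Clifford_move skip
    by (simp add: lookup_add lookup_sum power_add del: sum.lessThan_Suc)
  consider "a 0 > 0" | "a 0 = 0" | "a 0 < 0" by linarith
  then show ?thesis
  proof cases
    case 1
    then show ?thesis unfolding W by (simp add: ct_pair ct_Vop_pos)
  next
    case 2
    have "2 * ct ?w = 2 * (\<Sum>j<2 * n + 1. (- 1) ^ j * ct (qf.Vop (a 0) (qf.mz (a (Suc j)))) * ct (W (2 * n) (a \<circ> skip j)))"
      using move 2 unfolding sum_distrib_left
      by (auto simp: ct_Vop_0 ct_pair qf.Vop_one intro!: sum.cong simp del: sum.lessThan_Suc)
    then show ?thesis
      unfolding W using 2 by (simp add: ct_Vop_0 del: sum.lessThan_Suc)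
  next
    case 3
    then show ?thesis
      unfolding W move
      by (auto simp: ct_pair qf.Vop_one intro!: sum.cong simp del: sum.lessThan_Suc)
  qed
qed

text \<open>A family of polynomials indexed by integer vectors \<open>a\<close> is covariant on the slots \<open>S\<close> if the translation
  \<open>X \<mapsto> X + y\<close> acts by \<open>a\<^sub>s \<mapsto> a\<^sub>s - j\<close>, independently in every slot. Products of Q-functions are
  covariant, and a covariant family all of whose constant terms vanish is zero; so identities between such
  products need only be checked on constant terms.\<close>

definition covariant :: "nat set \<Rightarrow> ((nat \<Rightarrow> int) \<Rightarrow> (nat, K) pl) \<Rightarrow> bool" where
  "covariant S \<Phi> \<longleftrightarrow> finite S \<and> (\<forall>a b. (\<forall>s\<in>S. a s = b s) \<longrightarrow> \<Phi> a = \<Phi> b) \<and>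
    (\<forall>k a. qf.Dz 1 (int k) (\<Phi> a) =
      (\<Sum>c\<in>weak_comps S k. pconst (\<Prod>s\<in>S. qf.ccoeff 1 (c s)) * \<Phi> (\<lambda>s. a s - int (c s))))"

lemma covariantD:
  assumes "covariant S \<Phi>"
  shows "finite S" "(\<And>s. s \<in> S \<Longrightarrow> a s = b s) \<Longrightarrow> \<Phi> a = \<Phi> b"
    "qf.Dz 1 (int k) (\<Phi> a) =
      (\<Sum>c\<in>weak_comps S k. pconst (\<Prod>s\<in>S. qf.ccoeff 1 (c s)) * \<Phi> (\<lambda>s. a s - int (c s)))"
  using assms by (auto simp: covariant_def)

lemma covariant_one: "covariant {} (\<lambda>_. 1)"
  by (simp add: covariant_def weak_comps_empty qf.Dz_one)

text \<open>\<open>Dz_Vop_commute\<close> supplies the shift in the new slot, \<Phi> those in the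
  old ones.\<close>

lemma covariant_Vop:
  assumes \<Phi>: "covariant S \<Phi>" and s: "s \<notin> S"
  shows "covariant (insert s S) (\<lambda>a. qf.Vop (a s) (\<Phi> a))"
  unfolding covariant_def
proof (intro conjI allI impI)
  note S = covariantD(1)[OF \<Phi>]
  show "finite (insert s S)" using S by simp
  show "qf.Vop (a s) (\<Phi> a) = qf.Vop (b s) (\<Phi> b)" if "\<forall>s\<in>insert s S. a s = b s" for a b
    using that covariantD(2)[OF \<Phi>, of a b] by simp
  fix k a
  have prod: "(\<Prod>t\<in>insert s S. qf.ccoeff 1 ((c(s := i)) t)) = qf.ccoeff 1 i * (\<Prod>t\<in>S. qf.ccoeff 1 (c t))" for c i
  proof -
    have "(\<Prod>t\<in>S. qf.ccoeff 1 ((c(s := i)) t)) = (\<Prod>t\<in>S. qf.ccoeff 1 (c t))"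
      using s by (intro prod.cong) auto
    then show ?thesis using S s by simp
  qed
  have shift: "\<Phi> (\<lambda>t. a t - int ((c(s := i)) t)) = \<Phi> (\<lambda>t. a t - int (c t))" for c i
    using s by (intro covariantD(2)[OF \<Phi>]) auto
  have "qf.Dz 1 (int k) (qf.Vop (a s) (\<Phi> a)) =
      (\<Sum>i\<le>k. pconst (qf.ccoeff 1 i) * qf.Vop (a s - int i) (qf.Dz 1 (int (k - i)) (\<Phi> a)))"
    unfolding qf.Dz_Vop_commute by (intro sum.cong) (auto simp: of_nat_diff)
  also have "\<dots> = (\<Sum>i\<le>k. \<Sum>c\<in>weak_comps S (k - i). pconst (\<Prod>t\<in>insert s S. qf.ccoeff 1 ((c(s := i)) t)) *
      qf.Vop (a s - int ((c(s := i)) s)) (\<Phi> (\<lambda>t. a t - int ((c(s := i)) t))))"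
    unfolding covariantD(3)[OF \<Phi>] prod shift
    by (simp add: qf.Vop_sum qf.Vop_pconst_mult sum_distrib_left pconst.hom_mult mult.assoc)
  also have "\<dots> = (\<Sum>c\<in>weak_comps (insert s S) k. pconst (\<Prod>t\<in>insert s S. qf.ccoeff 1 (c t)) *
      qf.Vop (a s - int (c s)) (\<Phi> (\<lambda>t. a t - int (c t))))"
    by (rule sum_weak_comps_insert[OF S s, symmetric])
  finally show "qf.Dz 1 (int k) (qf.Vop (a s) (\<Phi> a)) = \<dots>" .
qed

lemma sum_weak_comps_union:
  fixes h :: "(nat \<Rightarrow> nat) \<Rightarrow> 'a::comm_monoid_add"
  assumes "finite S" "finite T" "S \<inter> T = {}"
  shows "(\<Sum>c\<in>weak_comps (S \<union> T) k. h c) =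
    (\<Sum>i\<le>k. \<Sum>c\<in>weak_comps S i. \<Sum>d\<in>weak_comps T (k - i). h (\<lambda>s. c s + d s))"
proof -
  have "(\<Sum>i\<le>k. \<Sum>c\<in>weak_comps S i. \<Sum>d\<in>weak_comps T (k - i). h (\<lambda>s. c s + d s)) =
      (\<Sum>(i, c, d)\<in>(SIGMA i:{..k}. weak_comps S i \<times> weak_comps T (k - i)). h (\<lambda>s. c s + d s))"
    using assms by (simp add: sum.cartesian_product sum.Sigma finite_weak_comps split_def)
  also have "\<dots> = (\<Sum>c\<in>weak_comps (S \<union> T) k. h c)"
  proof (rule sum.reindex_bij_witness[where
        i = "\<lambda>c. (sum c S, \<lambda>s. if s \<in> S then c s else 0, \<lambda>s. if s \<in> T then c s else 0)" and
        j = "\<lambda>(i, c, d). (\<lambda>s. c s + d s)"], goal_cases)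
    case (1 x)
    then obtain c d where x: "x = (sum c S, c, d)" and c: "\<forall>r. r \<notin> S \<longrightarrow> c r = 0" and d: "\<forall>r. r \<notin> T \<longrightarrow> d r = 0"
      by (auto simp: weak_comps_def)
    have "sum d S = 0"
      using d assms(3) by (intro sum.neutral) auto
    then show ?case
      using x c d assms(3) by (auto simp: sum.distrib fun_eq_iff)
  next
    case (2 x)
    then obtain c d where x: "x = (sum c S, c, d)" and c: "\<forall>r. r \<notin> S \<longrightarrow> c r = 0" and d: "\<forall>r. r \<notin> T \<longrightarrow> d r = 0"
      and k: "sum c S \<le> k" "sum d T = k - sum c S"
      by (auto simp: weak_comps_def)
    have "sum d S = 0" "sum c T = 0"
      using c d assms(3) by (auto intro!: sum.neutral)
    then show ?case
      using x c d k assms by (auto simp: weak_comps_def sum.distrib sum.union_disjoint)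
  next
    case (3 c)
    then show ?case by (auto simp: weak_comps_def fun_eq_iff) (use assms(3) in blast)
  next
    case (4 c)
    then show ?case
      using assms by (auto simp: weak_comps_def sum.union_disjoint)
  qed auto
  finally show ?thesis ..
qed

lemma covariant_mult:
  assumes \<Phi>: "covariant S \<Phi>" and \<Psi>: "covariant T \<Psi>" and disj: "S \<inter> T = {}"
  shows "covariant (S \<union> T) (\<lambda>a. \<Phi> a * \<Psi> a)"
  unfolding covariant_def
proof (intro conjI allI impI)
  note S = covariantD(1)[OF \<Phi>] and T = covariantD(1)[OF \<Psi>]
  show "finite (S \<union> T)" using S T by simp
  show "\<Phi> a * \<Psi> a = \<Phi> b * \<Psi> b" if "\<forall>s\<in>S \<union> T. a s = b s" for a b
    using that covariantD(2)[OF \<Phi>, of a b] covariantD(2)[OF \<Psi>, of a b] by simp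
  fix k a
  let ?p = "\<lambda>S c. \<Prod>s\<in>S. qf.ccoeff 1 (c s)"
  have "qf.Dz 1 (int k) (\<Phi> a * \<Psi> a) = (\<Sum>i\<le>k. qf.Dz 1 (int i) (\<Phi> a) * qf.Dz 1 (int (k - i)) (\<Psi> a))"
    by (subst qf.Dz_mult[where I = k]) (auto simp: of_nat_diff intro!: sum.cong)
  also have "\<dots> = (\<Sum>i\<le>k. \<Sum>c\<in>weak_comps S i. \<Sum>d\<in>weak_comps T (k - i).
      pconst (?p (S \<union> T) (\<lambda>s. c s + d s)) * (\<Phi> (\<lambda>s. a s - int (c s + d s)) * \<Psi> (\<lambda>s. a s - int (c s + d s))))"
    unfolding covariantD(3)[OF \<Phi>] covariantD(3)[OF \<Psi>] sum_product
  proof (intro sum.cong refl)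
    fix i c d assume c: "c \<in> weak_comps S i" and d: "d \<in> weak_comps T (k - i)"
    have "?p S (\<lambda>s. c s + d s) = ?p S c" "?p T (\<lambda>s. c s + d s) = ?p T d"
      using c d disj by (auto simp: weak_comps_def intro!: prod.cong)
    then have p: "?p (S \<union> T) (\<lambda>s. c s + d s) = ?p S c * ?p T d"
      using S T disj by (simp add: prod.union_disjoint)
    have "\<Phi> (\<lambda>s. a s - int (c s + d s)) = \<Phi> (\<lambda>s. a s - int (c s))"
      using c d disj by (intro covariantD(2)[OF \<Phi>]) (auto simp: weak_comps_def)
    moreover have "\<Psi> (\<lambda>s. a s - int (c s + d s)) = \<Psi> (\<lambda>s. a s - int (d s))"
      using c d disj by (intro covariantD(2)[OF \<Psi>]) (auto simp: weak_comps_def)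
    ultimately show "pconst (?p S c) * \<Phi> (\<lambda>s. a s - int (c s)) * (pconst (?p T d) * \<Psi> (\<lambda>s. a s - int (d s))) =
        pconst (?p (S \<union> T) (\<lambda>s. c s + d s)) * (\<Phi> (\<lambda>s. a s - int (c s + d s)) * \<Psi> (\<lambda>s. a s - int (c s + d s)))"
      by (simp only: p pconst.hom_mult mult_ac)
  qed
  also have "\<dots> = (\<Sum>c\<in>weak_comps (S \<union> T) k. pconst (?p (S \<union> T) c) *
      (\<Phi> (\<lambda>s. a s - int (c s)) * \<Psi> (\<lambda>s. a s - int (c s))))"
    by (rule sum_weak_comps_union[OF S T disj, symmetric])
  finally show "qf.Dz 1 (int k) (\<Phi> a * \<Psi> a) = \<dots>" .
qed

lemma covariant_add: "covariant S \<Phi> \<Longrightarrow> covariant S \<Psi> \<Longrightarrow> covariant S (\<lambda>a. \<Phi> a + \<Psi> a)"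
  unfolding covariant_def qf.Dz_add distrib_left sum.distrib by metis

lemma covariant_scale: "covariant S \<Phi> \<Longrightarrow> covariant S (\<lambda>a. pconst x * \<Phi> a)"
  unfolding covariant_def qf.Dz_pconst_mult mult.left_commute[of _ "pconst x"] sum_distrib_left[symmetric] by metis

lemma covariant_sum:
  assumes "finite S" "\<And>x. x \<in> A \<Longrightarrow> covariant S (\<Phi> x)"
  shows "covariant S (\<lambda>a. \<Sum>x\<in>A. \<Phi> x a)"
proof -
  have zero: "covariant S (\<lambda>_. 0)"
    using assms(1) by (simp add: covariant_def)
  show ?thesis
    using assms(2) by (induction A rule: infinite_finite_induct) (simp_all add: zero covariant_add)
qed

lemma covariant_W: "inj_on \<rho> {..<n} \<Longrightarrow> covariant (\<rho> ` {..<n}) (\<lambda>a. W n (a \<circ> \<rho>))"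
proof (induction n arbitrary: \<rho>)
  case 0
  then show ?case by (simp add: covariant_one)
next
  case (Suc n)
  have inj: "inj_on (\<rho> \<circ> Suc) {..<n}"
    using Suc.prems by (auto simp: inj_on_def)
  have "covariant (insert (\<rho> 0) ((\<rho> \<circ> Suc) ` {..<n})) (\<lambda>a. qf.Vop (a (\<rho> 0)) (W n (a \<circ> (\<rho> \<circ> Suc))))"
    by (rule covariant_Vop[OF Suc.IH[OF inj]]) (use Suc.prems in \<open>auto simp: inj_on_def\<close>)
  moreover have "insert (\<rho> 0) ((\<rho> \<circ> Suc) ` {..<n}) = \<rho> ` {..<Suc n}"
    by (simp add: lessThan_Suc_eq_insert_0 image_comp)
  ultimately show ?case by (simp add: o_def)
qed

text \<open>The polynomials orthogonal to every member include 1 and are closed under multiplication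
  by \<open>mz\<close>, since the adjoint translation only produces other members.\<close>

lemma covariant_eq_zero:
  assumes \<Phi>: "covariant S \<Phi>" and ct: "\<And>a. ct (\<Phi> a) = 0"
  shows "\<Phi> a = 0"
proof (rule qf.form_eqI)
  fix F
  let ?V = "{F. \<forall>a. qf.B F (\<Phi> a) = 0}"
  have "F \<in> ?V"
  proof (rule qf.closed_under_mz_imp_UNIV[OF inj_q_weight])
    show "1 \<in> ?V"
      using ct by simp
    show "qf.mz (int l) * F \<in> ?V" if "F \<in> ?V" for l F
      using that by (simp add: qf.Mser_adjoint_mz covariantD(3)[OF \<Phi>] form_sum_right form_pconst_mult_right)
  qed (auto simp: form_add_left form_pconst_mult_left)
  then show "qf.B F (\<Phi> a) = qf.B F 0" by simp
qed

text \<open>The difference of the two sides is covariant on all \<open>2 * n + 2\<close> slots, as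
  each product uses two complementary sets of slots; its constant terms vanish by
  \<open>Wick\<close>.\<close>

theorem W_expand: "W (2 * n + 2) a =
    (\<Sum>j<2 * n + 1. pconst ((- 1) ^ j) * (qf.Vop (a 0) (qf.mz (a (Suc j))) * W (2 * n) (a \<circ> skip j)))"
proof -
  let ?E = "\<lambda>a. W (2 * n + 2) a + pconst (- 1) * (\<Sum>j<2 * n + 1. pconst ((- 1) ^ j) *
      (qf.Vop (a 0) (qf.mz (a (Suc j))) * W (2 * n) (a \<circ> skip j)))"
  have "covariant {..<2 * n + 2} ?E"
  proof (intro covariant_add covariant_scale covariant_sum)
    show "covariant {..<2 * n + 2} (W (2 * n + 2))"
      using covariant_W[of id "2 * n + 2"] by simp
    fix j assume j: "j \<in> {..<2 * n + 1}"
    \<comment> \<open>The contracted slots \<open>0\<close> and \<open>Suc j\<close>, read as a word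
      of length 2.\<close>
    let ?\<rho> = "\<lambda>i::nat. if i = 0 then 0 else Suc j"
    have "covariant (?\<rho> ` {..<2}) (\<lambda>a. W 2 (a \<circ> ?\<rho>))"
      by (rule covariant_W) (auto simp: inj_on_def)
    moreover have "?\<rho> ` {..<2} = {0, Suc j}"
    proof -
      have "{..<2::nat} = {0, 1}" by auto
      then show ?thesis by (simp add: insert_commute)
    qed
    moreover have "W 2 (a \<circ> ?\<rho>) = qf.Vop (a 0) (qf.mz (a (Suc j)))" for a
      by (simp add: numeral_2_eq_2 qf.Vop_one)
    ultimately have 1: "covariant {0, Suc j} (\<lambda>a. qf.Vop (a 0) (qf.mz (a (Suc j))))"
      by simp
    have 2: "covariant (skip j ` {..<2 * n}) (\<lambda>a. W (2 * n) (a \<circ> skip j))"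
      by (rule covariant_W) (auto simp: inj_on_def skip_def del_def split: if_splits)
    have union: "{0, Suc j} \<union> skip j ` {..<2 * n} = {..<2 * n + 2}"
    proof (intro equalityI subsetI)
      fix x assume x: "x \<in> {..<2 * n + 2}"
      consider "x = 0" | "x = Suc j" | "0 < x" "x \<le> j" | "x > Suc j" by linarith
      then show "x \<in> {0, Suc j} \<union> skip j ` {..<2 * n}"
      proof cases
        case 3
        then show ?thesis
          using j by (intro UnI2 image_eqI[of _ _ "x - 1"]) (auto simp: skip_def del_def)
      next
        case 4
        then show ?thesis
          using x by (intro UnI2 image_eqI[of _ _ "x - 2"]) (auto simp: skip_def del_def)
      qed auto
    qed (use j in \<open>auto simp: skip_def del_def\<close>)
    have "covariant ({0, Suc j} \<union> skip j ` {..<2 * n}) (\<lambda>a. qf.Vop (a 0) (qf.mz (a (Suc j))) * W (2 * n) (a \<circ> skip j))"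
      by (rule covariant_mult[OF 1 2]) (auto simp: skip_def del_def split: if_splits)
    then show "covariant {..<2 * n + 2} (\<lambda>a. qf.Vop (a 0) (qf.mz (a (Suc j))) * W (2 * n) (a \<circ> skip j))"
      by (simp only: union)
  qed simp
  moreover have "ct (?E a) = 0" for a
    unfolding lookup_add lookup_sum lookup_mult_0 Wick
    by (simp add: lookup_pconst mult.assoc del: sum.lessThan_Suc Wf.simps)
  ultimately have "?E a = 0"
    by (rule covariant_eq_zero)
  then show ?thesis
    unfolding pconst.hom_uminus pconst.hom_one mult_minus_left mult_1 add_uminus_conv_diff right_minus_eq .
qed

lemma Vop_mz: "qf.Vop r (qf.mz s) = qf2 r s"
proof (cases "s < 0")
  case True
  then show ?thesis by (simp add: qf2_def)
next
  case False
  then show ?thesis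
    using qf.Vop_mult_mz[of r "nat s" 1] by (simp add: qf2_def qf.Vop_one mult_ac)
qed

section \<open>Perfect matchings and the recursion of the Pfaffian\<close>

definition pf_matchings :: "nat \<Rightarrow> (nat \<Rightarrow> nat) set" where
  "pf_matchings n = {\<sigma>. \<sigma> permutes {..<2 * n} \<and> (\<forall>i<n. \<sigma> (2 * i) < \<sigma> (2 * i + 1)) \<and>
        (\<forall>j<n. \<forall>i<j. \<sigma> (2 * i) < \<sigma> (2 * j))}"

text \<open>Adds the pair of \<open>0\<close> and \<open>Suc j\<close> in front of a matching and
  relabels the other points by \<open>skip j\<close>. Nesting two insertions makes the sign
  computable by \<open>signof_permutation_insert\<close>.\<close>

definition pf_insert :: "nat \<Rightarrow> (nat \<Rightarrow> nat) \<Rightarrow> nat \<Rightarrow> nat" where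
  "pf_insert j \<tau> = permutation_insert 0 0 (permutation_insert 0 j \<tau>)"

lemma pf_insert_values:
  "pf_insert j \<tau> 0 = 0" "pf_insert j \<tau> (Suc 0) = Suc j" "pf_insert j \<tau> (Suc (Suc k)) = skip j (\<tau> k)"
  by (simp_all add: pf_insert_def permutation_insert_expand skip_def del_def)

lemma skip_less_iff [simp]: "skip j k < skip j l \<longleftrightarrow> k < l"
  by (auto simp: skip_def del_def)

lemma pf_insert_in_matchings_iff:
  assumes "\<tau> permutes {..<2 * n}" "j < 2 * n + 1"
  shows "pf_insert j \<tau> \<in> pf_matchings (Suc n) \<longleftrightarrow> \<tau> \<in> pf_matchings n"
proof -
  have "permutation_insert 0 j \<tau> permutes {0..<Suc (2 * n)}"
    using assms by (intro permutation_insert_permutes) (auto simp: lessThan_atLeast0)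
  then have "pf_insert j \<tau> permutes {0..<Suc (Suc (2 * n))}"
    unfolding pf_insert_def by (rule permutation_insert_permutes) auto
  then have perm: "pf_insert j \<tau> permutes {..<2 * Suc n}"
    by (simp add: lessThan_atLeast0)
  have vals: "pf_insert j \<tau> (2 * Suc i) = skip j (\<tau> (2 * i))" "pf_insert j \<tau> (2 * Suc i + 1) = skip j (\<tau> (2 * i + 1))" for i
    using pf_insert_values(3)[of j \<tau> "2 * i"] pf_insert_values(3)[of j \<tau> "2 * i + 1"] by simp_all
  have "(\<forall>i<Suc n. pf_insert j \<tau> (2 * i) < pf_insert j \<tau> (2 * i + 1)) \<longleftrightarrow> (\<forall>i<n. \<tau> (2 * i) < \<tau> (2 * i + 1))"
    unfolding All_less_Suc2 vals by (simp add: pf_insert_values)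
  moreover have "(\<forall>l<Suc n. \<forall>i<l. pf_insert j \<tau> (2 * i) < pf_insert j \<tau> (2 * l)) \<longleftrightarrow> (\<forall>l<n. \<forall>i<l. \<tau> (2 * i) < \<tau> (2 * l))"
    unfolding All_less_Suc2 vals by (simp add: pf_insert_values) (simp add: skip_def)
  ultimately show ?thesis
    using assms perm by (simp add: pf_matchings_def)
qed

text \<open>In a normalised matching the point 0 comes first; its partner determines
  \<open>j\<close>, and the rest is a smaller matching.\<close>

lemma pf_matchings_Suc:
  "pf_matchings (Suc n) = (\<lambda>(j, \<tau>). pf_insert j \<tau>) ` ({..<2 * n + 1} \<times> pf_matchings n)"
proof (intro equalityI subsetI)
  fix \<sigma> assume \<sigma>: "\<sigma> \<in> pf_matchings (Suc n)"
  then have perm: "\<sigma> permutes {0..<Suc (Suc (2 * n))}"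
    by (simp add: pf_matchings_def lessThan_atLeast0)
  have lt: "\<sigma> (2 * i) < \<sigma> (2 * i + 1)" if "i < Suc n" for i
    using \<sigma> that by (simp add: pf_matchings_def)
  have lt': "\<sigma> (2 * i) < \<sigma> (2 * l)" if "l < Suc n" "i < l" for i l
    using \<sigma> that by (auto simp: pf_matchings_def)
  have "\<sigma> 0 = 0"
  proof (rule ccontr)
    assume nz: "\<sigma> 0 \<noteq> 0"
    obtain t where t: "\<sigma> t = 0"
      using permutes_surj[OF perm] by (metis surj_def)
    have tn: "t < Suc (Suc (2 * n))"
      using t permutes_not_in[OF perm, of t] by (cases "t < Suc (Suc (2 * n))") auto
    show False
    \<comment> \<open>An even position \<open>t\<close> of the value 0 would break the increase of
      the first entries, an odd one the order inside a pair.\<close>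
    proof (cases "even t")
      case True
      then obtain i where i: "t = 2 * i" by blast
      then show False
        using lt'[of i 0] t nz tn by (cases "i = 0") auto
    next
      case False
      then obtain i where i: "t = 2 * i + 1" by (rule oddE)
      then show False
        using lt[of i] t tn by auto
    qed
  qed
  then have "\<sigma> \<in> {p. p permutes {0..<Suc (Suc (2 * n))} \<and> p 0 = 0}"
    using perm by simp
  then obtain p where p: "p permutes {0..<Suc (2 * n)}" "\<sigma> = permutation_insert 0 0 p"
    unfolding permutation_fix[OF zero_less_Suc zero_less_Suc] by auto
  have p0: "p 0 < Suc (2 * n)"
    using permutes_in_image[OF p(1), of 0] by auto
  then have "p \<in> {q. q permutes {0..<Suc (2 * n)} \<and> q 0 = p 0}"
    using p by simp
  then obtain \<tau> where \<tau>: "\<tau> permutes {0..<2 * n}" "p = permutation_insert 0 (p 0) \<tau>"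
    unfolding permutation_fix[OF zero_less_Suc p0] by auto
  then have "\<sigma> = pf_insert (p 0) \<tau>"
    using p by (simp add: pf_insert_def)
  moreover have "\<tau> \<in> pf_matchings n"
    using \<sigma> \<tau> p0 calculation pf_insert_in_matchings_iff[of \<tau> n "p 0"] by (simp add: lessThan_atLeast0)
  ultimately show "\<sigma> \<in> (\<lambda>(j, \<tau>). pf_insert j \<tau>) ` ({..<2 * n + 1} \<times> pf_matchings n)"
    using p0 by auto
next
  fix \<sigma> assume "\<sigma> \<in> (\<lambda>(j, \<tau>). pf_insert j \<tau>) ` ({..<2 * n + 1} \<times> pf_matchings n)"
  then obtain j \<tau> where "\<sigma> = pf_insert j \<tau>" "j < 2 * n + 1" "\<tau> \<in> pf_matchings n" by auto
  then show "\<sigma> \<in> pf_matchings (Suc n)"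
    using pf_insert_in_matchings_iff[of \<tau> n j] by (simp add: pf_matchings_def)
qed

lemma sign_pf_insert:
  assumes "\<tau> permutes {..<2 * n}" "j < 2 * n + 1"
  shows "(of_int (sign (pf_insert j \<tau>)) :: 'a::comm_ring_1) = (- 1) ^ j * of_int (sign \<tau>)"
proof -
  have \<tau>: "\<tau> permutes {0..<2 * n}"
    using assms by (simp add: lessThan_atLeast0)
  have "permutation_insert 0 j \<tau> permutes {0..<Suc (2 * n)}"
    using assms by (intro permutation_insert_permutes[OF \<tau>]) auto
  then have "(of_int (sign (pf_insert j \<tau>)) :: 'a) = of_int (sign (permutation_insert 0 j \<tau>))"
    unfolding pf_insert_def by (subst signof_permutation_insert) auto
  also have "\<dots> = (- 1) ^ j * of_int (sign \<tau>)"
    using assms by (subst signof_permutation_insert[OF \<tau>]) auto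
  finally show ?thesis .
qed

text \<open>Expansion along the first row, the same recursion as \<open>W_expand\<close>.\<close>

theorem pfaffian_Suc:
  "pfaffian (Suc n) M = (\<Sum>j<2 * n + 1. (- 1) ^ j * (M 0 (Suc j) * pfaffian n (\<lambda>i k. M (skip j i) (skip j k))))"
proof -
  have pf: "pfaffian n M = (\<Sum>\<sigma>\<in>pf_matchings n. of_int (sign \<sigma>) * (\<Prod>i<n. M (\<sigma> (2 * i)) (\<sigma> (2 * i + 1))))"
    for n and M :: "nat \<Rightarrow> nat \<Rightarrow> 'a"
    by (simp add: pfaffian_def pf_matchings_def)
  have fin: "finite (pf_matchings n)"
    by (rule finite_subset[of _ "{\<sigma>. \<sigma> permutes {..<2 * n}}"]) (auto simp: pf_matchings_def finite_permutations)
  have inj: "inj_on (\<lambda>(j, \<tau>). pf_insert j \<tau>) ({..<2 * n + 1} \<times> pf_matchings n)"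
  proof (rule inj_onI, clarify)
    fix j \<tau> j' \<tau>' assume eq: "pf_insert j \<tau> = pf_insert j' \<tau>'"
    then have j: "j = j'"
      using pf_insert_values(2)[of j \<tau>] pf_insert_values(2)[of j' \<tau>'] by simp
    moreover have "\<tau> k = \<tau>' k" for k
    proof -
      have "skip j (\<tau> k) = skip j (\<tau>' k)"
        using eq j pf_insert_values(3)[of j \<tau> k] pf_insert_values(3)[of j' \<tau>' k] by simp
      then show ?thesis
        by (metis skip_less_iff linorder_neqE_nat nat_neq_iff)
    qed
    ultimately show "j = j' \<and> \<tau> = \<tau>'" by auto
  qed
  have "pfaffian (Suc n) M = (\<Sum>(j, \<tau>)\<in>{..<2 * n + 1} \<times> pf_matchings n.
      of_int (sign (pf_insert j \<tau>)) * (\<Prod>i<Suc n. M (pf_insert j \<tau> (2 * i)) (pf_insert j \<tau> (2 * i + 1))))"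
    unfolding pf pf_matchings_Suc by (subst sum.reindex[OF inj]) (simp add: split_def)
  also have "\<dots> = (\<Sum>(j, \<tau>)\<in>{..<2 * n + 1} \<times> pf_matchings n. (- 1) ^ j * (M 0 (Suc j) *
      (of_int (sign \<tau>) * (\<Prod>i<n. M (skip j (\<tau> (2 * i))) (skip j (\<tau> (2 * i + 1)))))))"
  proof (intro sum.cong refl, clarify)
    fix j \<tau> assume "\<tau> \<in> pf_matchings n" "j < 2 * n + 1"
    then have sign: "(of_int (sign (pf_insert j \<tau>)) :: 'a) = (- 1) ^ j * of_int (sign \<tau>)"
      by (intro sign_pf_insert) (auto simp: pf_matchings_def)
    have "(\<Prod>i<Suc n. M (pf_insert j \<tau> (2 * i)) (pf_insert j \<tau> (2 * i + 1))) =
        M 0 (Suc j) * (\<Prod>i<n. M (skip j (\<tau> (2 * i))) (skip j (\<tau> (2 * i + 1))))"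
      unfolding prod.lessThan_Suc_shift by (simp add: pf_insert_values)
    then show "of_int (sign (pf_insert j \<tau>)) * (\<Prod>i<Suc n. M (pf_insert j \<tau> (2 * i)) (pf_insert j \<tau> (2 * i + 1))) =
        (- 1) ^ j * (M 0 (Suc j) * (of_int (sign \<tau>) * (\<Prod>i<n. M (skip j (\<tau> (2 * i))) (skip j (\<tau> (2 * i + 1))))))"
      unfolding sign by (simp add: mult_ac)
  qed
  also have "\<dots> = (\<Sum>j<2 * n + 1. (- 1) ^ j * (M 0 (Suc j) * pfaffian n (\<lambda>i k. M (skip j i) (skip j k))))"
    unfolding pf sum_distrib_left sum.cartesian_product ..
  finally show ?thesis .
qed

lemma pfaffian_0 [simp]: "pfaffian 0 M = 1"
proof -
  have "{\<sigma>. \<sigma> permutes ({} :: nat set)} = {id}"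
    by (simp add: permutes_empty)
  then show ?thesis by (simp add: pfaffian_def)
qed

theorem W_eq_pfaffian: "W (2 * n) a = pfaffian n (\<lambda>i j. qf2 (a i) (a j))"
proof (induction n arbitrary: a)
  case (Suc n)
  have "W (2 * Suc n) a = W (2 * n + 2) a" by simp
  also have "\<dots> = (\<Sum>j<2 * n + 1. (- 1) ^ j * (qf2 (a 0) (a (Suc j)) * pfaffian n (\<lambda>i k. qf2 (a (skip j i)) (a (skip j k)))))"
    unfolding W_expand Suc Vop_mz by (simp add: pconst.hom_power pconst.hom_uminus o_def)
  finally show ?case by (simp only: pfaffian_Suc)
qed simp

lemma W_eq_Q_poly: "W (length \<nu>) (\<lambda>i. int (\<nu> ! i)) = Q_poly \<nu>"
  by (induction \<nu>) (simp_all add: o_def)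

text \<open>For odd length the padding zero is one more operator \<open>qf.Vop 0\<close>, applied to
  1, which returns 1.\<close>

lemma Q_poly_eq_pfaffian:
  "Q_poly \<nu> = pfaffian ((length \<nu> + 1) div 2) (\<lambda>i j. qf2 (if i < length \<nu> then int (\<nu> ! i) else 0)
      (if j < length \<nu> then int (\<nu> ! j) else 0))"
proof -
  let ?a = "\<lambda>i. if i < length \<nu> then int (\<nu> ! i) else 0"
  have "W (2 * ((length \<nu> + 1) div 2)) ?a = Q_poly \<nu>"
  proof (cases "even (length \<nu>)")
    case True
    then have "W (2 * ((length \<nu> + 1) div 2)) ?a = W (length \<nu>) ?a"
      by (simp add: div_add1_eq)
    also have "\<dots> = W (length \<nu>) (\<lambda>i. int (\<nu> ! i))"
      by (rule Wf_cong) simp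
    finally show ?thesis by (simp add: W_eq_Q_poly)
  next
    case False
    have snoc: "Wf (Suc n) a F = Wf n a (qf.Vop (a n) F)" for n a F
    proof (induction n arbitrary: a)
      case (Suc n)
      have "Wf (Suc (Suc n)) a F = qf.Vop (a 0) (Wf (Suc n) (a \<circ> Suc) F)"
        by (rule Wf.simps)
      then show ?case
        unfolding Suc.IH by simp
    qed simp
    have "W (2 * ((length \<nu> + 1) div 2)) ?a = W (Suc (length \<nu>)) ?a"
      using False by simp
    also have "\<dots> = W (length \<nu>) ?a"
      unfolding snoc by (simp add: qf.Vop_one)
    also have "\<dots> = W (length \<nu>) (\<lambda>i. int (\<nu> ! i))"
      by (rule Wf_cong) simp
    finally show ?thesis by (simp add: W_eq_Q_poly)
  qed
  then show ?thesis by (simp add: W_eq_pfaffian)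
qed

section \<open>Odd power sums among all power sums\<close>

definition odd_X :: "(nat, K) pl \<Rightarrow> (nat, K) mfps" where
  "odd_X = poly_eval mconst (\<lambda>n. psum (q_weight n) (\<lambda>_. 1))"

text \<open>\<open>plethysm\<close> refers to polynomials in all power sums, where p_(2n+1) has
  index \<open>2 * n\<close>.\<close>

definition odd_incl :: "(nat, K) pl \<Rightarrow> (nat, K) pl" where
  "odd_incl = poly_eval pconst (\<lambda>n. pvar (2 * n))"

lemma comm_ring_hom_odd_incl: "comm_ring_hom odd_incl"
  unfolding odd_incl_def by (rule comm_ring_hom_poly_eval[OF comm_ring_hom_pconst])

lemma comm_ring_hom_odd_X: "comm_ring_hom odd_X"
  unfolding odd_X_def by (rule comm_ring_hom_poly_eval[OF comm_ring_hom_mconst])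

interpretation odd_X: comm_ring_hom odd_X
  by (rule comm_ring_hom_odd_X)

lemma odd_X_eq: "odd_X F = at_X (odd_incl F)"
proof -
  have "at_X (odd_incl F) = poly_eval (at_X \<circ> pconst) (at_X \<circ> (\<lambda>n. pvar (2 * n))) F"
    unfolding odd_incl_def by (rule poly_eval_comp[OF comm_ring_hom_at_X comm_ring_hom_pconst])
  then show ?thesis
    by (simp add: odd_X_def o_def q_weight_def)
qed

lemma plethysm_odd_X: "plethysm (odd_X F) A = poly_eval mconst (\<lambda>n. power_sum (q_weight n) A) F"
proof -
  have "poly_eval mconst (\<lambda>n. power_sum (Suc n) A) (odd_incl F) =
      poly_eval (poly_eval mconst (\<lambda>n. power_sum (Suc n) A) \<circ> pconst)
        (poly_eval mconst (\<lambda>n. power_sum (Suc n) A) \<circ> (\<lambda>n. pvar (2 * n))) F"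
    unfolding odd_incl_def
    by (rule poly_eval_comp[OF comm_ring_hom_poly_eval[OF comm_ring_hom_mconst] comm_ring_hom_pconst])
  then show ?thesis
    unfolding odd_X_eq plethysm_at_X
    by (simp add: o_def q_weight_def poly_eval_pconst[OF comm_ring_hom_mconst] poly_eval_pvar[OF comm_ring_hom_mconst])
qed

text \<open>For t = -1 the factor 1 - t^k is 0 for even k and 2 for odd k, which is degree over norm
  in the ring of odd power sums.\<close>

lemma hl_poly_minus_1: "hl_poly (- 1) k = odd_incl (qf.mz (int k))"
proof -
  have "odd_incl (qf.Mser (\<lambda>_. 1) $ k) =
      pexp.fexp (Abs_fps (\<lambda>i. pconst (1 - (- 1) ^ Suc i) * pvar i)) $ k"
    unfolding qf.Mser_def
  proof (rule fexp_hom[OF rat_algebra_pconst rat_algebra_pconst comm_ring_hom_odd_incl])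
    fix i
    have [simp]: "odd_incl (pconst c) = pconst c" "odd_incl (pvar n) = pvar (2 * n)" for c n
      by (simp_all add: odd_incl_def poly_eval_pconst[OF comm_ring_hom_pconst] poly_eval_pvar[OF comm_ring_hom_pconst])
    interpret odd: comm_ring_hom odd_incl by (rule comm_ring_hom_odd_incl)
    show "odd_incl (qf.logder (\<lambda>_. 1) $ i) = Abs_fps (\<lambda>i. pconst (1 - (- 1) ^ Suc i) * pvar i) $ i"
    proof (cases "even i")
      case True
      then obtain l where l: "i = 2 * l" by blast
      then have "{n. q_weight n = Suc i \<and> (1::K) \<noteq> 0} = {l}"
        by (auto simp: q_weight_def)
      moreover have "of_nat (q_weight l) * 1 / q_norm l = 2"
        using qf.g_nonzero[of l] by (simp add: q_norm_def)
      ultimately show ?thesis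
        unfolding qf.logder_def fps_nth_Abs_fps by (simp only: sum.insert finite.emptyI empty_iff
            not_False_eq_True sum.empty add_0_right odd.hom_mult) (simp add: l)
    next
      case False
      then have "{n. q_weight n = Suc i \<and> (1::K) \<noteq> 0} = {}"
        by (auto simp: q_weight_def)
      then show ?thesis
        using False by (simp only: qf.logder_def fps_nth_Abs_fps sum.empty) simp
    qed
  qed (simp add: odd_incl_def poly_eval_pconst[OF comm_ring_hom_pconst])
  then show ?thesis by (simp add: hl_poly_def qf.mz_def)
qed

lemma schur_q_eq: "schur_q k = odd_X (qf.mz (int k))"
  by (simp add: hall_littlewood_q_eq hl_poly_minus_1 odd_X_eq)

lemma schur_Q2_eq: "schur_Q2 r s = odd_X (qf2 (int r) (int s))"
proof -
  have "{..s} = insert 0 {1..s}" by auto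
  then have "qf2 (int r) (int s) = qf.mz (int r) * qf.mz (int s) +
      (\<Sum>i=1..s. pconst (qf.ccoeff (- 1) i) * (qf.mz (int r + int i) * qf.mz (int s - int i)))"
    by (simp add: qf2_def)
  also have "(\<Sum>i=1..s. pconst (qf.ccoeff (- 1) i) * (qf.mz (int r + int i) * qf.mz (int s - int i))) =
      2 * (\<Sum>k=1..s. (- 1) ^ k * qf.mz (int (r + k)) * qf.mz (int (s - k)))"
    unfolding sum_distrib_left
    by (intro sum.cong refl)
       (simp add: qf_ccoeff_minus qf_ccoeff_1 par_int of_nat_diff pconst.hom_mult pconst.hom_power pconst.hom_uminus pconst.hom_numeral mult_ac)
  finally show ?thesis
    by (simp add: schur_Q2_def schur_q_eq odd_X.hom_add odd_X.hom_mult odd_X.hom_sum odd_X.hom_power odd_X.hom_uminus odd_X.hom_numeral)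
qed

theorem schur_Q_eq: "schur_Q \<nu> = odd_X (Q_poly \<nu>)"
proof -
  have "odd_X (pfaffian n M) = pfaffian n (\<lambda>i j. odd_X (M i j))" for n M
    by (simp add: pfaffian_def odd_X.hom_sum odd_X.hom_mult odd_X.hom_prod odd_X.hom_of_int)
  then show ?thesis
    unfolding schur_Q_def Q_poly_eq_pfaffian Let_def schur_Q2_eq by (simp add: if_distrib[of int] cong: if_cong)
qed


section \<open>Expansion coefficients\<close>

text \<open>Injectivity of \<Theta> and orthogonality make the expansion unique, spanning makes it
  exist, so the description selects the Fourier coefficients. The scalars \<open>x s\<close> carry
  the normalisations of the bases: powers of 2 or of \<open>qq - 1\<close>.\<close>

lemma expansion_coeff_orthogonal:
  fixes g :: "'i \<Rightarrow> K" and \<Theta> :: "('i, K) pl \<Rightarrow> ('v, K) mfps" and e :: "'s \<Rightarrow> ('i, K) pl"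
  assumes w: "weights w g"
    and \<Theta>: "comm_ring_hom \<Theta>" "\<And>c. \<Theta> (pconst c) = mconst c" "\<And>F. \<Theta> F = 0 \<Longrightarrow> F = 0"
    and orth: "\<And>s t. s \<in> I \<Longrightarrow> t \<in> I \<Longrightarrow> s \<noteq> t \<Longrightarrow> form g (e s) (e t) = 0"
    and norm: "\<And>s. s \<in> I \<Longrightarrow> form g (e s) (e s) \<noteq> 0"
    and F: "F \<in> lspan I e"
    and x: "\<And>s. x s \<noteq> 0"
    and s: "s \<in> I"
  shows "expansion_coeff I (\<lambda>s. mconst (x s) * \<Theta> (e s)) (\<Theta> F) s = form g F (e s) / (form g (e s) (e s) * x s)"
proof -
  interpret weights w g by (rule w)
  interpret \<Theta>: comm_ring_hom \<Theta> by (rule \<Theta>)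
  define c where "c s = (if s \<in> I then form g F (e s) / (form g (e s) (e s) * x s) else 0)" for s
  obtain T d where T: "finite T" "T \<subseteq> I" "F = (\<Sum>s\<in>T. pconst (d s) * e s)"
    using F by (auto simp: lspan_def)
  have expand: "finite {s \<in> I. B F (e s) \<noteq> 0}"
      "F = (\<Sum>s | s \<in> I \<and> B F (e s) \<noteq> 0. pconst (B F (e s) / B (e s) (e s)) * e s)"
    using orthogonal_expansion[of I e T F d] orth norm T by blast+
  have supp: "{s. c s \<noteq> 0} = {s \<in> I. B F (e s) \<noteq> 0}"
    using norm x by (auto simp: c_def)
  have term_eq: "mconst y * (mconst (x s) * \<Theta> (e s)) = \<Theta> (pconst (y * x s) * e s)" for y s
    by (simp add: \<Theta>.hom_mult \<Theta>(2) mconst.hom_mult mult.assoc)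
  have "\<Theta> F = (\<Sum>s | c s \<noteq> 0. mconst (c s) * (mconst (x s) * \<Theta> (e s)))"
  proof -
    have "(\<Sum>s | c s \<noteq> 0. mconst (c s) * (mconst (x s) * \<Theta> (e s))) = \<Theta> (\<Sum>s | c s \<noteq> 0. pconst (c s * x s) * e s)"
      by (simp add: term_eq \<Theta>.hom_sum)
    also have "(\<Sum>s | c s \<noteq> 0. pconst (c s * x s) * e s) =
        (\<Sum>s | s \<in> I \<and> B F (e s) \<noteq> 0. pconst (B F (e s) / B (e s) (e s)) * e s)"
      unfolding supp by (intro sum.cong) (auto simp: c_def x)
    also have "\<dots> = F"
      by (rule expand(2)[symmetric])
    finally show ?thesis ..
  qed
  moreover have "d = c" if d: "{s. d s \<noteq> 0} \<subseteq> I" "finite {s. d s \<noteq> 0}"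
      "\<Theta> F = (\<Sum>s | d s \<noteq> 0. mconst (d s) * (mconst (x s) * \<Theta> (e s)))" for d
  proof
    fix t
    have "\<Theta> (F - (\<Sum>s | d s \<noteq> 0. pconst (d s * x s) * e s)) = 0"
      unfolding \<Theta>.hom_minus \<Theta>.hom_sum d(3) term_eq by simp
    then have Fd: "F = (\<Sum>s | d s \<noteq> 0. pconst (d s * x s) * e s)"
      using \<Theta>(3) by fastforce
    show "d t = c t"
    proof (cases "t \<in> I")
      case True
      have "B F (e t) = (\<Sum>s | d s \<noteq> 0. if s = t then d t * x t * B (e t) (e t) else 0)"
        unfolding Fd form_sum_left form_pconst_mult_left
        using d(1) True orth by (intro sum.cong) auto
      also have "\<dots> = d t * x t * B (e t) (e t)"
        using d(2) by (auto simp: sum.delta)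
      finally show ?thesis
        using True norm[of t] x[of t] by (simp add: c_def)
    qed (use d(1) in \<open>auto simp: c_def\<close>)
  qed
  ultimately have "expansion_coeff I (\<lambda>s. mconst (x s) * \<Theta> (e s)) (\<Theta> F) = c"
    unfolding expansion_coeff_def using supp expand(1)
    by (intro the_equality conjI) auto
  then show ?thesis using s by (simp add: c_def)
qed

section \<open>Rescaling of power sums\<close>

context vertex
begin

text \<open>Plethysm by (q - 1)X as an endomorphism of the polynomial ring; it keeps the argument of
  \<open>expansion_coeff\<close> an image of a polynomial.\<close>

definition rescale :: "('i \<Rightarrow> 'k) \<Rightarrow> ('i, 'k) pl \<Rightarrow> ('i, 'k) pl" where
  "rescale b = poly_eval pconst (\<lambda>n. pconst (b n) * pvar n)"

lemma comm_ring_hom_rescale: "comm_ring_hom (rescale b)"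
  unfolding rescale_def by (rule comm_ring_hom_poly_eval[OF comm_ring_hom_pconst])

lemma rescale_Mser: "rescale b (Mser (\<lambda>_. 1) $ k) = Mser b $ k"
  unfolding Mser_def
proof (rule fexp_hom[OF rat_algebra_pconst rat_algebra_pconst comm_ring_hom_rescale])
  interpret R: comm_ring_hom "rescale b" by (rule comm_ring_hom_rescale)
  have [simp]: "rescale b (pconst c) = pconst c" "rescale b (pvar n) = pconst (b n) * pvar n" for c n
    by (simp_all add: rescale_def poly_eval_pconst[OF comm_ring_hom_pconst] poly_eval_pvar[OF comm_ring_hom_pconst])
  show "rescale b (pconst c) = pconst c" for c by simp
  fix k
  have "rescale b (logder (\<lambda>_. 1) $ k) = (\<Sum>n | w n = Suc k. pconst (of_nat (w n) * b n / g n) * pvar n)"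
    unfolding logder_def fps_nth_Abs_fps R.hom_sum R.hom_mult
    by (intro sum.cong) (auto simp: mult.assoc[symmetric] pconst.hom_mult[symmetric])
  also have "\<dots> = logder b $ k"
    unfolding logder_def fps_nth_Abs_fps
    by (intro sum.mono_neutral_right) (auto simp: finite_weight)
  finally show "rescale b (logder (\<lambda>_. 1) $ k) = logder b $ k" .
qed

lemma poly_eval_rescale:
  "poly_eval mconst (\<lambda>n. psum (w n) (\<lambda>_. b n)) F = poly_eval mconst (\<lambda>n. psum (w n) (\<lambda>_. 1)) (rescale b F)"
proof -
  let ?h = "poly_eval mconst (\<lambda>n. psum (w n) (\<lambda>_. 1)) :: ('i, 'k) pl \<Rightarrow> ('b, 'k) mfps"
  have h: "comm_ring_hom ?h"
    by (rule comm_ring_hom_poly_eval[OF comm_ring_hom_mconst])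
  interpret h: comm_ring_hom ?h by (rule h)
  show ?thesis
    unfolding rescale_def poly_eval_comp[OF h comm_ring_hom_pconst]
    by (simp add: o_def h.hom_mult poly_eval_pconst[OF comm_ring_hom_mconst]
        poly_eval_pvar[OF comm_ring_hom_mconst] psum_mconst_mult)
qed

end


section \<open>Hecke--Clifford algebras\<close>

lemma odd_X_injective: "odd_X F = 0 \<Longrightarrow> F = 0"
proof -
  assume "odd_X F = 0"
  then have zero: "poly_eval mconst (\<lambda>i. psum (q_weight i) (\<lambda>v::nat. 1)) F = 0"
    by (simp only: odd_X_def)
  have sep: "\<exists>c. qf.isolates c i \<and> infinite {v::nat. (\<lambda>_. 1 :: K) = c}" for i
    using inj_q_weight by (intro exI[of _ "\<lambda>_. 1"]) (auto simp: qf.isolates_def inj_def)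
  show ?thesis
    using qf.poly_eval_psum_injective[of "\<lambda>v n. 1", OF qf.admissible sep zero] by simp
qed

lemma odd_X_pconst [simp]: "odd_X (pconst c) = mconst c"
  by (simp add: odd_X_def poly_eval_pconst[OF comm_ring_hom_mconst])

theorem HC_part:
  assumes \<nu>: "\<nu> \<in> strict_partitions"
  shows "HC_G \<nu> = mconst (2 powi ((- int (length \<nu>) + int (delta \<nu>)) div 2)) *
      plethysm (schur_Q \<nu>) (q_minus_1 * alphabet UNIV)"
proof (rule mfps_eqI)
  fix \<alpha> :: "nat \<Rightarrow>\<^sub>0 nat"
  let ?b = "\<lambda>n. qq ^ q_weight n - 1"
  let ?l = "\<lambda>\<nu>. 2 powi (- (int (length \<nu> + delta \<nu>) div 2)) :: K"
  let ?P = "\<Prod>j\<in>Poly_Mapping.keys \<alpha>. qf.Mser ?b $ Poly_Mapping.lookup \<alpha> j"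
  let ?r = "(1 / (qq - 1)) ^ card (Poly_Mapping.keys \<alpha>)"
  have ev: "poly_eval mconst (\<lambda>n. power_sum (q_weight n) (q_minus_1 * alphabet UNIV)) F =
      poly_eval mconst (\<lambda>n. psum (q_weight n) (\<lambda>_. ?b n)) F" for F :: "(nat, K) pl"
    by (simp add: q_weight_def power_sum_q_minus_1_alphabet)
  \<comment> \<open>The one-row functions at (q - 1)X are, up to a scalar, the coefficients of the
    reproducing series for \<open>?b\<close>.\<close>
  have factor: "plethysm (schur_q_tilde k) (q_minus_1 * alphabet UNIV) =
      odd_X (pconst (1 / (qq - 1)) * qf.Mser ?b $ k)" for k
  proof -
    interpret R: comm_ring_hom "qf.rescale ?b" by (rule qf.comm_ring_hom_rescale)
    have "schur_q_tilde k = odd_X (pconst (1 / (qq - 1)) * qf.Mser (\<lambda>_. 1) $ k)"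
      by (simp add: schur_q_tilde_def schur_q_eq odd_X.hom_mult qf.mz_def)
    then have "plethysm (schur_q_tilde k) (q_minus_1 * alphabet UNIV) =
        odd_X (qf.rescale ?b (pconst (1 / (qq - 1)) * qf.Mser (\<lambda>_. 1) $ k))"
      by (simp add: plethysm_odd_X ev qf.poly_eval_rescale flip: odd_X_def)
    moreover have "qf.rescale ?b (pconst c) = pconst c" for c
      by (simp add: qf.rescale_def poly_eval_pconst[OF comm_ring_hom_pconst])
    ultimately show ?thesis
      by (simp only: R.hom_mult qf.rescale_Mser)
  qed
  have "HC_zeta \<alpha> \<nu> = expansion_coeff strict_partitions (\<lambda>\<nu>. mconst (?l \<nu>) * odd_X (Q_poly \<nu>))
      (odd_X (pconst ?r * ?P)) \<nu>"
    unfolding HC_zeta_def factor schur_Q_eq odd_X.hom_prod[symmetric] prod.distrib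
    by (simp only: prod_constant pconst.hom_power)
  also have "\<dots> = qf.B (pconst ?r * ?P) (Q_poly \<nu>) / (qf.B (Q_poly \<nu>) (Q_poly \<nu>) * ?l \<nu>)"
    using \<nu> odd_X_injective
    by (intro expansion_coeff_orthogonal[OF qf.weights_axioms comm_ring_hom_odd_X])
       (simp_all add: Q_poly_orthogonal Q_poly_spanning)
  also have "qf.B (pconst ?r * ?P) (Q_poly \<nu>) = ?r * mcoeff (plethysm (schur_Q \<nu>) (q_minus_1 * alphabet UNIV)) \<alpha>"
    using qf.reproducing_Mser[of "\<lambda>_. ?b" "Q_poly \<nu>" \<alpha>]
    by (simp add: form_pconst_mult_left schur_Q_eq plethysm_odd_X ev)
  finally have zeta: "(qq - 1) ^ card (Poly_Mapping.keys \<alpha>) * HC_zeta \<alpha> \<nu> =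
      mcoeff (plethysm (schur_Q \<nu>) (q_minus_1 * alphabet UNIV)) \<alpha> / (2 ^ length \<nu> * ?l \<nu>)"
    using \<nu> by (simp add: Q_poly_orthogonal power_divide)
  \<comment> \<open>The square norm \<open>2 ^ length \<nu>\<close> and the normalisation
    \<open>?l \<nu>\<close> combine to the constant; \<open>length \<nu> + delta \<nu>\<close> is
    even, so both divisions by 2 are exact.\<close>
  have "2 powi ((- int (length \<nu>) + int (delta \<nu>)) div 2) = 1 / (2 ^ length \<nu> * ?l \<nu>)"
  proof -
    have "even (length \<nu> + delta \<nu>)"
      by (auto simp: delta_def)
    then obtain h where h: "length \<nu> + delta \<nu> = 2 * h" by blast
    then have 1: "(- int (length \<nu>) + int (delta \<nu>)) div 2 = int h - int (length \<nu>)"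
      by linarith
    have 2: "int (length \<nu> + delta \<nu>) div 2 = int h"
      using h by simp
    show ?thesis
      unfolding 1 2 by (simp add: power_int_diff power_int_minus field_simps)
  qed
  then show "mcoeff (HC_G \<nu>) \<alpha> = mcoeff (mconst (2 powi ((- int (length \<nu>) + int (delta \<nu>)) div 2)) *
      plethysm (schur_Q \<nu>) (q_minus_1 * alphabet UNIV)) \<alpha>"
    by (simp add: HC_G_def zeta)
qed


section \<open>Rook monoid algebras\<close>

definition in_var :: "nat \<Rightarrow> K fps \<Rightarrow> (nat, K) mfps" where
  "in_var j f = Abs_mfps (\<lambda>\<alpha>. if Poly_Mapping.keys \<alpha> \<subseteq> {j} then f $ Poly_Mapping.lookup \<alpha> j else 0)"

lemma keys_subset_single: "Poly_Mapping.keys \<alpha> \<subseteq> {j} \<longleftrightarrow> \<alpha> = Poly_Mapping.single j (Poly_Mapping.lookup \<alpha> j)"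
proof
  assume "Poly_Mapping.keys \<alpha> \<subseteq> {j}"
  then show "\<alpha> = Poly_Mapping.single j (Poly_Mapping.lookup \<alpha> j)"
    by (intro poly_mapping_eqI) (auto simp: lookup_single when_def in_keys_iff)
next
  assume "\<alpha> = Poly_Mapping.single j (Poly_Mapping.lookup \<alpha> j)"
  then show "Poly_Mapping.keys \<alpha> \<subseteq> {j}"
    by (metis keys_single empty_subsetI order_refl)
qed

lemma mcoeff_in_var_mult:
  "mcoeff (in_var j f * h) \<alpha> = (\<Sum>k\<le>Poly_Mapping.lookup \<alpha> j. f $ k * mcoeff h (\<alpha> - Poly_Mapping.single j k))"
proof -
  have "mcoeff (in_var j f * h) \<alpha> = (\<Sum>k\<le>Poly_Mapping.lookup \<alpha> j.
      mcoeff (in_var j f) (Poly_Mapping.single j k) * mcoeff h (\<alpha> - Poly_Mapping.single j k))"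
  proof (rule mcoeff_mult_sparse)
    show "inj_on (Poly_Mapping.single j) {..Poly_Mapping.lookup \<alpha> j}"
      by (auto intro: inj_on_subset)
    show "Poly_Mapping.single j k + (\<alpha> - Poly_Mapping.single j k) = \<alpha>" if "k \<in> {..Poly_Mapping.lookup \<alpha> j}" for k
      using that by (intro poly_mapping_eqI) (auto simp: lookup_add lookup_minus lookup_single when_def)
    fix \<beta> \<gamma> assume "\<beta> + \<gamma> = \<alpha>" "mcoeff (in_var j f) \<beta> \<noteq> 0"
    then have "\<beta> = Poly_Mapping.single j (Poly_Mapping.lookup \<beta> j)" "Poly_Mapping.lookup \<beta> j \<le> Poly_Mapping.lookup \<alpha> j"
      by (auto simp: in_var_def keys_subset_single lookup_add split: if_splits)
    then show "\<beta> \<in> Poly_Mapping.single j ` {..Poly_Mapping.lookup \<alpha> j}"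
      by auto
  qed simp
  moreover have "mcoeff (in_var j f) (Poly_Mapping.single j k) = f $ k" for k
    by (auto simp: in_var_def)
  ultimately show ?thesis by simp
qed

lemma in_var_mult: "in_var j f * in_var j h = in_var j (f * h)"
proof (rule mfps_eqI)
  fix \<alpha> :: "nat \<Rightarrow>\<^sub>0 nat"
  have "Poly_Mapping.keys (\<alpha> - Poly_Mapping.single j k) \<subseteq> {j} \<longleftrightarrow> Poly_Mapping.keys \<alpha> \<subseteq> {j}" for k
    by (auto simp: subset_iff in_keys_iff lookup_minus lookup_single when_def)
  then show "mcoeff (in_var j f * in_var j h) \<alpha> = mcoeff (in_var j (f * h)) \<alpha>"
    unfolding mcoeff_in_var_mult
    by (simp add: in_var_def fps_mult_nth atMost_atLeast0 lookup_minus)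
qed

lemma in_var_linear: "in_var j (1 - fps_const c * fps_X) = 1 - mconst c * mvar j"
proof (rule mfps_eqI)
  fix \<alpha>
  have zero: "Poly_Mapping.single j n = 0 \<longleftrightarrow> n = 0" for n :: nat
    by (metis single_zero lookup_single_eq lookup_zero)
  show "mcoeff (in_var j (1 - fps_const c * fps_X)) \<alpha> = mcoeff (1 - mconst c * mvar j) \<alpha>"
  proof (cases "Poly_Mapping.keys \<alpha> \<subseteq> {j}")
    case True
    define n where "n = Poly_Mapping.lookup \<alpha> j"
    have n: "\<alpha> = Poly_Mapping.single j n"
      using True unfolding n_def keys_subset_single .
    have "Poly_Mapping.single j n = Poly_Mapping.single j (Suc 0) \<longleftrightarrow> n = 1"
      by (metis One_nat_def lookup_single_eq)
    then show ?thesis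
      by (simp add: n in_var_def mcoeff_1 mvar_def zero fps_X_def)
  next
    case False
    then have "\<alpha> \<noteq> 0" "\<alpha> \<noteq> Poly_Mapping.single j 1" by auto
    then show ?thesis
      using False by (simp add: in_var_def mcoeff_1 mvar_def)
  qed
qed

text \<open>The series (1 - z) / (1 - q z), written as an exponential for comparison with constant
  terms of exponentials.\<close>

definition rook_series :: "K fps" where
  "rook_series = kexp.fexp (Abs_fps (\<lambda>k. qq ^ Suc k - 1))"

lemma rook_factor: "(1 - mvar j) * recip (1 - mconst qq * mvar j) = in_var j rook_series"
proof -
  have rs: "rook_series * (1 - fps_const qq * fps_X) = 1 - fps_X"
    using kexp.fexp_geometric_diff[of qq 1] by (simp add: rook_series_def)
  let ?inv = "inverse (1 - fps_const qq * fps_X :: K fps)"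
  have inv: "(1 - fps_const qq * fps_X) * ?inv = 1"
    by (rule inverse_mult_eq_1') simp
  have one: "in_var j 1 = 1"
    using in_var_linear[of j 0] by simp
  have "recip (1 - mconst qq * mvar j) = in_var j ?inv"
    by (rule recip_eqI) (simp add: in_var_linear[symmetric] in_var_mult inv one)
  moreover have "1 - mvar j = in_var j (1 - fps_X)"
    using in_var_linear[of j 1] by simp
  moreover have "(1 - fps_X) * ?inv = rook_series"
    unfolding rs[symmetric] mult.assoc inv by simp
  ultimately show ?thesis by (simp add: in_var_mult)
qed

lemma mcoeff_prod_in_var:
  assumes "f $ 0 = 1"
  shows "mcoeff (\<Prod>j<n. in_var j f) \<alpha> =
    (if Poly_Mapping.keys \<alpha> \<subseteq> {..<n} then \<Prod>j\<in>Poly_Mapping.keys \<alpha>. f $ Poly_Mapping.lookup \<alpha> j else 0)"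
proof (induction n arbitrary: \<alpha>)
  case 0
  then show ?case by (auto simp: mcoeff_1)
next
  case (Suc n)
  let ?a = "Poly_Mapping.lookup \<alpha> n"
  let ?r = "\<alpha> - Poly_Mapping.single n ?a"
  have "mcoeff (\<Prod>j<Suc n. in_var j f) \<alpha> = mcoeff (in_var n f * (\<Prod>j<n. in_var j f)) \<alpha>"
    by (simp add: mult.commute)
  also have "\<dots> = (\<Sum>k\<le>?a. f $ k * mcoeff (\<Prod>j<n. in_var j f) (\<alpha> - Poly_Mapping.single n k))"
    by (rule mcoeff_in_var_mult)
  also have "\<dots> = (\<Sum>k\<in>{?a}. f $ k * mcoeff (\<Prod>j<n. in_var j f) (\<alpha> - Poly_Mapping.single n k))"
  proof (rule sum.mono_neutral_right)
    show "\<forall>k\<in>{..?a} - {?a}. f $ k * mcoeff (\<Prod>j<n. in_var j f) (\<alpha> - Poly_Mapping.single n k) = 0"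
    proof
      fix k assume "k \<in> {..?a} - {?a}"
      then have "n \<in> Poly_Mapping.keys (\<alpha> - Poly_Mapping.single n k)"
        by (auto simp: in_keys_iff lookup_minus)
      then show "f $ k * mcoeff (\<Prod>j<n. in_var j f) (\<alpha> - Poly_Mapping.single n k) = 0"
        unfolding Suc by auto
    qed
  qed auto
  also have "\<dots> = f $ ?a * mcoeff (\<Prod>j<n. in_var j f) ?r"
    by simp
  also have "\<dots> = (if Poly_Mapping.keys \<alpha> \<subseteq> {..<Suc n} then \<Prod>j\<in>Poly_Mapping.keys \<alpha>. f $ Poly_Mapping.lookup \<alpha> j else 0)"
  proof -
    have keys: "Poly_Mapping.keys ?r = Poly_Mapping.keys \<alpha> - {n}"
      by (auto simp: in_keys_iff lookup_minus lookup_single when_def split: if_splits)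
    have "(\<Prod>j\<in>Poly_Mapping.keys \<alpha> - {n}. f $ Poly_Mapping.lookup ?r j) = (\<Prod>j\<in>Poly_Mapping.keys \<alpha> - {n}. f $ Poly_Mapping.lookup \<alpha> j)"
      by (intro prod.cong) (auto simp: lookup_minus lookup_single when_def)
    moreover have "f $ ?a * (\<Prod>j\<in>Poly_Mapping.keys \<alpha> - {n}. f $ Poly_Mapping.lookup \<alpha> j) =
        (\<Prod>j\<in>Poly_Mapping.keys \<alpha>. f $ Poly_Mapping.lookup \<alpha> j)"
      using assms by (cases "n \<in> Poly_Mapping.keys \<alpha>") (auto simp: prod.remove in_keys_iff)
    moreover have "Poly_Mapping.keys \<alpha> - {n} \<subseteq> {..<n} \<longleftrightarrow> Poly_Mapping.keys \<alpha> \<subseteq> {..<Suc n}"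
      by (auto simp: less_Suc_eq)
    ultimately show ?thesis
      unfolding Suc keys by simp
  qed
  finally show ?case .
qed

text \<open>The coefficients of the infinite product factor over the variables, as
  \<open>reproducing\<close> demands of \<sigma>.\<close>

lemma mcoeff_sigma_Z: "mcoeff sigma_Z \<alpha> = (\<Prod>j\<in>Poly_Mapping.keys \<alpha>. rook_series $ Poly_Mapping.lookup \<alpha> j)"
proof -
  let ?f = "Abs_mfps (\<lambda>\<alpha>. \<Prod>j\<in>Poly_Mapping.keys \<alpha>. rook_series $ Poly_Mapping.lookup \<alpha> j)"
  have "stable_limit (\<lambda>n. \<Prod>j<n. in_var j rook_series) ?f"
    unfolding stable_limit_def
  proof
    fix \<mu> :: "nat \<Rightarrow>\<^sub>0 nat"
    obtain N where N: "Poly_Mapping.keys \<mu> \<subseteq> {..<N}"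
      using finite_nat_iff_bounded[of "Poly_Mapping.keys \<mu>"] by auto
    have "\<forall>\<^sub>F n in sequentially. N \<le> n" by (rule eventually_ge_at_top)
    then show "\<forall>\<^sub>F n in sequentially. mcoeff (\<Prod>j<n. in_var j rook_series) \<mu> = mcoeff ?f \<mu>"
    proof eventually_elim
      case (elim n)
      then have "Poly_Mapping.keys \<mu> \<subseteq> {..<n}" using N by auto
      then show ?case by (simp add: mcoeff_prod_in_var rook_series_def)
    qed
  qed
  then have "sigma_Z = ?f"
    unfolding sigma_Z_def rook_factor by (rule mlim_eqI)
  then have "mcoeff sigma_Z \<alpha> = mcoeff ?f \<alpha>"
    by (rule arg_cong)
  then show ?thesis unfolding mcoeff_Abs .
qed

text \<open>The function q^k q_k[1 + X; 1/q]: the power sums of 1 + X are \<open>1 + pvar i\<close>,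
  and q^k turns 1 - q^(-n) into q^n - 1.\<close>

definition rook_poly :: "nat \<Rightarrow> (nat, K) pl" where
  "rook_poly k = pexp.fexp (Abs_fps (\<lambda>i. pconst (qq ^ Suc i - 1) * (1 + pvar i))) $ k"

lemma rook_poly_plethysm:
  "mconst (qq ^ k) * plethysm (hall_littlewood_q (1 / qq) k) (1 + alphabet UNIV) = at_X (rook_poly k)"
proof -
  let ?t = "poly_eval pconst (\<lambda>n. 1 + pvar n) :: (nat, K) pl \<Rightarrow> (nat, K) pl"
  have t: "comm_ring_hom ?t" by (rule comm_ring_hom_poly_eval[OF comm_ring_hom_pconst])
  interpret t: comm_ring_hom ?t by (rule t)
  let ?A = "Abs_fps (\<lambda>i. pconst (1 - (1 / qq) ^ Suc i) * (1 + pvar i)) :: (nat, K) pl fps"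
  have "plethysm (hall_littlewood_q (1 / qq) k) (1 + alphabet UNIV) = at_X (?t (hl_poly (1 / qq) k))"
    unfolding hall_littlewood_q_eq plethysm_at_X power_sum_one_plus_alphabet
    by (subst poly_eval_comp[OF comm_ring_hom_at_X comm_ring_hom_pconst])
       (simp add: o_def at_X.hom_add)
  also have "?t (hl_poly (1 / qq) k) = pexp.fexp ?A $ k"
    unfolding hl_poly_def
    by (rule fexp_hom[OF rat_algebra_pconst rat_algebra_pconst t])
       (simp_all add: t.hom_mult poly_eval_pconst[OF comm_ring_hom_pconst] poly_eval_pvar[OF comm_ring_hom_pconst]
          del: power_Suc)
  finally have "mconst (qq ^ k) * plethysm (hall_littlewood_q (1 / qq) k) (1 + alphabet UNIV) =
      at_X (pconst qq ^ k * pexp.fexp ?A $ k)"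
    by (simp add: at_X.hom_mult at_X.hom_power mconst.hom_power)
  also have "pconst qq ^ k * pexp.fexp ?A $ k = rook_poly k"
  proof -
    have "(pconst qq :: (nat, K) pl) ^ Suc i * (pconst (1 - (1 / qq) ^ Suc i) * (1 + pvar i)) =
        pconst (qq ^ Suc i - 1) * (1 + pvar i)" for i
    proof -
      have "qq ^ Suc i * (1 - (1 / qq) ^ Suc i) = qq ^ Suc i - 1"
        by (simp add: right_diff_distrib power_divide del: power_Suc)
      then show ?thesis
        by (simp only: mult.assoc[symmetric] pconst.hom_power[symmetric] pconst.hom_mult[symmetric])
    qed
    then show ?thesis
      unfolding rook_poly_def pexp.fexp_scale[symmetric] by (simp only: fps_nth_Abs_fps)
  qed
  finally show ?thesis .
qed

text \<open>Setting the power sums of X to 0 leaves the alphabet 1, whose series is one factor of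
  \<open>sigma_Z\<close>.\<close>

lemma lookup_rook_poly_0: "Poly_Mapping.lookup (rook_poly k) 0 = rook_series $ k"
  unfolding rook_poly_def rook_series_def
  by (rule fexp_hom[OF rat_algebra_pconst rat_algebra_id comm_ring_hom_lookup_0])
     (simp_all add: lookup_pconst lookup_add lookup_pvar_0 del: power_Suc)

theorem rook_part:
  assumes \<pi>: "\<pi> \<in> partitions"
  shows "rook_G \<pi> = sigma_Z * plethysm (schur \<pi>) (q_minus_1 * alphabet UNIV)"
proof (rule mfps_eqI)
  fix \<alpha> :: "nat \<Rightarrow>\<^sub>0 nat"
  let ?b = "\<lambda>n. qq ^ Suc n - 1"
  let ?P = "\<Prod>j\<in>Poly_Mapping.keys \<alpha>. rook_poly (Poly_Mapping.lookup \<alpha> j)"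
  let ?x = "(qq - 1) ^ card (Poly_Mapping.keys \<alpha>)"
  have "mconst (qq ^ (\<Sum>j\<in>Poly_Mapping.keys \<alpha>. Poly_Mapping.lookup \<alpha> j)) *
      (\<Prod>j\<in>Poly_Mapping.keys \<alpha>. plethysm (hall_littlewood_q (1 / qq) (Poly_Mapping.lookup \<alpha> j)) (1 + alphabet UNIV)) =
      at_X ?P"
    by (simp add: at_X.hom_prod power_sum mconst.hom_prod prod.distrib[symmetric] rook_poly_plethysm)
  then have "rook_Upsilon \<alpha> \<pi> = expansion_coeff partitions (\<lambda>\<pi>. mconst ?x * at_X (schur_poly \<pi>)) (at_X ?P) \<pi>"
    by (simp add: rook_Upsilon_def schur_eq)
  also have "\<dots> = hall.B ?P (schur_poly \<pi>) / (hall.B (schur_poly \<pi>) (schur_poly \<pi>) * ?x)"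
    using \<pi> at_X_injective[of _ 0]
    by (intro expansion_coeff_orthogonal[OF hall.weights_axioms comm_ring_hom_at_X])
       (simp_all add: schur_poly_orthonormal schur_poly_spanning)
  finally have upsilon: "?x * rook_Upsilon \<alpha> \<pi> = hall.B ?P (schur_poly \<pi>)"
    using \<pi> by (simp add: schur_poly_orthonormal)
  have "hall.B ?P (schur_poly \<pi>) =
      mcoeff (sigma_Z * poly_eval mconst (\<lambda>i. psum (Suc i) (\<lambda>v. ?b i)) (schur_poly \<pi>)) \<alpha>"
  \<comment> \<open>\<open>rook_poly\<close> has derivatives like those of \<open>Mser\<close> but
    nonzero constant terms, hence the general form with \<sigma>.\<close>
  proof (rule hall.reproducing[symmetric])
    show "rook_poly 0 = 1" by (simp add: rook_poly_def)
    show "mcoeff sigma_Z \<alpha> = (\<Prod>v\<in>Poly_Mapping.keys \<alpha>. Poly_Mapping.lookup (rook_poly (Poly_Mapping.lookup \<alpha> v)) 0)" for \<alpha>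
      by (simp add: mcoeff_sigma_Z lookup_rook_poly_0)
    show "pconst (hall_norm i) * pdiff i (rook_poly k) = (if Suc i \<le> k then pconst (?b i) * rook_poly (k - Suc i) else 0)"
      for i k and v :: nat
      unfolding rook_poly_def
      by (rule hall.pdiff_fexp) (simp add: pdiff_mult hall_norm_def del: of_nat_Suc power_Suc)
  qed
  then show "mcoeff (rook_G \<pi>) \<alpha> = mcoeff (sigma_Z * plethysm (schur \<pi>) (q_minus_1 * alphabet UNIV)) \<alpha>"
    by (simp add: rook_G_def upsilon schur_eq plethysm_at_X power_sum_q_minus_1_alphabet)
qed


section \<open>Several alphabets\<close>

text \<open>The variable \<open>(r, n)\<close> stands for p_(n+1) of alphabet
  \<open>r\<close>.\<close>

interpretation ak: weights "\<lambda>p :: nat \<times> nat. Suc (snd p)" "\<lambda>p. hall_norm (snd p) :: K"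
  by unfold_locales (simp_all add: hall_norm_def del: of_nat_Suc)

definition incl :: "nat \<Rightarrow> (nat, K) pl \<Rightarrow> (nat \<times> nat, K) pl" where
  "incl r = poly_eval pconst (\<lambda>n. pvar (r, n))"

lemma comm_ring_hom_incl: "comm_ring_hom (incl r)"
  unfolding incl_def by (rule comm_ring_hom_poly_eval[OF comm_ring_hom_pconst])

interpretation incl: comm_ring_hom "incl r"
  by (rule comm_ring_hom_incl)

lemma incl_pconst [simp]: "incl r (pconst c) = pconst c"
  by (simp add: incl_def poly_eval_pconst[OF comm_ring_hom_pconst])

lemma incl_pvar [simp]: "incl r (pvar n) = pvar (r, n)"
  by (simp add: incl_def poly_eval_pvar[OF comm_ring_hom_pconst])

lemma pdiff_incl: "pdiff (s, n) (incl r F) = (if s = r then incl r (pdiff n F) else 0)"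
  by (induction F rule: pl_induct) (auto simp: incl.hom_add incl.hom_mult pdiff_mult)

text \<open>Polynomials in one alphabet and polynomials free of it behave like factors of an
  orthogonal tensor product; the vanishing derivatives express freeness.\<close>

lemma form_incl_mult:
  assumes A: "\<And>n. pdiff (r, n) A = 0" and C: "\<And>n. pdiff (r, n) C = 0"
  shows "ak.B (incl r F * A) (incl r G * C) = hall.B F G * ak.B A C"
proof (induction F arbitrary: G rule: pl_induct)
  case (const c)
  have "ak.B A (incl r G * C) = Poly_Mapping.lookup G 0 * ak.B A C"
  proof (induction G rule: pl_induct)
    case (const d)
    then show ?case by (simp add: form_pconst_mult_right lookup_pconst)
  next
    case (add G H)
    then show ?case by (simp add: incl.hom_add distrib_right form_add_right lookup_add)
  next
    case (var n G)
    then show ?case by (simp add: incl.hom_mult mult.assoc form_pvar_mult_right A lookup_pvar_mult)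
  qed
  then show ?case
    by (simp add: form_pconst_mult_left form_commute[of _ "pconst c"])
next
  case (add F H)
  then show ?case by (simp add: incl.hom_add distrib_right form_add_left)
next
  case (var n F)
  then show ?case
    by (simp add: incl.hom_mult mult.assoc form_pvar_mult_left pdiff_mult pdiff_incl C)
qed

lemma form_incl_prod:
  "finite R \<Longrightarrow> ak.B (\<Prod>r\<in>R. incl r (F r)) (\<Prod>r\<in>R. incl r (G r)) = (\<Prod>r\<in>R. hall.B (F r) (G r))"
proof (induction R rule: finite_induct)
  case (insert r R)
  have "pdiff (r, n) (\<Prod>s\<in>R. incl s (H s)) = 0" for n H
    using insert.hyps by (simp add: pdiff_prod pdiff_incl) (intro sum.neutral, auto)
  then show ?case
    using insert by (simp add: form_incl_mult)
qed simp

definition multi_poly :: "nat \<Rightarrow> (nat \<Rightarrow> nat list) \<Rightarrow> (nat \<times> nat, K) pl" where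
  "multi_poly m \<Lambda> = (\<Prod>r=1..m. incl r (schur_poly (\<Lambda> r)))"

lemma multi_poly_orthonormal:
  assumes "\<Lambda> \<in> multipartitions m" "\<Lambda>' \<in> multipartitions m"
  shows "ak.B (multi_poly m \<Lambda>) (multi_poly m \<Lambda>') = (if \<Lambda> = \<Lambda>' then 1 else 0)"
proof -
  have "ak.B (multi_poly m \<Lambda>) (multi_poly m \<Lambda>') = (\<Prod>r=1..m. if \<Lambda> r = \<Lambda>' r then 1 else 0)"
    unfolding multi_poly_def form_incl_prod[OF finite_atLeastAtMost]
    using assms by (intro prod.cong) (auto simp: multipartitions_def schur_poly_orthonormal)
  also have "\<dots> = (if \<Lambda> = \<Lambda>' then 1 else 0)"
  proof (cases "\<Lambda> = \<Lambda>'")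
    case False
    then obtain r where "\<Lambda> r \<noteq> \<Lambda>' r" by blast
    moreover have "r \<in> {1..m}"
    proof (rule ccontr)
      assume "r \<notin> {1..m}"
      then have "\<Lambda> r = []" "\<Lambda>' r = []"
        using assms unfolding multipartitions_def by blast+
      then show False using \<open>\<Lambda> r \<noteq> \<Lambda>' r\<close> by simp
    qed
    ultimately have "\<exists>r\<in>{1..m}. (if \<Lambda> r = \<Lambda>' r then 1 else 0 :: K) = 0"
      by auto
    then have "(\<Prod>r=1..m. if \<Lambda> r = \<Lambda>' r then 1 else 0 :: K) = 0"
      by (intro prod_zero) auto
    then show ?thesis using False by simp
  qed simp
  finally show ?thesis .
qed

text \<open>Only the factor of alphabet \<open>r\<close> is expanded again in Schur functions, so
  just one partition of \<Lambda> is replaced.\<close>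

lemma incl_mult_lspan:
  assumes r: "r \<in> {1..m}" and F: "F \<in> lspan (multipartitions m) (multi_poly m)"
  shows "incl r H * F \<in> lspan (multipartitions m) (multi_poly m)"
  using F
proof (induction F rule: lspan_induct)
  case (base \<Lambda>)
  let ?rest = "\<Prod>s\<in>{1..m} - {r}. incl s (schur_poly (\<Lambda> s))"
  have split: "multi_poly m \<Lambda>' = incl r (schur_poly (\<Lambda>' r)) * (\<Prod>s\<in>{1..m} - {r}. incl s (schur_poly (\<Lambda>' s)))" for \<Lambda>'
    unfolding multi_poly_def using r by (subst prod.remove[of _ r]) auto
  have "incl r G * ?rest \<in> lspan (multipartitions m) (multi_poly m)" if "G \<in> lspan partitions schur_poly" for G
    using that
  proof (induction G rule: lspan_induct)
    case (base \<pi>)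
    have "\<Lambda>(r := \<pi>) \<in> multipartitions m"
      using \<open>\<Lambda> \<in> multipartitions m\<close> base r by (auto simp: multipartitions_def)
    moreover have "multi_poly m (\<Lambda>(r := \<pi>)) = incl r (schur_poly \<pi>) * ?rest"
      unfolding split by (intro arg_cong2[of _ _ _ _ "(*)"] prod.cong) auto
    ultimately show ?case
      by (metis lspan_base)
  qed (simp_all add: lspan_zero lspan_add lspan_scale incl.hom_add incl.hom_mult distrib_right mult.assoc)
  then have "incl r (H * schur_poly (\<Lambda> r)) * ?rest \<in> lspan (multipartitions m) (multi_poly m)"
    using schur_poly_spanning by blast
  then show ?case
    by (simp add: split[of \<Lambda>] incl.hom_mult mult.assoc)
qed (simp_all add: lspan_zero lspan_add lspan_scale distrib_left mult.left_commute[of _ "pconst _"])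

section \<open>Evaluation at several alphabets\<close>

definition multi_X :: "(nat \<times> nat, K) pl \<Rightarrow> (nat \<times> nat, K) mfps" where
  "multi_X = poly_eval mconst (\<lambda>p. psum (Suc (snd p)) (\<lambda>v. if fst v = fst p then 1 else 0))"

lemma comm_ring_hom_multi_X: "comm_ring_hom multi_X"
  unfolding multi_X_def by (rule comm_ring_hom_poly_eval[OF comm_ring_hom_mconst])

interpretation multi_X: comm_ring_hom multi_X
  by (rule comm_ring_hom_multi_X)

lemma multi_X_pconst [simp]: "multi_X (pconst c) = mconst c"
  by (simp add: multi_X_def poly_eval_pconst[OF comm_ring_hom_mconst])

lemma multi_X_injective: "multi_X F = 0 \<Longrightarrow> F = 0"
proof -
  let ?b = "\<lambda>(v :: nat \<times> nat) (p :: nat \<times> nat). if fst v = fst p then 1 else 0 :: K"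
  assume "multi_X F = 0"
  then have zero: "poly_eval mconst (\<lambda>p. psum (Suc (snd p)) (\<lambda>v. ?b v p)) F = 0"
    by (simp only: multi_X_def)
  have adm: "ak.admissible (?b v)" for v
    unfolding ak.admissible_def
  proof
    fix k
    show "finite {p. Suc (snd p) = k \<and> ?b v p \<noteq> 0}"
      by (rule finite_subset[of _ "{fst v} \<times> {..k}"]) auto
  qed
  have sep: "\<exists>c. ak.isolates c p \<and> infinite {v. ?b v = c}" for p
  proof (intro exI conjI)
    \<comment> \<open>\<open>?b v\<close> is the indicator of the alphabet containing
      \<open>v\<close>. It meets each degree in one variable, and every alphabet has infinitely many
      variables.\<close>
    show "ak.isolates (?b p) p"
      by (auto simp: ak.isolates_def prod_eq_iff)
    have "infinite ({fst p} \<times> (UNIV :: nat set))"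
      by (simp add: finite_cartesian_product_iff)
    moreover have "{fst p} \<times> UNIV \<subseteq> {v. ?b v = ?b p}"
      by auto
    ultimately show "infinite {v. ?b v = ?b p}"
      by (rule infinite_super[rotated])
  qed
  show ?thesis
    using ak.poly_eval_psum_injective[OF adm sep zero] .
qed

lemma plethysm_alphabet_at_X: "plethysm (at_X F) (alphabet ({r} \<times> UNIV)) = multi_X (incl r F)"
proof -
  have "multi_X (incl r F) = poly_eval (multi_X \<circ> pconst) (multi_X \<circ> (\<lambda>n. pvar (r, n))) F"
    unfolding incl_def by (rule poly_eval_comp[OF comm_ring_hom_multi_X comm_ring_hom_pconst])
  moreover have "v \<in> {r} \<times> UNIV \<longleftrightarrow> fst v = r" for v :: "nat \<times> nat"
    by (cases v) auto
  ultimately show ?thesis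
    by (simp add: plethysm_at_X power_sum_alphabet o_def multi_X_def poly_eval_pconst[OF comm_ring_hom_mconst]
        poly_eval_pvar[OF comm_ring_hom_mconst])
qed

lemma multi_schur_eq: "multi_schur m \<Lambda> = multi_X (multi_poly m \<Lambda>)"
  by (simp add: multi_schur_def multi_poly_def schur_eq plethysm_alphabet_at_X multi_X.hom_prod)


section \<open>Ariki--Koike algebras\<close>

text \<open>A variable of colour \<kappa> belongs to \<open>AK_Y\<close> exactly for r = 1, ...,
  \<kappa>, hence contributes to the first \<kappa> alphabets.\<close>

definition q_factor :: "nat \<Rightarrow> nat \<Rightarrow> nat \<times> nat \<Rightarrow> K" where
  "q_factor m \<kappa> p = (if 1 \<le> fst p \<and> fst p \<le> \<kappa> then qq ^ Suc (snd p) - 1 else 0)"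

text \<open>The function q^k q_k(X; 1/q), which is h_k[(q - 1)X].\<close>

definition q_one_row :: "nat \<Rightarrow> (nat, K) pl" where
  "q_one_row k = pexp.fexp (Abs_fps (\<lambda>i. pconst (qq ^ Suc i - 1) * pvar i)) $ k"

lemma q_one_row_0 [simp]: "q_one_row 0 = 1"
  by (simp add: q_one_row_def)

lemma q_one_row_eq: "pconst (qq ^ k) * hl_poly (1 / qq) k = q_one_row k"
proof -
  have "(pconst qq :: (nat, K) pl) ^ Suc i * (pconst (1 - (1 / qq) ^ Suc i) * pvar i) =
      pconst (qq ^ Suc i - 1) * pvar i" for i
  proof -
    have "qq ^ Suc i * (1 - (1 / qq) ^ Suc i) = qq ^ Suc i - 1"
      by (simp add: right_diff_distrib power_divide del: power_Suc)
    then show ?thesis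
      by (simp only: mult.assoc[symmetric] pconst.hom_power[symmetric] pconst.hom_mult[symmetric])
  qed
  then show ?thesis
    unfolding q_one_row_def hl_poly_def pconst.hom_power pexp.fexp_scale[symmetric] by (simp only: fps_nth_Abs_fps)
qed

lemma admissible_q_factor: "ak.admissible (q_factor m \<kappa>)"
  unfolding ak.admissible_def
proof
  fix k
  show "finite {p. Suc (snd p) = k \<and> q_factor m \<kappa> p \<noteq> 0}"
    by (rule finite_subset[of _ "{1..\<kappa>} \<times> {..k}"]) (auto simp: q_factor_def split: if_splits)
qed

text \<open>The logarithmic derivative is a sum over the first \<kappa> alphabets, so the
  exponential is a product and its coefficients are sums over compositions.\<close>

lemma Mser_q_factor: "ak.Mser (q_factor m \<kappa>) $ a = (\<Sum>c\<in>weak_comps {1..\<kappa>} a. \<Prod>r=1..\<kappa>. incl r (q_one_row (c r)))"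
proof -
  let ?A = "\<lambda>r. Abs_fps (\<lambda>i. pconst (qq ^ Suc i - 1) * pvar (r, i)) :: (nat \<times> nat, K) pl fps"
  have "ak.logder (q_factor m \<kappa>) = (\<Sum>r=1..\<kappa>. ?A r)"
  proof (rule fps_ext)
    fix i
    have "ak.logder (q_factor m \<kappa>) $ i = (\<Sum>p | Suc (snd p) = Suc i \<and> q_factor m \<kappa> p \<noteq> 0.
        pconst (q_factor m \<kappa> p) * pvar p)"
      unfolding ak.logder_def fps_nth_Abs_fps
      by (intro sum.cong) (auto simp: hall_norm_def simp del: of_nat_Suc)
    also have "\<dots> = (\<Sum>p\<in>(\<lambda>r. (r, i)) ` {1..\<kappa>}. pconst (q_factor m \<kappa> p) * pvar p)"
      by (rule sum.mono_neutral_left) (auto simp: q_factor_def split: if_splits)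
    also have "\<dots> = (\<Sum>r=1..\<kappa>. ?A r) $ i"
      by (subst sum.reindex) (auto simp: inj_on_def q_factor_def fps_sum_nth)
    finally show "ak.logder (q_factor m \<kappa>) $ i = (\<Sum>r=1..\<kappa>. ?A r) $ i" .
  qed
  moreover have "pexp.fexp (?A r) $ k = incl r (q_one_row k)" for r k
    unfolding q_one_row_def
    by (rule sym, rule fexp_hom[OF rat_algebra_pconst rat_algebra_pconst comm_ring_hom_incl])
       (simp_all add: incl.hom_mult)
  ultimately show ?thesis
    by (simp add: ak.Mser_def pexp.fexp_sum fps_prod_nth_weak_comps)
qed

text \<open>Telescoping from the top, where the last \<open>AK_b\<close> is
  \<open>uu m ^ (i - 1)\<close> itself.\<close>

lemma sum_AK_b: "1 \<le> M \<Longrightarrow> M \<le> m \<Longrightarrow> (\<Sum>\<kappa>=M..m. AK_b m i \<kappa>) = uu M ^ (i - 1)"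
proof (induction "m - M" arbitrary: M)
  case 0
  then show ?case by (simp add: AK_b_def)
next
  case (Suc d)
  then have "(\<Sum>\<kappa>=M..m. AK_b m i \<kappa>) = AK_b m i M + (\<Sum>\<kappa>=Suc M..m. AK_b m i \<kappa>)"
    by (simp add: sum.atLeast_Suc_atMost)
  also have "(\<Sum>\<kappa>=Suc M..m. AK_b m i \<kappa>) = uu (Suc M) ^ (i - 1)"
    using Suc by (intro Suc(1)) auto
  finally show ?case
    using Suc by (simp add: AK_b_def)
qed

text \<open>By \<open>sum_AK_b\<close> the factor \<open>u\<^bsub>\<kappa>(c)\<^esub>\<^bsup>i-1\<^esup>\<close> of a composition \<open>c\<close> is the sum of the \<open>b\<^sub>k\<close> with \<open>c\<close> supported in \<open>{1..k}\<close>, so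
  the one-row function is a combination of one-row functions of the alphabets \<open>X\<^bsup>(1)\<^esup> + \<dots> + X\<^bsup>(k)\<^esup>\<close>.\<close>

definition AK_poly :: "nat \<Rightarrow> nat \<Rightarrow> nat \<Rightarrow> (nat \<times> nat, K) pl" where
  "AK_poly m i a = (\<Sum>\<kappa>\<in>{0..m}. pconst (AK_b m i \<kappa>) * ak.Mser (q_factor m \<kappa>) $ a)"

text \<open>This is what colour 0 is for: it brings the sum of all \<open>AK_b\<close> to 1 and, as
  \<open>q_factor m 0\<close> vanishes, adds nothing to coefficients with
  \<open>a > 0\<close>.\<close>

lemma AK_poly_0:
  assumes "m \<ge> 1"
  shows "AK_poly m i 0 = 1"
proof -
  have "{0..m} = insert 0 {1..m}" by auto
  then have "(\<Sum>\<kappa>\<in>{0..m}. AK_b m i \<kappa>) = 1"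
    using assms by (simp add: sum_AK_b) (simp add: AK_b_def)
  then show ?thesis
    by (simp add: AK_poly_def flip: pconst.hom_sum)
qed

text \<open>\<open>a > 0\<close> makes the support of a composition nonempty, so that its maximum is
  meaningful.\<close>

lemma AK_q_eq:
  assumes "a > 0"
  shows "AK_q m i a = multi_X (pconst (1 / (qq - 1)) * AK_poly m i a)"
proof -
  let ?M = "\<lambda>c :: nat \<Rightarrow> nat. Max {r. c r \<noteq> 0}"
  let ?p = "\<lambda>c. \<Prod>r=1..m. incl r (q_one_row (c r))"
  \<comment> \<open>Compositions supported in the first \<kappa> alphabets are those with maximum at
    most \<kappa>; for a fixed composition the colours that count thus form a tail, on which the
    \<open>AK_b\<close> telescope.\<close>
  have M: "1 \<le> ?M c \<and> ?M c \<le> m \<and> (\<forall>\<kappa>. c \<in> weak_comps {1..\<kappa>} a \<longleftrightarrow> ?M c \<le> \<kappa>)"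
    if c: "c \<in> weak_comps {1..m} a" for c
  proof -
    have sub: "{r. c r \<noteq> 0} \<subseteq> {1..m}"
      using c by (auto simp: weak_comps_def)
    then have fin: "finite {r. c r \<noteq> 0}"
      by (rule finite_subset) simp
    have ne: "{r. c r \<noteq> 0} \<noteq> {}"
    proof
      assume "{r. c r \<noteq> 0} = {}"
      then have "sum c {1..m} = 0" by auto
      then show False using c assms by (simp add: weak_comps_def)
    qed
    have mem: "c (?M c) \<noteq> 0"
      using Max_in[OF fin ne] by simp
    have "c \<in> weak_comps {1..\<kappa>} a \<longleftrightarrow> {r. c r \<noteq> 0} \<subseteq> {1..\<kappa>}" for \<kappa>
    proof
      assume "{r. c r \<noteq> 0} \<subseteq> {1..\<kappa>}"
      then have "sum c {1..\<kappa>} = sum c {r. c r \<noteq> 0}" "sum c {1..m} = sum c {r. c r \<noteq> 0}"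
        using sub by (auto intro!: sum.mono_neutral_right)
      then show "c \<in> weak_comps {1..\<kappa>} a"
        using c \<open>{r. c r \<noteq> 0} \<subseteq> {1..\<kappa>}\<close> by (auto simp: weak_comps_def)
    qed (auto simp: weak_comps_def)
    moreover have "{r. c r \<noteq> 0} \<subseteq> {1..\<kappa>} \<longleftrightarrow> ?M c \<le> \<kappa>" for \<kappa>
    proof
      assume "{r. c r \<noteq> 0} \<subseteq> {1..\<kappa>}"
      then show "?M c \<le> \<kappa>" using mem by auto
    next
      assume le: "?M c \<le> \<kappa>"
      show "{r. c r \<noteq> 0} \<subseteq> {1..\<kappa>}"
      proof
        fix r assume r: "r \<in> {r. c r \<noteq> 0}"
        then have "r \<le> ?M c" by (rule Max_ge[OF fin])
        then have "r \<le> \<kappa>" using le by (rule order_trans)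
        moreover have "r \<in> {1..m}" using sub r by (rule subsetD)
        ultimately show "r \<in> {1..\<kappa>}" by simp
      qed
    qed
    moreover have "?M c \<in> {1..m}"
      using sub Max_in[OF fin ne] by (rule subsetD)
    ultimately show ?thesis by auto
  qed
  have trunc: "ak.Mser (q_factor m \<kappa>) $ a = (\<Sum>c\<in>weak_comps {1..m} a. if ?M c \<le> \<kappa> then ?p c else 0)"
    if "\<kappa> \<le> m" for \<kappa>
  proof -
    have sub: "weak_comps {1..\<kappa>} a \<subseteq> weak_comps {1..m} a"
    proof
      fix c assume c: "c \<in> weak_comps {1..\<kappa>} a"
      then have "sum c {1..m} = sum c {1..\<kappa>}"
        using that by (intro sum.mono_neutral_right) (auto simp: weak_comps_def)
      then show "c \<in> weak_comps {1..m} a"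
        using c that by (auto simp: weak_comps_def)
    qed
    have "(\<Prod>r=1..\<kappa>. incl r (q_one_row (c r))) = ?p c" if "c \<in> weak_comps {1..\<kappa>} a" for c
      using that \<open>\<kappa> \<le> m\<close> by (intro prod.mono_neutral_left) (auto simp: weak_comps_def)
    then have "ak.Mser (q_factor m \<kappa>) $ a = (\<Sum>c\<in>weak_comps {1..\<kappa>} a. ?p c)"
      by (simp add: Mser_q_factor)
    also have "\<dots> = (\<Sum>c\<in>weak_comps {1..m} a. if ?M c \<le> \<kappa> then ?p c else 0)"
      using sub M by (intro sum.mono_neutral_cong_left) (auto simp: finite_weak_comps)
    finally show ?thesis .
  qed
  have "AK_poly m i a = (\<Sum>\<kappa>\<in>{0..m}. \<Sum>c\<in>weak_comps {1..m} a. pconst (if ?M c \<le> \<kappa> then AK_b m i \<kappa> else 0) * ?p c)"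
    by (auto simp: AK_poly_def trunc sum_distrib_left intro!: sum.cong)
  also have "\<dots> = (\<Sum>c\<in>weak_comps {1..m} a. \<Sum>\<kappa>\<in>{0..m}. pconst (if ?M c \<le> \<kappa> then AK_b m i \<kappa> else 0) * ?p c)"
    by (rule sum.swap)
  also have "\<dots> = (\<Sum>c\<in>weak_comps {1..m} a. pconst (uu (?M c) ^ (i - 1)) * ?p c)"
  proof (rule sum.cong[OF refl])
    fix c assume c: "c \<in> weak_comps {1..m} a"
    have "(\<Sum>\<kappa>\<in>{0..m}. if ?M c \<le> \<kappa> then AK_b m i \<kappa> else 0) = (\<Sum>\<kappa>=?M c..m. AK_b m i \<kappa>)"
      by (rule sum.mono_neutral_cong_right) auto
    then show "(\<Sum>\<kappa>\<in>{0..m}. pconst (if ?M c \<le> \<kappa> then AK_b m i \<kappa> else 0) * ?p c) = pconst (uu (?M c) ^ (i - 1)) * ?p c"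
      using M[OF c] by (simp add: sum_distrib_right[symmetric] pconst.hom_sum[symmetric] sum_AK_b)
  qed
  finally have poly: "AK_poly m i a = (\<Sum>c\<in>weak_comps {1..m} a. pconst (uu (?M c) ^ (i - 1)) * ?p c)" .
  \<comment> \<open>\<open>qq ^ a\<close> splits over the parts of \<open>c\<close>, one power for
    each one-row function.\<close>
  have "mconst (qq ^ a) * (\<Prod>r=1..m. plethysm (hall_littlewood_q (1 / qq) (c r)) (alphabet ({r} \<times> UNIV))) = multi_X (?p c)"
    if "c \<in> weak_comps {1..m} a" for c
  proof -
    have "qq ^ a = (\<Prod>r=1..m. qq ^ c r)"
      using that by (simp add: weak_comps_def power_sum[symmetric])
    moreover have "mconst (qq ^ k) * multi_X (incl r (hl_poly (1 / qq) k)) = multi_X (incl r (q_one_row k))" for r k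
      by (simp add: q_one_row_eq[symmetric] incl.hom_mult multi_X.hom_mult)
    ultimately show ?thesis
      by (simp add: mconst.hom_prod prod.distrib[symmetric] hall_littlewood_q_eq plethysm_alphabet_at_X multi_X.hom_prod)
  qed
  then have "AK_q m i a = mconst (1 / (qq - 1)) * (\<Sum>c\<in>weak_comps {1..m} a.
      mconst (uu (?M c) ^ (i - 1)) * multi_X (?p c))"
    unfolding AK_q_def weak_comps_def[symmetric]
    by (simp add: mconst.hom_mult[of "qq ^ a" "1 / (qq - 1)", simplified] mult.assoc sum_distrib_left
        mult.left_commute[of "mconst (qq ^ a)"])
  then show ?thesis
    by (simp add: poly multi_X.hom_mult multi_X.hom_sum)
qed

lemma AK_chi_eq:
  assumes \<Lambda>: "\<Lambda> \<in> multipartitions m"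
  shows "(qq - 1) ^ card (Poly_Mapping.keys \<alpha>) * AK_chi m \<alpha> \<Lambda> =
    ak.B (\<Prod>v\<in>Poly_Mapping.keys \<alpha>. AK_poly m (fst v) (Poly_Mapping.lookup \<alpha> v)) (multi_poly m \<Lambda>)"
proof -
  let ?V = "lspan (multipartitions m) (multi_poly m)"
  let ?F = "\<Prod>v\<in>Poly_Mapping.keys \<alpha>. pconst (1 / (qq - 1)) * AK_poly m (fst v) (Poly_Mapping.lookup \<alpha> v)"
  \<comment> \<open>The multipliers of the span; they are closed under sums and products, so
    membership is checked factor by factor.\<close>
  define C where "C = {H. \<forall>F\<in>?V. H * F \<in> ?V}"
  have C_mult: "G * H \<in> C" if "G \<in> C" "H \<in> C" for G H
    using that by (simp add: C_def mult.assoc)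
  have C_const: "pconst c \<in> C" for c
    by (simp add: C_def lspan_scale)
  have C_sum: "(\<Sum>x\<in>S. h x) \<in> C" if "\<And>x. x \<in> S \<Longrightarrow> h x \<in> C" for S :: "'x set" and h
    using that by (auto simp: C_def sum_distrib_right intro: lspan_sum)
  have C_one: "1 \<in> C"
    using C_const[of 1] by simp
  have C_prod: "(\<Prod>x\<in>S. h x) \<in> C" if "\<And>x. x \<in> S \<Longrightarrow> h x \<in> C" for S :: "'x set" and h
    using that by (induction S rule: infinite_finite_induct) (auto simp: C_one C_mult)
  have "AK_poly m i a \<in> C" for i a
    unfolding AK_poly_def Mser_q_factor
    by (intro C_sum C_mult C_const C_prod) (auto simp: C_def incl_mult_lspan)
  then have "?F \<in> C"
    by (intro C_prod C_mult C_const)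
  moreover have "1 \<in> ?V"
  proof -
    have "(\<lambda>_. []) \<in> multipartitions m" "multi_poly m (\<lambda>_. []) = 1"
      by (simp_all add: multipartitions_def multi_poly_def)
    then show ?thesis by (metis lspan_base)
  qed
  ultimately have F: "?F \<in> ?V"
    by (auto simp: C_def)
  have "(\<Prod>(i, j)\<in>Poly_Mapping.keys \<alpha>. AK_q m i (Poly_Mapping.lookup \<alpha> (i, j))) = multi_X ?F"
    unfolding multi_X.hom_prod by (intro prod.cong) (auto simp: AK_q_eq in_keys_iff)
  then have "AK_chi m \<alpha> \<Lambda> = expansion_coeff (multipartitions m) (\<lambda>\<Lambda>. mconst 1 * multi_X (multi_poly m \<Lambda>)) (multi_X ?F) \<Lambda>"
    by (simp add: AK_chi_def multi_schur_eq[abs_def])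
  also have "\<dots> = ak.B ?F (multi_poly m \<Lambda>) / (ak.B (multi_poly m \<Lambda>) (multi_poly m \<Lambda>) * 1)"
    using \<Lambda> multi_X_injective F
    by (intro expansion_coeff_orthogonal[OF ak.weights_axioms comm_ring_hom_multi_X])
       (simp_all add: multi_poly_orthonormal)
  also have "\<dots> = ak.B ?F (multi_poly m \<Lambda>)"
    using \<Lambda> by (simp add: multi_poly_orthonormal)
  finally have "AK_chi m \<alpha> \<Lambda> = ak.B ?F (multi_poly m \<Lambda>)" .
  then show ?thesis
    by (simp add: prod.distrib form_pconst_mult_left power_divide flip: pconst.hom_power)
qed

lemma AK_Y_eq: "AK_Y m r N \<kappa> = alphabet {v \<in> {1..m} \<times> {..<N}. r \<le> \<kappa> v}"
proof (rule mfps_eqI)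
  fix \<mu> :: "nat \<times> nat \<Rightarrow>\<^sub>0 nat"
  let ?V = "{v \<in> {1..m} \<times> {..<N}. r \<le> \<kappa> v}"
  have fin: "finite ?V" by simp
  have "AK_Y m r N \<kappa> = (\<Sum>v\<in>?V. mvar v)"
    unfolding AK_Y_def by (intro sum.cong) auto
  then have Y: "mcoeff (AK_Y m r N \<kappa>) \<mu> = (\<Sum>v\<in>?V. if \<mu> = Poly_Mapping.single v (Suc 0) then 1 else 0)"
    by (simp add: mcoeff_sum mvar_def)
  show "mcoeff (AK_Y m r N \<kappa>) \<mu> = mcoeff (alphabet ?V) \<mu>"
  proof (cases "\<exists>u. \<mu> = Poly_Mapping.single u (Suc 0)")
    case True
    then obtain u where u: "\<mu> = Poly_Mapping.single u (Suc 0)" by blast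
    have "mcoeff (AK_Y m r N \<kappa>) \<mu> = (\<Sum>v\<in>?V. if u = v then 1 else 0)"
      unfolding Y by (intro sum.cong) (simp_all add: u single_eq_single_iff)
    also have "\<dots> = (if u \<in> ?V then 1 else 0)"
      using fin by (rule sum.delta')
    also have "\<dots> = mcoeff (alphabet ?V) \<mu>"
      unfolding u mcoeff_alphabet_single ..
    finally show ?thesis .
  next
    case False
    then show ?thesis
      unfolding Y by (subst mcoeff_alphabet_other) (auto intro!: sum.neutral)
  qed
qed

text \<open>\<open>reproducing_Mser\<close> turns every colouring in the formula into a pairing. On
  the character side the product of the \<open>AK_poly\<close>, each a sum over colours, expands by
  distributivity into the same sum over colourings.\<close>

lemma mcoeff_AK_formula:
  assumes \<Lambda>: "\<Lambda> \<in> multipartitions m" and m: "m \<ge> 1"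
  shows "mcoeff (AK_formula m N \<Lambda>) \<alpha> = (if Poly_Mapping.keys \<alpha> \<subseteq> {1..m} \<times> {..<N} then
    (qq - 1) ^ card (Poly_Mapping.keys \<alpha>) * AK_chi m \<alpha> \<Lambda> else 0)"
proof -
  let ?box = "{1..m} \<times> {..<N}"
  let ?K = "?box \<rightarrow>\<^sub>E {0..m}"
  \<comment> \<open>Weight 0 outside the box sets those variables to 0: their series is 1 and has no
    higher coefficients.\<close>
  define b where "b \<kappa> v = (if v \<in> ?box then q_factor m (\<kappa> v) else (\<lambda>_. 0))" for \<kappa> v
  have adm: "ak.admissible (b \<kappa> v)" for \<kappa> v
    by (simp add: b_def admissible_q_factor) (simp add: ak.admissible_def)
  have pleth: "(\<Prod>r=1..m. plethysm (schur (\<Lambda> r)) (q_minus_1 * AK_Y m r N \<kappa>)) =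
      poly_eval mconst (\<lambda>p. psum (Suc (snd p)) (\<lambda>v. b \<kappa> v p)) (multi_poly m \<Lambda>)" for \<kappa>
  proof -
    let ?h = "poly_eval mconst (\<lambda>p. psum (Suc (snd p)) (\<lambda>v. b \<kappa> v p))"
    have h: "comm_ring_hom ?h" by (rule comm_ring_hom_poly_eval[OF comm_ring_hom_mconst])
    interpret h: comm_ring_hom ?h by (rule h)
    have "plethysm (schur (\<Lambda> r)) (q_minus_1 * AK_Y m r N \<kappa>) = ?h (incl r (schur_poly (\<Lambda> r)))" if r: "r \<in> {1..m}" for r
    proof -
      have "?h (incl r F) = poly_eval (?h \<circ> pconst) (?h \<circ> (\<lambda>n. pvar (r, n))) F" for F
        unfolding incl_def by (rule poly_eval_comp[OF h comm_ring_hom_pconst])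
      moreover have "b \<kappa> v (r, n) = (if v \<in> {v \<in> ?box. r \<le> \<kappa> v} then qq ^ Suc n - 1 else 0)" for v n
        using r by (auto simp: b_def q_factor_def)
      ultimately show ?thesis
        unfolding schur_eq plethysm_at_X AK_Y_eq power_sum_q_minus_1_alphabet
        by (simp only: o_def poly_eval_pconst[OF comm_ring_hom_mconst] poly_eval_pvar[OF comm_ring_hom_mconst] snd_conv)
    qed
    then show ?thesis
      by (simp add: multi_poly_def h.hom_prod)
  qed
  have coeff: "mcoeff (AK_formula m N \<Lambda>) \<alpha> = (\<Sum>\<kappa>\<in>?K. (\<Prod>v\<in>?box. AK_b m (fst v) (\<kappa> v)) *
      ak.B (\<Prod>v\<in>Poly_Mapping.keys \<alpha>. ak.Mser (b \<kappa> v) $ Poly_Mapping.lookup \<alpha> v) (multi_poly m \<Lambda>))"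
  proof -
    have "(\<Prod>i=1..m. \<Prod>j<N. AK_b m i (\<kappa> (i, j))) = (\<Prod>v\<in>?box. AK_b m (fst v) (\<kappa> v))" for \<kappa>
      by (simp add: prod.cartesian_product split_def)
    then show ?thesis
      by (simp only: AK_formula_def mcoeff_sum pleth mcoeff_mconst_mult ak.reproducing_Mser[OF adm])
  qed
  show ?thesis
  proof (cases "Poly_Mapping.keys \<alpha> \<subseteq> ?box")
    case True
    \<comment> \<open>Factors with exponent 0 are 1, by \<open>AK_poly_0\<close> for the sums over
      colours, so the products may run over the whole box and produce exactly the colourings of
      \<open>AK_formula\<close>.\<close>
    have ext: "(\<Prod>v\<in>Poly_Mapping.keys \<alpha>. h v (Poly_Mapping.lookup \<alpha> v)) = (\<Prod>v\<in>?box. h v (Poly_Mapping.lookup \<alpha> v))"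
      if "\<And>v. v \<in> ?box \<Longrightarrow> h v 0 = 1" for h :: "nat \<times> nat \<Rightarrow> nat \<Rightarrow> (nat \<times> nat, K) pl"
      using True that by (intro prod.mono_neutral_left) (auto simp: in_keys_iff)
    have "(\<Prod>v\<in>Poly_Mapping.keys \<alpha>. AK_poly m (fst v) (Poly_Mapping.lookup \<alpha> v)) =
        (\<Prod>v\<in>?box. AK_poly m (fst v) (Poly_Mapping.lookup \<alpha> v))"
      by (rule ext) (rule AK_poly_0[OF m])
    also have "\<dots> = (\<Sum>\<kappa>\<in>?K. \<Prod>v\<in>?box. pconst (AK_b m (fst v) (\<kappa> v)) * ak.Mser (q_factor m (\<kappa> v)) $ Poly_Mapping.lookup \<alpha> v)"
      unfolding AK_poly_def by (rule prod_sum_PiE) auto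
    also have "\<dots> = (\<Sum>\<kappa>\<in>?K. pconst (\<Prod>v\<in>?box. AK_b m (fst v) (\<kappa> v)) *
        (\<Prod>v\<in>Poly_Mapping.keys \<alpha>. ak.Mser (b \<kappa> v) $ Poly_Mapping.lookup \<alpha> v))"
    proof (rule sum.cong[OF refl])
      fix \<kappa>
      have "(\<Prod>v\<in>Poly_Mapping.keys \<alpha>. ak.Mser (b \<kappa> v) $ Poly_Mapping.lookup \<alpha> v) =
          (\<Prod>v\<in>?box. ak.Mser (b \<kappa> v) $ Poly_Mapping.lookup \<alpha> v)"
        by (rule ext) simp
      also have "\<dots> = (\<Prod>v\<in>?box. ak.Mser (q_factor m (\<kappa> v)) $ Poly_Mapping.lookup \<alpha> v)"
        by (rule prod.cong) (simp_all add: b_def)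
      finally show "(\<Prod>v\<in>?box. pconst (AK_b m (fst v) (\<kappa> v)) * ak.Mser (q_factor m (\<kappa> v)) $ Poly_Mapping.lookup \<alpha> v) =
          pconst (\<Prod>v\<in>?box. AK_b m (fst v) (\<kappa> v)) *
          (\<Prod>v\<in>Poly_Mapping.keys \<alpha>. ak.Mser (b \<kappa> v) $ Poly_Mapping.lookup \<alpha> v)"
        by (simp add: prod.distrib pconst.hom_prod)
    qed
    finally show ?thesis
      using True by (simp add: coeff AK_chi_eq[OF \<Lambda>] form_sum_left form_pconst_mult_left)
  next
    case False
    then obtain v where v: "v \<in> Poly_Mapping.keys \<alpha>" "v \<notin> ?box" by blast
    then have "ak.Mser (b \<kappa> v) $ Poly_Mapping.lookup \<alpha> v = 0" for \<kappa>
      by (simp add: b_def in_keys_iff)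
    then have "(\<Prod>v\<in>Poly_Mapping.keys \<alpha>. ak.Mser (b \<kappa> v) $ Poly_Mapping.lookup \<alpha> v) = 0" for \<kappa>
      using v by (intro prod_zero) auto
    then show ?thesis
      using False by (simp add: coeff)
  qed
qed

theorem AK_part:
  assumes "\<Lambda> \<in> multipartitions m" "m \<ge> 1"
  shows "restrict_vars (UNIV \<times> {..<N}) (AK_G m \<Lambda>) = AK_formula m N \<Lambda>"
proof (rule mfps_eqI)
  fix \<alpha>
  have "Poly_Mapping.keys \<alpha> \<subseteq> {1..m} \<times> {..<N} \<longleftrightarrow> Poly_Mapping.keys \<alpha> \<subseteq> UNIV \<times> {..<N} \<and> \<alpha> \<in> arrays m"
    by (auto simp: arrays_def)
  then show "mcoeff (restrict_vars (UNIV \<times> {..<N}) (AK_G m \<Lambda>)) \<alpha> = mcoeff (AK_formula m N \<Lambda>) \<alpha>"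
    by (simp add: mcoeff_AK_formula assms restrict_vars_def AK_G_def del: One_nat_def)
qed

theorem AK_stable:
  assumes "\<Lambda> \<in> multipartitions m" "m \<ge> 1"
  shows "stable_limit (\<lambda>N. AK_formula m N \<Lambda>) (AK_G m \<Lambda>)"
  unfolding stable_limit_def
proof
  fix \<mu> :: "nat \<times> nat \<Rightarrow>\<^sub>0 nat"
  obtain M where "snd ` Poly_Mapping.keys \<mu> \<subseteq> {..<M}"
    using finite_nat_iff_bounded[of "snd ` Poly_Mapping.keys \<mu>"] by auto
  then have M: "Poly_Mapping.keys \<mu> \<subseteq> UNIV \<times> {..<M}"
    by force
  have "\<forall>\<^sub>F N in sequentially. M \<le> N" by (rule eventually_ge_at_top)
  then show "\<forall>\<^sub>F N in sequentially. mcoeff (AK_formula m N \<Lambda>) \<mu> = mcoeff (AK_G m \<Lambda>) \<mu>"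
  proof eventually_elim
    case (elim N)
    then have "Poly_Mapping.keys \<mu> \<subseteq> UNIV \<times> {..<N}" using M by force
    then show ?case
      by (simp add: restrict_vars_def flip: AK_part[OF assms])
  qed
qed

theorem theorem2:
  shows "(\<forall>m \<ge> 1. \<forall>\<Lambda> \<in> multipartitions m.
            (\<forall>N \<ge> 1. restrict_vars (UNIV \<times> {..<N}) (AK_G m \<Lambda>) = AK_formula m N \<Lambda>) \<and>
            stable_limit (\<lambda>N. AK_formula m N \<Lambda>) (AK_G m \<Lambda>)) \<and>
         (\<forall>\<nu> \<in> strict_partitions.
            HC_G \<nu> = mconst (2 powi ((- int (length \<nu>) + int (delta \<nu>)) div 2)) *
              plethysm (schur_Q \<nu>) (q_minus_1 * alphabet UNIV)) \<and>
         (\<forall>\<pi> \<in> partitions.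
            rook_G \<pi> = sigma_Z * plethysm (schur \<pi>) (q_minus_1 * alphabet UNIV))"
  using AK_part AK_stable HC_part rook_part by blast

end
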